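(* Let $D=1$, let $m\in(2,6)$ be real and put $\epsilon=m/2-1\in(0,2)$. Let $p>0$ and $q\ge 0$. Then the integral $I_{1,m}(p,q)$ (defined in the context) satisfies $$I_{1,m}(p,q) = -\frac1p\,\frac{\Gamma(-\epsilon)}{2^{1+4\epsilon}\,\pi^{1+\epsilon}}\; \operatorname{Im}\left[(q^2-2ip)^{-1+\epsilon}\;{}_2F_1\Big(1,1-\epsilon;1+\epsilon;\frac{-q^2}{q^2-2ip}\Big)\right],$$ where for $\epsilon=1$ (i.e. $m=4$) the right-hand side is understood as its limit as $\epsilon\to1$.
   Context: For positive integers $D,m$ and vectors $\boldsymbol p\in\mathbb R^D$, $\boldsymbol q\in\mathbb R^m$ with Euclidean norms $p=|\boldsymbol p|$, $q=|\boldsymbol q|$, define $$I_{D,m}(p,q)=\int_{\mathbb R^m}\frac{d^m y}{(2\pi)^m}\int_{\mathbb R^D}\frac{d^D x}{(2\pi)^D}\;\frac1{|\boldsymbol x-\boldsymbol p/2|^2+|\boldsymbol y-\boldsymbol q/2|^4}\;\frac1{|\boldsymbol x+\boldsymbol p/2|^2+|\boldsymbol y+\boldsymbol q/2|^4}.$$ By rotational symmetry in each of the subspaces this depends only on $p$ and $q$. For non-integer real $m$ the integral over $\boldsymbol y$ is understood in the usual sense of continuous dimension: for an integrand $f$ depending on $\boldsymbol y$ only through $r=|\boldsymbol y|$ and the angle $\theta$ between $\boldsymbol y$ and $\boldsymbol q$, $$\int d^m y\, f = \frac{2\pi^{(m-1)/2}}{\Gamma((m-1)/2)}\int_0^\infty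 r^{m-1}\int_0^\pi (\sin\theta)^{m-2} f(r,\theta)\,d\theta\,dr .$$ Here ${}_2F_1$ is the Gauss hypergeometric function, and complex powers are principal values. *)

theory Defs
  imports "HOL-Analysis.Analysis"
begin

text \<open>
  The integral over \<open>x \<in> \<real>\<^sup>D\<close> (with \<open>D = DIM('a)\<close>). The variable \<open>y\<close> enters the integrand only
  through the distances \<open>u = |y - q/2|\<close> and \<open>v = |y + q/2|\<close>, so these are the parameters here.
\<close>

definition x_integral :: "'a::euclidean_space \<Rightarrow> real \<Rightarrow> real \<Rightarrow> real" where
  "x_integral P u v =
     (LINT x|lborel.
        1 / (norm (x - P /\<^sub>R 2) ^ 2 + u ^ 4) * (1 / (norm (x + P /\<^sub>R 2) ^ 2 + v ^ 4)))
     / (2 * pi) ^ DIM('a)"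

text \<open>\<open>I\<^bsub>D,m\<^esub>\<close> for integer \<open>m = DIM('b)\<close>, as a function of the two external vectors.\<close>

definition I_int :: "'a::euclidean_space \<Rightarrow> 'b::euclidean_space \<Rightarrow> real" where
  "I_int P Q =
     (LINT y|lborel. x_integral P (norm (y - Q /\<^sub>R 2)) (norm (y + Q /\<^sub>R 2))) / (2 * pi) ^ DIM('b)"

text \<open>
  Integration in continuous dimension \<open>m\<close> of a function \<open>f r \<theta>\<close> of the radius and of the angle
  between \<open>y\<close> and a fixed direction.
\<close>

definition cont_dim_integral :: "real \<Rightarrow> (real \<Rightarrow> real \<Rightarrow> real) \<Rightarrow> real" where
  "cont_dim_integral m f =
     2 * pi powr ((m - 1) / 2) / Gamma ((m - 1) / 2) *
     (LINT r:{0<..}|lborel.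
        r powr (m - 1) * (LINT \<theta>:{0..pi}|lborel. sin \<theta> powr (m - 2) * f r \<theta>))"

text \<open>
  \<open>I\<^bsub>D,m\<^esub>\<close> for real \<open>m\<close>, with \<open>q = |Q|\<close>; here
  \<open>|y \<mp> Q/2|\<^sup>2 = r\<^sup>2 \<mp> r q cos \<theta> + q\<^sup>2/4\<close>.
\<close>

definition I_cont :: "real \<Rightarrow> 'a::euclidean_space \<Rightarrow> real \<Rightarrow> real" where
  "I_cont m P q =
     cont_dim_integral m
       (\<lambda>r \<theta>. x_integral P (sqrt (r\<^sup>2 - r * q * cos \<theta> + q\<^sup>2 / 4))
                             (sqrt (r\<^sup>2 + r * q * cos \<theta> + q\<^sup>2 / 4)))
     / (2 * pi) powr m"

text \<open>
  The Gauss series, which represents \<open>\<^sub>2F\<^sub>1(a,b;c;z)\<close> for \<open>|z| < 1\<close>. This covers every use below: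
  \<open>|-q\<^sup>2/(q\<^sup>2 - 2ip)| < 1\<close> for \<open>p > 0\<close>.
\<close>

definition gauss_2F1 :: "complex \<Rightarrow> complex \<Rightarrow> complex \<Rightarrow> complex \<Rightarrow> complex" where
  "gauss_2F1 a b c z = eval_fps (fps_hypergeo [a, b] [c] 1) z"

definition closed_form :: "real \<Rightarrow> real \<Rightarrow> real \<Rightarrow> real" where
  "closed_form p q \<epsilon> =
     (let w = complex_of_real (q\<^sup>2) - 2 * \<i> * complex_of_real p in
        - (1 / p) * (Gamma (- \<epsilon>) / (2 powr (1 + 4 * \<epsilon>) * pi powr (1 + \<epsilon>))) *
        Im (w powr (complex_of_real (- 1 + \<epsilon>)) *
            gauss_2F1 1 (1 - complex_of_real \<epsilon>) (1 + complex_of_real \<epsilon>)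
              (- complex_of_real (q\<^sup>2) / w)))"

text \<open>
  \<open>Gamma (-1) = 0\<close> by convention in the library, so \<open>closed_form p q 1\<close> is meaningless and
  is replaced by the limit, whose existence is part of the claim.
\<close>

definition equals_closed_form :: "real \<Rightarrow> real \<Rightarrow> real \<Rightarrow> real \<Rightarrow> bool" where
  "equals_closed_form J p q \<epsilon> \<longleftrightarrow>
     (if \<epsilon> = 1 then (closed_form p q \<longlongrightarrow> J) (at 1) else J = closed_form p q \<epsilon>)"

end

theory Submission
  imports Defs "HOL-Probability.Distributions"
begin

text \<open>
  Why the formula holds. Put \<open>A = |y - q/2|\<^sup>2\<close>, \<open>B = |y + q/2|\<^sup>2\<close> and \<open>S = A + B\<close>. The integral over
  \<open>x \<in> \<real>\<close> is the convolution of two Lorentz profiles, and it equals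
  \<open>(1/A + 1/B) / (2 (p\<^sup>2 + S\<^sup>2))\<close> (\<open>x_integral_real\<close>). By the reflection symmetry in \<open>q\<close> it remains to
  integrate \<open>1 / (A (p\<^sup>2 + S\<^sup>2))\<close> over \<open>y\<close>.

  Both factors are turned into exponentials:
  \<open>1/A = \<integral>\<^sub>0\<^sup>\<infinity> exp (-\<alpha> A) d\<alpha>\<close> and \<open>p / (p\<^sup>2 + S\<^sup>2) = \<integral>\<^sub>0\<^sup>\<infinity> sin (p \<beta>) exp (-\<beta> S) d\<beta>\<close>. The integral over
  \<open>y\<close> is then the Gaussian integral of \<open>exp (-\<alpha> A - \<beta> S)\<close>, whose value
  \<open>(\<pi> / (\<alpha> + 2\<beta>))\<^bsup>m/2\<^esup> exp (-\<alpha>\<beta>q\<^sup>2 / (2 (\<alpha> + 2\<beta>)) - \<beta>q\<^sup>2/2)\<close> has the same form in continuous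
  dimension \<open>m\<close> and in \<open>\<real>\<^sup>m\<close>. Apart from \<open>A > 0\<close> almost everywhere, the argument needs
  nothing else about the \<open>y\<close>-integration, so this is isolated in the locale \<open>gaussian_pair\<close>, and one computation
  (\<open>propagator_integral\<close>) serves both parts of the theorem.

  With \<open>\<alpha> = 2\<beta> (1/v - 1)\<close>, \<open>0 < v < 1\<close>, the exponent becomes \<open>-\<beta> q\<^sup>2 (1 - v/2)\<close> and the powers of
  \<open>\<beta>\<close> and \<open>v\<close> separate into \<open>\<beta>\<^bsup>-\<epsilon>\<^esup> v\<^bsup>\<epsilon>-1\<^esup>\<close>. The \<open>\<beta>\<close>-integral is a sine transform, equal to
  \<open>\<Gamma>(1-\<epsilon>) Im (a - ip)\<^bsup>\<epsilon>-1\<^esup>\<close> with \<open>a = q\<^sup>2 (1 - v/2)\<close> (\<open>sine_transform_integral\<close>). Writing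
  \<open>w = q\<^sup>2 - 2ip\<close> and \<open>z = -q\<^sup>2/w\<close> gives \<open>a - ip = (w/2) (1 - z (1 - v))\<close>, and the remaining integral
  over \<open>v\<close> is Euler's integral for \<open>\<^sub>2F\<^sub>1(1, 1-\<epsilon>; 1+\<epsilon>; z)\<close> (\<open>Euler_integral_2F1\<close>).

  For \<open>q = 0\<close> and \<open>\<epsilon> \<le> 1\<close> the double integral over \<open>\<beta>\<close> and \<open>v\<close> does not converge absolutely. The
  interchange is therefore made with \<open>S + \<delta>\<close> in place of \<open>S\<close>, after which \<open>\<delta>\<close> tends to \<open>0\<close>. At
  \<open>\<epsilon> = 1\<close> the sine transform is \<open>-Arg (a - ip)\<close>, the limit of its values for \<open>\<epsilon> \<noteq> 1\<close>, and dominated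
  convergence in \<open>v\<close> carries this limit over to the closed form (\<open>reduced_integral_tendsto\<close>).
\<close>

section \<open>Gaussian, Gamma and Beta integrals\<close>

lemma nn_integral_gaussian:
  fixes \<gamma> c :: real
  assumes "\<gamma> > 0"
  shows "(\<integral>\<^sup>+x. ennreal (exp (- \<gamma> * (x - c)\<^sup>2)) \<partial>lborel) = ennreal (sqrt (pi / \<gamma>))"
proof -
  define \<sigma> where "\<sigma> = 1 / sqrt (2 * \<gamma>)"
  have \<sigma>: "\<sigma> > 0" "\<sigma>\<^sup>2 = 1 / (2 * \<gamma>)"
    using assms by (auto simp: \<sigma>_def power_divide)
  have eq: "exp (- \<gamma> * (x - c)\<^sup>2) = sqrt (pi / \<gamma>) * normal_density c \<sigma> x" for x
    using assms unfolding normal_density_def \<sigma>(2) by (simp add: mult.commute)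
  have "(\<integral>\<^sup>+x. ennreal (exp (- \<gamma> * (x - c)\<^sup>2)) \<partial>lborel)
      = ennreal (LINT x|lborel. sqrt (pi / \<gamma>) * normal_density c \<sigma> x)"
    unfolding eq using \<sigma> assms by (intro nn_integral_eq_integral) auto
  also have "\<dots> = ennreal (sqrt (pi / \<gamma>))"
    using \<sigma> by simp
  finally show ?thesis .
qed

lemma nn_integral_Gamma_scaled:
  fixes s a :: real
  assumes "s > 0" "a > 0"
  shows "(\<integral>\<^sup>+x. ennreal (x powr (s - 1) * exp (- a * x)) * indicator {0<..} x \<partial>lborel)
           = ennreal (Gamma s / a powr s)"
proof -
  define f where "f = (\<lambda>t. ennreal (indicator {0..} t * t powr (s - 1) / exp t))"
  have "ennreal (a powr s * (Gamma s / a powr s)) = integral\<^sup>N lborel f"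
    using assms Gamma_conv_nn_integral_real[of s] by (simp add: f_def)
  also have "\<dots> = \<bar>a\<bar> * (\<integral>\<^sup>+x. f (0 + a * x) \<partial>lborel)"
    using assms by (intro nn_integral_real_affine) (auto simp: f_def)
  also have "(\<integral>\<^sup>+x. f (0 + a * x) \<partial>lborel) =
     (\<integral>\<^sup>+x. ennreal (a powr (s - 1)) * (ennreal (x powr (s - 1) * exp (- a * x)) * indicator {0<..} x) \<partial>lborel)"
    using assms
    by (intro nn_integral_cong_AE AE_I[of _ _ "{0}"])
       (auto simp: f_def indicator_def zero_le_mult_iff powr_mult exp_minus field_simps ennreal_mult[symmetric])
  also have "\<dots> = ennreal (a powr (s - 1)) * (\<integral>\<^sup>+x. ennreal (x powr (s - 1) * exp (- a * x)) * indicator {0<..} x \<partial>lborel)"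
    by (intro nn_integral_cmult) auto
  also have "ennreal \<bar>a\<bar> * \<dots> = ennreal (a powr s) * (\<integral>\<^sup>+x. ennreal (x powr (s - 1) * exp (- a * x)) * indicator {0<..} x \<partial>lborel)"
    using assms by (simp add: mult.assoc[symmetric] ennreal_mult[symmetric] powr_diff)
  finally have "ennreal (a powr s) * ennreal (Gamma s / a powr s) = 
     ennreal (a powr s) * (\<integral>\<^sup>+x. ennreal (x powr (s - 1) * exp (- a * x)) * indicator {0<..} x \<partial>lborel)"
    by (subst ennreal_mult'[symmetric]) auto
  then show ?thesis
    using assms by (subst (asm) ennreal_mult_cancel_left) auto
qed

lemma set_integrable_Gamma:
  fixes s a :: real
  assumes "s > 0" "a > 0"
  shows "set_integrable lborel {0<..} (\<lambda>x. x powr (s - 1) * exp (- a * x))"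
  unfolding set_integrable_def
proof (rule integrableI_nonneg)
  have "(\<integral>\<^sup>+x. ennreal (indicator {0<..} x *\<^sub>R (x powr (s - 1) * exp (- a * x))) \<partial>lborel)
     = (\<integral>\<^sup>+x. ennreal (x powr (s - 1) * exp (- a * x)) * indicator {0<..} x \<partial>lborel)"
    by (intro nn_integral_cong) (auto simp: indicator_def)
  then show "(\<integral>\<^sup>+x. ennreal (indicator {0<..} x *\<^sub>R (x powr (s - 1) * exp (- a * x))) \<partial>lborel) < \<infinity>"
    using nn_integral_Gamma_scaled[OF assms] by simp
qed auto

lemma set_lebesgue_integral_Gamma:
  fixes s a :: real
  assumes "s > 0" "a > 0"
  shows "(LINT x:{0<..}|lborel. x powr (s - 1) * exp (- a * x)) = Gamma s / a powr s"
proof -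
  have "(\<integral>\<^sup>+x. ennreal (indicator {0<..} x *\<^sub>R (x powr (s - 1) * exp (- a * x))) \<partial>lborel)
     = (\<integral>\<^sup>+x. ennreal (x powr (s - 1) * exp (- a * x)) * indicator {0<..} x \<partial>lborel)"
    by (intro nn_integral_cong) (auto simp: indicator_def)
  then show ?thesis
    unfolding set_lebesgue_integral_def
    using nn_integral_Gamma_scaled[OF assms] assms
    by (intro integral_eq_nn_integral[THEN trans]) (auto)
qed

lemma Beta_nat_eq:
  assumes \<epsilon>: "\<epsilon> > (0::real)"
  shows "Beta \<epsilon> (real n + 1) = fact n / (\<epsilon> * pochhammer (1 + \<epsilon>) n)"
proof -
  have nz: "\<epsilon> \<notin> \<int>\<^sub>\<le>\<^sub>0" "1 + \<epsilon> \<notin> \<int>\<^sub>\<le>\<^sub>0" using \<epsilon> by auto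
  have pos: "Gamma \<epsilon> > 0" "Gamma (1 + \<epsilon>) > 0" "pochhammer (1 + \<epsilon>) n > 0"
    using \<epsilon> by (auto intro!: Gamma_real_pos pochhammer_pos)
  have "Gamma (1 + \<epsilon>) = \<epsilon> * Gamma \<epsilon>"
    using Gamma_plus1[of \<epsilon>] nz(1) by (simp add: add.commute)
  moreover have "Gamma (1 + \<epsilon> + real n) = pochhammer (1 + \<epsilon>) n * Gamma (1 + \<epsilon>)"
    unfolding pochhammer_Gamma[OF nz(2), of n] using pos(2) by simp
  ultimately have "Gamma (\<epsilon> + (real n + 1)) = pochhammer (1 + \<epsilon>) n * (\<epsilon> * Gamma \<epsilon>)"
    by (simp add: add_ac)
  moreover have "Gamma (real n + 1) = fact n" using Gamma_fact[of n, where 'a = real] by (simp add: add.commute)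
  ultimately show ?thesis
    using \<epsilon> pos(3) less_imp_neq[OF pos(1)] by (simp add: Beta_def)
qed

lemma Beta_weight:
  assumes \<epsilon>: "\<epsilon> > (0::real)"
  shows "set_integrable lborel {0<..<1} (\<lambda>v. v powr (\<epsilon> - 1) * (1 - v) ^ n)" (is ?thesis1)
    and "(LINT v:{0<..<1}|lborel. v powr (\<epsilon> - 1) * (1 - v) ^ n) = fact n / (\<epsilon> * pochhammer (1 + \<epsilon>) n)" (is ?thesis2)
proof -
  have eq: "indicator {0<..<1} v *\<^sub>R (v powr (\<epsilon> - 1) * (1 - v) ^ n) =
     indicator {0..1} v *\<^sub>R (v powr (\<epsilon> - 1) * (1 - v) powr (real n + 1 - 1))" if "v \<noteq> 1" for v
    using that by (auto simp: indicator_def powr_realpow)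
  have AE: "AE v in lborel. indicator {0<..<1} v *\<^sub>R (v powr (\<epsilon> - 1) * (1 - v) ^ n) =
     indicator {0..1} v *\<^sub>R (v powr (\<epsilon> - 1) * (1 - v) powr (real n + 1 - 1))"
    using AE_lborel_singleton[of 1] by eventually_elim (rule eq)
  have I: "set_integrable lborel {0..1} (\<lambda>v. v powr (\<epsilon> - 1) * (1 - v) powr (real n + 1 - 1))"
    by (rule integrable_Beta) (use \<epsilon> in auto)
  show ?thesis1
    using I unfolding set_integrable_def by (subst integrable_cong_AE[OF _ _ AE]) auto
  have "(LINT v:{0<..<1}|lborel. v powr (\<epsilon> - 1) * (1 - v) ^ n) =
      (LINT v:{0..1}|lborel. v powr (\<epsilon> - 1) * (1 - v) powr (real n + 1 - 1))"
    unfolding set_lebesgue_integral_def by (rule integral_cong_AE[OF _ _ AE]) auto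
  also have "\<dots> = Beta \<epsilon> (real n + 1)"
    using set_borel_integral_eq_integral(2)[OF I] has_integral_Beta_real[of \<epsilon> "real n + 1"] \<epsilon>
    by (simp add: integral_unique)
  finally show ?thesis2 unfolding Beta_nat_eq[OF \<epsilon>] .
qed

section \<open>The sine transform of a Gamma density\<close>

lemma has_vector_derivative_iff_slope:
  fixes f :: "real \<Rightarrow> 'b::real_normed_vector"
  shows "(f has_vector_derivative D) (at x) \<longleftrightarrow> ((\<lambda>t. (f t - f x) /\<^sub>R (t - x)) \<longlongrightarrow> D) (at x)"
proof -
  have "(f has_vector_derivative D) (at x) \<longleftrightarrow>
      ((\<lambda>t. norm ((1 / norm (t - x)) *\<^sub>R (f t - (f x + (t - x) *\<^sub>R D)))) \<longlongrightarrow> 0) (at x)"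
    unfolding has_vector_derivative_def has_derivative_at2 tendsto_norm_zero_iff
    by (simp add: bounded_linear_scaleR_left)
  also have "\<dots> \<longleftrightarrow> ((\<lambda>t. norm ((f t - f x) /\<^sub>R (t - x) - D)) \<longlongrightarrow> 0) (at x)"
  proof (rule filterlim_cong[OF refl refl])
    have "norm ((1 / norm (t - x)) *\<^sub>R (f t - (f x + (t - x) *\<^sub>R D))) = norm ((f t - f x) /\<^sub>R (t - x) - D)"
      if "t \<noteq> x" for t
    proof -
      have "(f t - f x) /\<^sub>R (t - x) - D = (f t - (f x + (t - x) *\<^sub>R D)) /\<^sub>R (t - x)"
        using that by (simp add: diff_diff_eq[symmetric] scaleR_diff_right[of _ _ "(t - x) *\<^sub>R D"])
      then show ?thesis by (simp add: divide_inverse)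
    qed
    then show "\<forall>\<^sub>F t in at x. norm ((1 / norm (t - x)) *\<^sub>R (f t - (f x + (t - x) *\<^sub>R D))) = norm ((f t - f x) /\<^sub>R (t - x) - D)"
      by (auto simp: eventually_at_filter)
  qed
  also have "\<dots> \<longleftrightarrow> ((\<lambda>t. (f t - f x) /\<^sub>R (t - x)) \<longlongrightarrow> D) (at x)"
    unfolding tendsto_norm_zero_iff by (rule LIM_zero_iff)
  finally show ?thesis .
qed

text \<open>
  Differentiation under the integral sign: by the mean value inequality the domination of the
  derivative carries over to the difference quotients.
\<close>

lemma has_vector_derivative_lebesgue_integral:
  fixes f f' :: "real \<Rightarrow> 'a \<Rightarrow> 'b::{banach, second_countable_topology}"
  assumes f: "\<And>x. integrable M (f x)"
    and f': "f' x \<in> borel_measurable M"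
    and deriv: "\<And>x y. y \<in> space M \<Longrightarrow> ((\<lambda>x. f x y) has_vector_derivative f' x y) (at x)"
    and bound: "\<And>x y. y \<in> space M \<Longrightarrow> norm (f' x y) \<le> w y"
    and w: "integrable M w"
  shows "((\<lambda>x. integral\<^sup>L M (f x)) has_vector_derivative integral\<^sup>L M (f' x)) (at x)"
proof -
  have lim: "((\<lambda>t. integral\<^sup>L M (\<lambda>y. (f t y - f x y) /\<^sub>R (t - x))) \<longlongrightarrow> integral\<^sup>L M (f' x)) (at x)"
  proof (unfold tendsto_at_iff_sequentially, intro allI impI)
    fix X :: "nat \<Rightarrow> real" assume X: "\<forall>i. X i \<in> UNIV - {x}" "X \<longlonglongrightarrow> x"
    show "((\<lambda>t. integral\<^sup>L M (\<lambda>y. (f t y - f x y) /\<^sub>R (t - x))) \<circ> X) \<longlonglongrightarrow> integral\<^sup>L M (f' x)"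
      unfolding o_def
    proof (rule integral_dominated_convergence[OF _ _ w])
      show "AE y in M. (\<lambda>i. (f (X i) y - f x y) /\<^sub>R (X i - x)) \<longlonglongrightarrow> f' x y"
      proof (rule AE_I2)
        fix y assume y: "y \<in> space M"
        have "((\<lambda>t. (f t y - f x y) /\<^sub>R (t - x)) \<longlongrightarrow> f' x y) (at x)"
          using deriv[OF y, of x] unfolding has_vector_derivative_iff_slope .
        then show "(\<lambda>i. (f (X i) y - f x y) /\<^sub>R (X i - x)) \<longlonglongrightarrow> f' x y"
          using X unfolding tendsto_at_iff_sequentially o_def by auto
      qed
      show "AE y in M. norm ((f (X i) y - f x y) /\<^sub>R (X i - x)) \<le> w y" for i
      proof (rule AE_I2)
        fix y assume y: "y \<in> space M"
        have "norm (f (X i) y - f x y) \<le> w y * norm (X i - x)"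
        proof (rule differentiable_bound[OF convex_UNIV])
          show "((\<lambda>x. f x y) has_derivative (\<lambda>h. h *\<^sub>R f' t y)) (at t within UNIV)" for t
            using deriv[OF y, of t] by (simp add: has_vector_derivative_def)
          show "onorm (\<lambda>h. h *\<^sub>R f' t y) \<le> w y" for t
            using bound[OF y, of t] by (intro onorm_le) (simp add: mult.commute[of "w y"] mult_left_mono)
        qed auto
        moreover have "X i \<noteq> x" using X by auto
        ultimately show "norm ((f (X i) y - f x y) /\<^sub>R (X i - x)) \<le> w y"
          by (simp add: divide_simps mult.commute)
      qed
    qed (use f f' in \<open>auto intro!: borel_measurable_integrable\<close>)
  qed
  have "integral\<^sup>L M (\<lambda>y. (f t y - f x y) /\<^sub>R (t - x)) = (integral\<^sup>L M (f t) - integral\<^sup>L M (f x)) /\<^sub>R (t - x)" for t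
    using f by simp
  with lim have "((\<lambda>t. (integral\<^sup>L M (f t) - integral\<^sup>L M (f x)) /\<^sub>R (t - x)) \<longlongrightarrow> integral\<^sup>L M (f' x)) (at x)"
    by (simp only:)
  then show ?thesis
    unfolding has_vector_derivative_iff_slope .
qed

text \<open>
  Write \<open>E s\<close> for the integral and \<open>c = a - ix\<close>. At \<open>x = 0\<close> it is a rescaled Gamma integral.
  Differentiation in \<open>x\<close> gives \<open>i E (s + 1)\<close>, and integration by parts gives \<open>c E (s + 1) = s E s\<close>, so
  \<open>c\<^sup>s E s\<close> does not depend on \<open>x\<close>.
\<close>

lemma Gamma_integral_complex_scale:
  fixes s a x :: real
  assumes s: "s > 0" and a: "a > 0"
  shows "(LINT t:{0<..}|lborel. of_real (t powr (s - 1)) * exp (- (Complex a (-x)) * of_real t))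
           = of_real (Gamma s) * Complex a (-x) powr (- of_real s)"
proof -
  define f where "f = (\<lambda>s x t. indicator {0<..} t *\<^sub>R (complex_of_real (t powr (s - 1)) * exp (- (Complex a (-x)) * of_real t)))"
  define E where "E = (\<lambda>s x. integral\<^sup>L lborel (f s x))"
  define w where "w = (\<lambda>s t. indicator {0<..} t *\<^sub>R (t powr (s - 1) * exp (- a * t)))"
  have w_int: "integrable lborel (w s)" if "s > 0" for s
    using set_integrable_Gamma[OF that a] unfolding w_def set_integrable_def .
  have norm_f: "norm (f s x t) = w s t" for s x t
    unfolding f_def w_def by (auto simp: norm_mult indicator_def)
  have f_meas [measurable]: "f s x \<in> borel_measurable borel" for s x
    unfolding f_def by measurable
  have f_int: "integrable lborel (f s x)" if "s > 0" for s x
    by (rule Bochner_Integration.integrable_bound[OF w_int[OF that]]) (auto simp: norm_f)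
  have E_deriv: "(E s has_vector_derivative (\<i> * E (s + 1) x)) (at x)" if "s > 0" for s x
  proof -
    have "(E s has_vector_derivative integral\<^sup>L lborel (\<lambda>t. \<i> * f (s + 1) x t)) (at x)"
      unfolding E_def
    proof (rule has_vector_derivative_lebesgue_integral[where w = "w (s + 1)"])
      show "((\<lambda>x. f s x t) has_vector_derivative \<i> * f (s + 1) x t) (at x)" for x t
      proof (cases "t > 0")
        case True
        have "((\<lambda>x. complex_of_real (t powr (s - 1)) * exp (- (of_real a - \<i> * of_real x) * of_real t)) 
            has_vector_derivative complex_of_real (t powr (s - 1)) * (exp (- (of_real a - \<i> * of_real x) * of_real t) * (\<i> * of_real t))) (at x)"
          by (rule derivative_eq_intros refl exI has_vector_derivative_real_field | simp)+
        moreover have "complex_of_real (t powr s) = of_real (t powr (s - 1)) * of_real t"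
          using True by (simp add: powr_diff)
        ultimately show ?thesis
          using True by (simp add: f_def Complex_eq mult_ac)
      qed (simp add: f_def)
    qed (use that in \<open>auto intro!: f_int w_int simp: norm_mult norm_f\<close>)
    then show ?thesis by (simp add: E_def)
  qed
  \<comment> \<open>integration by parts: the derivative of \<open>t\<^sup>s exp (-ct)\<close> integrates to \<open>0\<close>\<close>
  have rec: "Complex a (-x) * E (s + 1) x = of_real s * E s x" if s: "s > 0" for s x
  proof -
    define c where "c = Complex a (-x)"
    define F where "F = (\<lambda>t. complex_of_real (t powr s) * exp (- c * of_real t))"
    have Re_c: "Re c = a" by (simp add: c_def)
    have int1: "set_integrable lborel {0<..} (\<lambda>t. complex_of_real (t powr (s - 1)) * exp (- c * of_real t))"
      using f_int[OF s, of x] by (simp add: f_def c_def set_integrable_def)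
    have int2: "set_integrable lborel {0<..} (\<lambda>t. complex_of_real (t powr s) * exp (- c * of_real t))"
      using f_int[of "s + 1" x] s by (simp add: f_def c_def set_integrable_def)
    have ivl: "einterval 0 \<infinity> = {0<..}" by (auto simp: einterval_iff)
    have "(LBINT t=0..\<infinity>. of_real s * (complex_of_real (t powr (s - 1)) * exp (- c * of_real t))
             - c * (complex_of_real (t powr s) * exp (- c * of_real t))) = 0 - 0"
    proof (rule interval_integral_FTC_integrable[where F = F])
      show "(F has_vector_derivative of_real s * (complex_of_real (t powr (s - 1)) * exp (- c * of_real t))
             - c * (complex_of_real (t powr s) * exp (- c * of_real t))) (at t)" if "0 < ereal t" for t
      proof -
        have t: "t > 0" using that by simp
        have "((\<lambda>t. t powr s) has_vector_derivative s * t powr (s - 1)) (at t)"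
          using t by (auto intro!: derivative_eq_intros simp flip: has_real_derivative_iff_has_vector_derivative)
        then have 1: "((\<lambda>t. complex_of_real (t powr s)) has_vector_derivative of_real (s * t powr (s - 1))) (at t)"
          by (rule bounded_linear.has_vector_derivative[OF bounded_linear_of_real])
        have 2: "((\<lambda>t. exp (- c * of_real t)) has_vector_derivative (- c * exp (- c * of_real t))) (at t)"
          by (rule derivative_eq_intros refl exI has_vector_derivative_real_field | simp)+
        show ?thesis
          unfolding F_def using has_vector_derivative_mult[OF 1 2] by (simp add: algebra_simps)
      qed
      show "isCont (\<lambda>t. of_real s * (complex_of_real (t powr (s - 1)) * exp (- c * of_real t))
             - c * (complex_of_real (t powr s) * exp (- c * of_real t))) t" if "0 < ereal t" for t
        using that by (intro continuous_intros) auto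
      show "set_integrable lborel (einterval 0 \<infinity>)
          (\<lambda>t. of_real s * (complex_of_real (t powr (s - 1)) * exp (- c * of_real t))
             - c * (complex_of_real (t powr s) * exp (- c * of_real t)))"
        unfolding ivl by (intro set_integral_diff set_integrable_mult_right int1 int2)
      have "((\<lambda>t. t powr s) \<longlongrightarrow> 0) (at_right 0)"
        using s by (intro tendsto_zero_powrI[of _ _ _ s])  (auto intro: tendsto_ident_at simp: eventually_at_filter)
      then have "(F \<longlongrightarrow> of_real 0 * exp (- c * of_real 0)) (at_right 0)"
        unfolding F_def by (intro tendsto_intros)
      then show "((F \<circ> real_of_ereal) \<longlongrightarrow> 0) (at_right 0)"
        by (simp add: zero_ereal_def ereal_tendsto_simps)
      have "((\<lambda>t. exp ((s * (ln t / t) - a) * t)) \<longlongrightarrow> 0) at_top"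
      proof (rule filterlim_compose[OF exp_at_bot])
        have "((\<lambda>t. s * (ln t / t) - a) \<longlongrightarrow> s * 0 - a) at_top"
          by (intro tendsto_intros ln_x_over_x_tendsto_0)
        then show "filterlim (\<lambda>t. (s * (ln t / t) - a) * t) at_bot at_top"
          using a by (intro filterlim_tendsto_neg_mult_at_bot[of _ "-a"]) (auto intro: filterlim_ident)
      qed
      moreover have "\<forall>\<^sub>F t in at_top. exp ((s * (ln t / t) - a) * t) = norm (F t)"
        using eventually_gt_at_top[of "0::real"]
        by eventually_elim (simp add: F_def norm_mult Re_c powr_def exp_add[symmetric] algebra_simps)
      ultimately have "((\<lambda>t. norm (F t)) \<longlongrightarrow> 0) at_top"
        by (rule Lim_transform_eventually)
      then have "(F \<longlongrightarrow> 0) at_top"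
        by (simp add: tendsto_norm_zero_iff)
      then show "((F \<circ> real_of_ereal) \<longlongrightarrow> 0) (at_left \<infinity>)"
        by (simp add: ereal_tendsto_simps)
    qed simp
    then have "(LBINT t:{0<..}. of_real s * (complex_of_real (t powr (s - 1)) * exp (- c * of_real t))
             - c * (complex_of_real (t powr s) * exp (- c * of_real t))) = 0"
      by (simp add: interval_lebesgue_integral_0_infty)
    then have "of_real s * (LBINT t:{0<..}. complex_of_real (t powr (s - 1)) * exp (- c * of_real t))
             - c * (LBINT t:{0<..}. (complex_of_real (t powr s) * exp (- c * of_real t))) = 0"
      using int1 int2 by (subst (asm) set_integral_diff) auto
    then show ?thesis
      by (simp add: E_def f_def c_def set_lebesgue_integral_def)
  qed
  have c_nz: "Complex a (-x) \<noteq> 0" "Complex a (-x) \<notin> \<real>\<^sub>\<le>\<^sub>0" for x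
    using a by (auto simp: complex_nonpos_Reals_iff complex_eq_iff)
  have "((\<lambda>x. Complex a (-x) powr (of_real s) * E s x) has_derivative (\<lambda>h. 0)) (at x within UNIV)" for x
  proof -
    have "((\<lambda>z. (of_real a - \<i> * z) powr (of_real s)) has_field_derivative
        (of_real s * (of_real a - \<i> * of_real x) powr (of_real s - 1) * (- \<i>))) (at (of_real x))"
      using c_nz(2)[of x] by (auto intro!: derivative_eq_intros simp: Complex_eq)
    from has_vector_derivative_real_field[OF this]
    have 1: "((\<lambda>x. Complex a (-x) powr (of_real s)) has_vector_derivative
        (- (\<i> * of_real s) * Complex a (-x) powr (of_real s - 1))) (at x)"
      by (simp add: Complex_eq mult_ac)
    have "Complex a (-x) powr of_real s * (\<i> * E (s + 1) x) + - (\<i> * of_real s) * Complex a (-x) powr (of_real s - 1) * E s x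
      = \<i> * Complex a (-x) powr (of_real s - 1) * (Complex a (-x) * E (s + 1) x - of_real s * E s x)"
      using c_nz(1)[of x] by (simp add: powr_diff field_simps)
    also have "\<dots> = 0"
      by (simp add: rec[OF s])
    finally have "((\<lambda>x. Complex a (-x) powr (of_real s) * E s x) has_vector_derivative 0) (at x)"
      using has_vector_derivative_mult[OF 1 E_deriv[OF s, of x]] by (simp only:)
    then show ?thesis
      by (simp add: has_vector_derivative_def)
  qed
  then have "Complex a (-x) powr (of_real s) * E s x = Complex a (-0) powr (of_real s) * E s 0"
    by (intro has_derivative_zero_unique[of UNIV]) auto
  also have "E s 0 = (LINT t:{0<..}|lborel. of_real (t powr (s - 1) * exp (- a * t)))"
    unfolding E_def f_def set_lebesgue_integral_def
    by (intro Bochner_Integration.integral_cong refl)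
      (simp add: exp_of_real[symmetric] indicator_def Complex_eq)
  also have "\<dots> = of_real (Gamma s / a powr s)"
    unfolding set_integral_complex_of_real set_lebesgue_integral_Gamma[OF s a] by simp
  also have "Complex a (-0) powr (of_real s) = of_real (a powr s)"
    using a by (simp add: powr_of_real flip: complex_of_real_def)
  finally have "Complex a (-x) powr (of_real s) * E s x = of_real (Gamma s)"
    using a by simp
  then have "E s x = of_real (Gamma s) * Complex a (-x) powr (- of_real s)"
    using c_nz(1)[of x] by (simp add: powr_minus field_simps)
  then show ?thesis
    by (simp add: E_def f_def set_lebesgue_integral_def)
qed

lemma Gamma_two_minus:
  fixes \<epsilon> :: real
  assumes "\<epsilon> < 2" "\<epsilon> \<noteq> 1"
  shows "Gamma (2 - \<epsilon>) = (1 - \<epsilon>) * Gamma (1 - \<epsilon>)"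
proof -
  have "1 - \<epsilon> \<notin> \<int>\<^sub>\<le>\<^sub>0"
  proof
    assume "1 - \<epsilon> \<in> \<int>\<^sub>\<le>\<^sub>0"
    then obtain n where n: "1 - \<epsilon> = - real n" by (rule nonpos_Ints_cases')
    then have "real n < 1" using assms by linarith
    then have "n = 0" by simp
    with n assms show False by simp
  qed
  then show ?thesis
    using Gamma_plus1[of "1 - \<epsilon>"] by (simp add: add.commute diff_add_eq)
qed

text \<open>
  The integral of \<open>t\<^bsup>-\<epsilon>\<^esup> exp (-at) sin (pt)\<close> over \<open>t > 0\<close> in closed form. At the pole \<open>\<epsilon> = 1\<close> of the
  Gamma factor its value is \<open>arctan (p/a) = -Arg (a - ip)\<close>, written so that it also makes sense for
  \<open>a = 0\<close>.
\<close>

definition sine_transform :: "real \<Rightarrow> real \<Rightarrow> real \<Rightarrow> real" where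
  "sine_transform p \<epsilon> a =
     (if \<epsilon> = 1 then - Im (Ln (Complex a (- p)))
      else Gamma (1 - \<epsilon>) * Im (Complex a (- p) powr of_real (\<epsilon> - 1)))"

text \<open>
  The derivative in \<open>p\<close> is free of the pole at \<open>\<epsilon> = 1\<close>, so both branches of the definition are primitives of
  the same function; it is the real part of a complex Gamma integral with \<open>s = 2 - \<epsilon>\<close>.
\<close>

lemma sine_transform_has_derivative:
  assumes a: "a > 0" and \<epsilon>: "\<epsilon> < 2"
  shows "((\<lambda>x. sine_transform x \<epsilon> a) has_vector_derivative
            Gamma (2 - \<epsilon>) * Re (Complex a (- x) powr (- of_real (2 - \<epsilon>)))) (at x)"
proof -
  have c_nz: "Complex a (-x) \<noteq> 0" "Complex a (-x) \<notin> \<real>\<^sub>\<le>\<^sub>0"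
    using a by (auto simp: complex_nonpos_Reals_iff complex_eq_iff)
  show ?thesis
  proof (cases "\<epsilon> = 1")
    case True
    have "((\<lambda>z. Ln (of_real a - \<i> * z)) has_field_derivative
        (inverse (of_real a - \<i> * of_real x) * (- \<i>))) (at (of_real x))"
      using c_nz(2) by (auto intro!: derivative_eq_intros simp: Complex_eq)
    from bounded_linear.has_vector_derivative[OF bounded_linear_Im has_vector_derivative_real_field[OF this]]
    have "((\<lambda>x. Im (Ln (Complex a (-x)))) has_vector_derivative - Re (inverse (Complex a (- x)))) (at x)"
      by (simp add: Complex_eq)
    from has_vector_derivative_minus[OF this] show ?thesis
      using True c_nz(1) by (simp add: sine_transform_def powr_minus)
  next
    case False
    have "((\<lambda>z. (of_real a - \<i> * z) powr (of_real (\<epsilon> - 1))) has_field_derivative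
        (of_real (\<epsilon> - 1) * (of_real a - \<i> * of_real x) powr (of_real (\<epsilon> - 1) - 1) * (- \<i>))) (at (of_real x))"
      using c_nz(2) by (auto intro!: derivative_eq_intros simp: Complex_eq)
    from bounded_linear.has_vector_derivative[OF bounded_linear_Im has_vector_derivative_real_field[OF this]]
    have "((\<lambda>x. Im (Complex a (-x) powr (of_real (\<epsilon> - 1)))) has_vector_derivative
        (1 - \<epsilon>) * Re (Complex a (- x) powr (- of_real (2 - \<epsilon>)))) (at x)"
      by (simp add: Complex_eq algebra_simps)
    from has_vector_derivative_mult_right[OF this, of "Gamma (1 - \<epsilon>)"]
    have *: "((\<lambda>x. Gamma (1 - \<epsilon>) * Im (Complex a (-x) powr (of_real (\<epsilon> - 1)))) has_vector_derivative
        ((1 - \<epsilon>) * Gamma (1 - \<epsilon>)) * Re (Complex a (- x) powr (- of_real (2 - \<epsilon>)))) (at x)"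
      by (simp add: mult_ac)
    then show ?thesis
      using * False Gamma_two_minus[OF \<epsilon> False] by (simp add: sine_transform_def)
  qed
qed

text \<open>
  For \<open>\<epsilon> \<ge> 1\<close> the factor \<open>t\<^bsup>-\<epsilon>\<^esup>\<close> alone is not integrable at \<open>0\<close>; the zero of the sine makes the integral
  converge. Both sides vanish at \<open>p = 0\<close> and have the same derivative in \<open>p\<close>, where the cosine integral
  has the integrable weight \<open>t\<^bsup>1-\<epsilon>\<^esup>\<close>.
\<close>

lemma sine_transform_integral:
  assumes a: "a > 0" and \<epsilon>: "\<epsilon> < 2"
  shows "(LINT t:{0<..}|lborel. t powr (- \<epsilon>) * exp (- a * t) * sin (p * t)) = sine_transform p \<epsilon> a"
proof -
  define g where "g = (\<lambda>x t. indicator {0<..} t *\<^sub>R (t powr (- \<epsilon>) * exp (- a * t) * sin (x * t)))"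
  define w where "w = (\<lambda>t. indicator {0<..} t *\<^sub>R (t powr (2 - \<epsilon> - 1) * exp (- a * t)))"
  have w: "integrable lborel w"
    using set_integrable_Gamma[of "2 - \<epsilon>" a] a \<epsilon> unfolding w_def set_integrable_def by simp
  have powr_eq: "t powr (1 - \<epsilon>) = t * t powr (- \<epsilon>)" if "t > 0" for t
    using that by (simp add: powr_diff powr_minus field_simps)
  have [measurable]: "g x \<in> borel_measurable borel" for x
    unfolding g_def by measurable
  have g_int: "integrable lborel (g x)" for x
  proof (rule Bochner_Integration.integrable_bound[OF integrable_mult_right[OF w, of "\<bar>x\<bar>"]])
    show "AE t in lborel. norm (g x t) \<le> norm (\<bar>x\<bar> * w t)"
    proof (rule AE_I2)
      fix t
      have "\<bar>sin (x * t)\<bar> \<le> \<bar>x * t\<bar>" by (rule abs_sin_x_le_abs_x)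
      then have "t powr (- \<epsilon>) * exp (- a * t) * \<bar>sin (x * t)\<bar> \<le> t powr (- \<epsilon>) * exp (- a * t) * \<bar>x * t\<bar>"
        by (intro mult_left_mono) auto
      then show "norm (g x t) \<le> norm (\<bar>x\<bar> * w t)"
        by (auto simp: g_def w_def indicator_def abs_mult powr_eq mult_ac)
    qed
  qed auto
  define d where "d = (\<lambda>x t. indicator {0<..} t *\<^sub>R (t powr (2 - \<epsilon> - 1) * exp (- a * t) * cos (x * t)))"
  have d_eq: "integral\<^sup>L lborel (d x) = Gamma (2 - \<epsilon>) * Re (Complex a (- x) powr (- of_real (2 - \<epsilon>)))" for x
  proof -
    define f where "f = (\<lambda>t. complex_of_real (t powr (2 - \<epsilon> - 1)) * exp (- (Complex a (-x)) * of_real t))"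
    have f: "set_integrable lborel {0<..} f"
      unfolding set_integrable_def
    proof (rule Bochner_Integration.integrable_bound[OF w])
      show "AE t in lborel. norm (indicat_real {0<..} t *\<^sub>R f t) \<le> norm (w t)"
        by (auto simp: f_def w_def norm_mult indicator_def)
    qed (simp add: f_def)
    have "integral\<^sup>L lborel (d x) = (LINT t|lborel. Re (indicator {0<..} t *\<^sub>R f t))"
      by (intro Bochner_Integration.integral_cong refl) (simp add: d_def f_def exp_eq_polar Re_exp)
    also have "\<dots> = Re (LINT t:{0<..}|lborel. f t)"
      using f unfolding set_lebesgue_integral_def set_integrable_def by (rule integral_Re)
    also have "\<dots> = Gamma (2 - \<epsilon>) * Re (Complex a (- x) powr (- of_real (2 - \<epsilon>)))"
      unfolding f_def using Gamma_integral_complex_scale[of "2 - \<epsilon>" a x] a \<epsilon> by simp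
    finally show ?thesis .
  qed
  have "((\<lambda>x. integral\<^sup>L lborel (g x)) has_vector_derivative integral\<^sup>L lborel (d x)) (at x)" for x
  proof (rule has_vector_derivative_lebesgue_integral[OF g_int _ _ _ w])
    show "((\<lambda>x. g x t) has_vector_derivative d x t) (at x)" for x t
    proof (cases "t > 0")
      case True
      have "((\<lambda>x. t powr (- \<epsilon>) * exp (- a * t) * sin (x * t)) has_real_derivative
          t powr (- \<epsilon>) * exp (- a * t) * (cos (x * t) * t)) (at x)"
        by (auto intro!: derivative_eq_intros)
      then show ?thesis
        using True by (simp add: g_def d_def powr_eq has_real_derivative_iff_has_vector_derivative mult_ac)
    qed (simp add: g_def d_def)
    show "norm (d x t) \<le> w t" for x t
      by (auto simp: d_def w_def indicator_def abs_mult mult_left_le)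
  qed (simp add: d_def)
  from has_vector_derivative_diff[OF this sine_transform_has_derivative[OF a \<epsilon>]]
  have "((\<lambda>x. integral\<^sup>L lborel (g x) - sine_transform x \<epsilon> a) has_derivative (\<lambda>h. 0)) (at x within UNIV)" for x
    unfolding d_eq has_vector_derivative_def by simp
  then have "integral\<^sup>L lborel (g p) - sine_transform p \<epsilon> a = integral\<^sup>L lborel (g 0) - sine_transform 0 \<epsilon> a"
    by (intro has_derivative_zero_unique[of UNIV]) auto
  also have "integral\<^sup>L lborel (g 0) = 0" by (simp add: g_def)
  also have "sine_transform 0 \<epsilon> a = 0"
  proof -
    have "Complex a (- 0) powr of_real (\<epsilon> - 1) = of_real (a powr (\<epsilon> - 1))"
      using a by (subst powr_of_real[symmetric]) (auto simp: complex_of_real_def)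
    moreover have "Ln (Complex a (- 0)) = of_real (ln a)"
      using a Ln_of_real by (simp add: complex_of_real_def)
    ultimately show ?thesis by (simp add: sine_transform_def)
  qed
  finally show ?thesis by (simp add: g_def set_lebesgue_integral_def)
qed

lemma integral_exp_sin:
  fixes a p :: real
  assumes a: "a > 0"
  shows "(LINT t:{0<..}|lborel. exp (- a * t) * sin (p * t)) = p / (p\<^sup>2 + a\<^sup>2)"
proof -
  have nz: "Complex a (- p) \<noteq> 0" using a by (simp add: complex_eq_iff)
  have "(LINT t:{0<..}|lborel. exp (- a * t) * sin (p * t)) = (LINT t:{0<..}|lborel. t powr (- 0) * exp (- a * t) * sin (p * t))"
    by (intro set_lebesgue_integral_cong) auto
  also have "\<dots> = Im (inverse (Complex a (- p)))"
    using sine_transform_integral[OF a, of 0 p] nz by (simp add: sine_transform_def powr_minus)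
  also have "\<dots> = p / (p\<^sup>2 + a\<^sup>2)" by (simp add: add.commute)
  finally show ?thesis .
qed

lemma sine_transform_continuous:
  assumes "p > 0"
  shows "continuous_on {0..} (sine_transform p \<epsilon>)"
proof -
  have nz: "Complex (a::real) (- p) \<notin> \<real>\<^sub>\<le>\<^sub>0" "Complex (a::real) (- p) \<noteq> 0" for a
    using assms by (auto simp: complex_nonpos_Reals_iff complex_eq_iff)
  then show ?thesis
    unfolding sine_transform_def Complex_eq
    by (cases "\<epsilon> = 1") (auto intro!: continuous_intros)
qed

lemma abs_sin_kernel_le:
  fixes p \<beta> \<delta> :: real
  assumes "p > 0" "\<beta> > 0"
  shows "\<bar>sin (p * \<beta>) / p * exp (- \<delta> * \<beta>)\<bar> \<le> \<beta> * exp (- \<delta> * \<beta>)"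
proof -
  have "\<bar>sin (p * \<beta>)\<bar> \<le> p * \<beta>"
    using abs_sin_x_le_abs_x[of "p * \<beta>"] assms by simp
  then have "\<bar>sin (p * \<beta>)\<bar> / p \<le> \<beta>"
    using assms by (simp add: field_simps)
  from mult_right_mono[OF this, of "exp (- \<delta> * \<beta>)"] show ?thesis
    using assms by (simp add: abs_mult)
qed

section \<open>Exponential parametrization of the propagators\<close>

text \<open>
  The parametrization of \<open>1/A\<close> by \<open>exp (-\<alpha> A)\<close>, \<open>\<alpha> > 0\<close>, after the substitution
  \<open>\<alpha> = 2\<beta> (1/v - 1)\<close>; in this variable the integrand has the primitive \<open>exp (-\<alpha> A) / A\<close>, which tends to \<open>0\<close> as
  \<open>v \<rightarrow> 0\<close>.
\<close>

lemma nn_integral_exp_inverse: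
  fixes A \<beta> :: real
  assumes A: "A > 0" and \<beta>: "\<beta> > 0"
  shows "(\<integral>\<^sup>+v. ennreal (2 * \<beta> / v\<^sup>2 * exp (- (2 * \<beta> * (1 / v - 1)) * A)) * indicator {0<..<1} v \<partial>lborel)
           = ennreal (1 / A)"
proof -
  define f where "f = (\<lambda>v. 2 * \<beta> / v\<^sup>2 * exp (- (2 * \<beta> * (1 / v - 1)) * A))"
  define F where "F = (\<lambda>v. exp (- (2 * \<beta> * (1 / v - 1)) * A) / A)"
  have ivl: "einterval 0 1 = {0<..<1}" by (auto simp: einterval_iff)
  have deriv: "DERIV F v :> f v" if "0 < ereal v" for v
    using that A unfolding F_def f_def
    by (auto intro!: derivative_eq_intros simp: field_simps power2_eq_square)
  have cont: "isCont f v" if "0 < ereal v" for v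
    using that unfolding f_def by (intro continuous_intros) auto
  have "filterlim (\<lambda>v. 2 * \<beta> * A + - (2 * \<beta> * A) * inverse v) at_bot (at_right 0)"
    using A \<beta>
    using A \<beta> unfolding filterlim_tendsto_add_at_bot_iff[OF tendsto_const]
    by (intro filterlim_tendsto_neg_mult_at_bot[OF tendsto_const] filterlim_inverse_at_top_right) auto

  then have "((\<lambda>v. exp (2 * \<beta> * A + - (2 * \<beta> * A) * inverse v) / A) \<longlongrightarrow> 0 / A) (at_right 0)"
    using A by (intro tendsto_intros filterlim_compose[OF exp_at_bot]) auto
  then have lim0: "(F \<longlongrightarrow> 0) (at_right 0)"
    by (simp add: F_def field_simps)
  have "isCont F 1" using deriv[of 1] by (auto intro: DERIV_isCont)
  then have lim1: "(F \<longlongrightarrow> 1 / A) (at_left 1)"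
    unfolding isCont_def by (auto simp: F_def intro: filterlim_mono at_le)
  have nonneg: "AE v in lborel. 0 < ereal v \<longrightarrow> ereal v < 1 \<longrightarrow> 0 \<le> f v"
    using \<beta> by (auto simp: f_def)
  have "0 < (1::ereal)" by simp
  note FTC = interval_integral_FTC_nonneg[OF this deriv cont nonneg, of 0 "1 / A"]
  have int: "set_integrable lborel {0<..<1} f" and eq: "(LBINT v=0..1. f v) = 1 / A - 0"
    using FTC lim0 lim1 by (simp_all add: zero_ereal_def one_ereal_def ereal_tendsto_simps ivl)
  have "(\<integral>\<^sup>+v. ennreal (f v) * indicator {0<..<1} v \<partial>lborel) = (\<integral>\<^sup>+v. ennreal (indicator {0<..<1} v *\<^sub>R f v) \<partial>lborel)"
    by (intro nn_integral_cong) (auto simp: indicator_def)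
  also have "\<dots> = ennreal (LINT v:{0<..<1}|lborel. f v)"
    using int \<beta> unfolding set_lebesgue_integral_def set_integrable_def
    by (intro nn_integral_eq_integral) (auto simp: f_def indicator_def)
  also have "(LINT v:{0<..<1}|lborel. f v) = 1 / A"
    using eq by (simp add: interval_lebesgue_integral_def ivl)
  finally show ?thesis by (simp add: f_def)
qed

lemma (in pair_sigma_finite) integrable_Tonelli:
  fixes f :: "'a \<Rightarrow> 'b \<Rightarrow> real"
  assumes [measurable]: "case_prod f \<in> borel_measurable (M1 \<Otimes>\<^sub>M M2)"
    and fin: "(\<integral>\<^sup>+x. \<integral>\<^sup>+y. ennreal \<bar>f x y\<bar> \<partial>M2 \<partial>M1) < \<infinity>"
  shows "integrable (M1 \<Otimes>\<^sub>M M2) (case_prod f)"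
proof (rule integrableI_bounded)
  have "(\<integral>\<^sup>+z. ennreal (norm (case z of (x, y) \<Rightarrow> f x y)) \<partial>(M1 \<Otimes>\<^sub>M M2))
      = (\<integral>\<^sup>+x. \<integral>\<^sup>+y. ennreal (norm (case (x, y) of (x, y) \<Rightarrow> f x y)) \<partial>M2 \<partial>M1)"
    by (rule M2.nn_integral_fst[symmetric]) measurable
  then show "(\<integral>\<^sup>+z. ennreal (norm (case z of (x, y) \<Rightarrow> f x y)) \<partial>(M1 \<Otimes>\<^sub>M M2)) < \<infinity>"
    using fin by simp
qed fact

text \<open>
  The integral of \<open>exp (-\<alpha> A - \<beta> S)\<close> over \<open>y\<close>, with \<open>\<alpha> = 2\<beta> (1/v - 1)\<close> and including the Jacobian
  \<open>2\<beta>/v\<^sup>2\<close> of this substitution.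
\<close>

definition schwinger_weight :: "real \<Rightarrow> real \<Rightarrow> real \<Rightarrow> real \<Rightarrow> real" where
  "schwinger_weight \<epsilon> q \<beta> v =
     pi powr (1 + \<epsilon>) * (2 * \<beta>) powr (- \<epsilon>) * v powr (\<epsilon> - 1) * exp (- \<beta> * q\<^sup>2 * (1 - v / 2))"

text \<open>
  What the computation needs to know about the integration over \<open>y\<close>. The intended \<open>A\<close> is the squared
  distance from \<open>y\<close> to \<open>q/2\<close>, the intended \<open>S\<close> is the sum of the squared distances to \<open>q/2\<close> and \<open>-q/2\<close>, and
  the dimension is \<open>2 + 2\<epsilon>\<close>. Since \<open>q\<close> enters through its square only, the pair with centre
  \<open>-q/2\<close> is another instance with the same \<open>S\<close>.
\<close>

locale gaussian_pair = sigma_finite_measure M for M :: "'a measure" +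
  fixes A S :: "'a \<Rightarrow> real" and \<epsilon> q :: real
  assumes A_measurable [measurable]: "A \<in> borel_measurable M"
    and S_measurable [measurable]: "S \<in> borel_measurable M"
    and A_pos: "AE y in M. A y > 0"
    and S_nonneg: "\<And>y. S y \<ge> 0"
    and \<epsilon>_pos: "0 < \<epsilon>"
    and \<epsilon>_less: "\<epsilon> < 2"
    and gaussian: "\<And>\<alpha> \<beta>. \<alpha> > 0 \<Longrightarrow> \<beta> > 0 \<Longrightarrow>
      (\<integral>\<^sup>+y. ennreal (exp (- \<alpha> * A y - \<beta> * S y)) \<partial>M) =
      ennreal ((pi / (\<alpha> + 2 * \<beta>)) powr (1 + \<epsilon>) * exp (- (\<alpha> * \<beta> * q\<^sup>2 / (2 * (\<alpha> + 2 * \<beta>))) - \<beta> * q\<^sup>2 / 2))"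
begin

sublocale pair: pair_sigma_finite M "lborel :: real measure" ..

lemma powr_integrable: "set_integrable lborel {0<..<1} (\<lambda>v. v powr (\<epsilon> - 1))"
  and powr_integral: "(LINT v:{0<..<1}|lborel. v powr (\<epsilon> - 1)) = 1 / \<epsilon>"
  using Beta_weight[OF \<epsilon>_pos, of 0] by simp_all

text \<open>The constant in the bound of order \<open>\<beta>\<^bsup>-\<epsilon>\<^esup>\<close> on the integral of the weight over \<open>v\<close>.\<close>

definition weight_bound :: real where
  "weight_bound = pi powr (1 + \<epsilon>) * 2 powr (- \<epsilon>) / \<epsilon>"

lemma weight_nonneg: "schwinger_weight \<epsilon> q \<beta> v \<ge> 0"
  by (simp add: schwinger_weight_def)

lemma weight_measurable [measurable]: "(\<lambda>(\<beta>, v). schwinger_weight \<epsilon> q \<beta> v) \<in> borel_measurable (borel \<Otimes>\<^sub>M borel)"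
  unfolding schwinger_weight_def by measurable

lemma weight_le:
  assumes "\<beta> > 0" "v \<in> {0<..<1}"
  shows "schwinger_weight \<epsilon> q \<beta> v \<le> weight_bound * \<epsilon> * \<beta> powr (- \<epsilon>) * v powr (\<epsilon> - 1)"
proof -
  have "exp (- \<beta> * q\<^sup>2 * (1 - v / 2)) \<le> 1"
    using assms by (simp add: mult_nonneg_nonneg)
  then have "pi powr (1 + \<epsilon>) * (2 * \<beta>) powr (- \<epsilon>) * v powr (\<epsilon> - 1) * exp (- \<beta> * q\<^sup>2 * (1 - v / 2))
       \<le> pi powr (1 + \<epsilon>) * (2 * \<beta>) powr (- \<epsilon>) * v powr (\<epsilon> - 1) * 1"
    by (intro mult_left_mono) auto
  then show ?thesis
    using assms \<epsilon>_pos by (simp add: schwinger_weight_def weight_bound_def powr_mult mult_ac)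
qed

lemma nn_weight_le:
  assumes "\<beta> > 0"
  shows "(\<integral>\<^sup>+v. ennreal (schwinger_weight \<epsilon> q \<beta> v) * indicator {0<..<1} v \<partial>lborel)
           \<le> ennreal (weight_bound * \<beta> powr (- \<epsilon>))"
proof -
  have "(\<integral>\<^sup>+v. ennreal (schwinger_weight \<epsilon> q \<beta> v) * indicator {0<..<1} v \<partial>lborel)
      \<le> (\<integral>\<^sup>+v. ennreal (weight_bound * \<epsilon> * \<beta> powr (- \<epsilon>)) * ennreal (indicator {0<..<1} v *\<^sub>R v powr (\<epsilon> - 1)) \<partial>lborel)"
    using weight_le[OF assms] \<epsilon>_pos
    by (intro nn_integral_mono) (auto simp: indicator_def ennreal_mult[symmetric] weight_bound_def)
  also have "\<dots> = ennreal (weight_bound * \<epsilon> * \<beta> powr (- \<epsilon>)) * ennreal (LINT v:{0<..<1}|lborel. v powr (\<epsilon> - 1))"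
    using powr_integrable unfolding set_lebesgue_integral_def set_integrable_def
    by (subst nn_integral_cmult) (auto intro!: arg_cong2[where f = "(*)"] nn_integral_eq_integral)
  also have "\<dots> = ennreal (weight_bound * \<beta> powr (- \<epsilon>))"
    using \<epsilon>_pos unfolding powr_integral by (simp add: ennreal_mult[symmetric] weight_bound_def)
  finally show ?thesis .
qed

text \<open>
  Tonelli's theorem exchanges the integrals over \<open>y\<close> and \<open>v\<close>; the inner integral is Gaussian. With
  \<open>\<gamma> = \<alpha> + 2\<beta> = 2\<beta>/v\<close> one finds \<open>\<alpha>\<beta>/(2\<gamma>) = \<beta>(1 - v)/2\<close>, so that the exponent is linear in \<open>v\<close>.
\<close>

lemma nn_integral_exp_over_A:
  assumes \<beta>: "\<beta> > 0"
  shows "(\<integral>\<^sup>+y. ennreal (exp (- \<beta> * S y) / A y) \<partial>M) =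
         (\<integral>\<^sup>+v. ennreal (schwinger_weight \<epsilon> q \<beta> v) * indicator {0<..<1} v \<partial>lborel)"
proof -
  define k where "k = (\<lambda>y v. ennreal (2 * \<beta> / v\<^sup>2 * exp (- (2 * \<beta> * (1 / v - 1)) * A y)) * indicator {0<..<1} v)"
  have [measurable]: "(\<lambda>(y, v). k y v) \<in> borel_measurable (M \<Otimes>\<^sub>M lborel)"
    unfolding k_def by measurable
  have "(\<integral>\<^sup>+y. ennreal (exp (- \<beta> * S y) / A y) \<partial>M) =
      (\<integral>\<^sup>+y. (\<integral>\<^sup>+v. ennreal (exp (- \<beta> * S y)) * k y v \<partial>lborel) \<partial>M)"
  proof (rule nn_integral_cong_AE, use A_pos in eventually_elim)
    fix y assume "A y > 0"
    then have "ennreal (exp (- \<beta> * S y) / A y) = ennreal (exp (- \<beta> * S y)) * (\<integral>\<^sup>+v. k y v \<partial>lborel)"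
      using nn_integral_exp_inverse[of "A y" \<beta>] \<beta> unfolding k_def by (simp add: ennreal_mult[symmetric])
    then show "ennreal (exp (- \<beta> * S y) / A y) = (\<integral>\<^sup>+v. ennreal (exp (- \<beta> * S y)) * k y v \<partial>lborel)"
      by (subst nn_integral_cmult) (auto simp: k_def)
  qed
  also have "\<dots> = (\<integral>\<^sup>+v. (\<integral>\<^sup>+y. ennreal (exp (- \<beta> * S y)) * k y v \<partial>M) \<partial>lborel)"
    by (rule pair.Fubini'[symmetric]) measurable
  also have "\<dots> = (\<integral>\<^sup>+v. ennreal (schwinger_weight \<epsilon> q \<beta> v) * indicator {0<..<1} v \<partial>lborel)"
  proof (intro nn_integral_cong)
    fix v :: real
    show "(\<integral>\<^sup>+y. ennreal (exp (- \<beta> * S y)) * k y v \<partial>M) = ennreal (schwinger_weight \<epsilon> q \<beta> v) * indicator {0<..<1} v"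
    proof (cases "v \<in> {0<..<1}")
      case True
      define \<alpha> where "\<alpha> = 2 * \<beta> * (1 / v - 1)"
      have \<alpha>: "\<alpha> > 0" using True \<beta> by (auto simp: \<alpha>_def field_simps)
      have sum: "\<alpha> + 2 * \<beta> = 2 * \<beta> / v" by (simp add: \<alpha>_def field_simps)
      have "(\<integral>\<^sup>+y. ennreal (exp (- \<beta> * S y)) * k y v \<partial>M) =
          (\<integral>\<^sup>+y. ennreal (2 * \<beta> / v\<^sup>2) * ennreal (exp (- \<alpha> * A y - \<beta> * S y)) \<partial>M)"
        using True \<beta>
        by (intro nn_integral_cong) (simp add: k_def \<alpha>_def ennreal_mult[symmetric] mult_ac exp_add[symmetric] exp_diff exp_minus field_simps)
      also have "\<dots> = ennreal (2 * \<beta> / v\<^sup>2) * ennreal ((pi / (2 * \<beta> / v)) powr (1 + \<epsilon>) * exp (- (\<alpha> * \<beta> * q\<^sup>2 / (2 * (2 * \<beta> / v))) - \<beta> * q\<^sup>2 / 2))"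
        by (subst nn_integral_cmult) (simp_all only: gaussian[OF \<alpha> \<beta>] sum, measurable)
      also have "\<alpha> * \<beta> * q\<^sup>2 / (2 * (2 * \<beta> / v)) = \<beta> * q\<^sup>2 * (1 - v) / 2"
        using True \<beta> by (simp add: \<alpha>_def field_simps)
      also have "- (\<beta> * q\<^sup>2 * (1 - v) / 2) - \<beta> * q\<^sup>2 / 2 = - \<beta> * q\<^sup>2 * (1 - v / 2)"
        by (simp add: field_simps)
      also have "(pi / (2 * \<beta> / v)) powr (1 + \<epsilon>) = v\<^sup>2 / (2 * \<beta>) * (pi powr (1 + \<epsilon>) * (2 * \<beta>) powr (- \<epsilon>) * v powr (\<epsilon> - 1))"
        using True \<beta> by (simp add: powr_mult powr_divide powr_add powr_diff powr_minus field_simps power2_eq_square)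
      finally show ?thesis
        using True \<beta> by (simp add: schwinger_weight_def ennreal_mult[symmetric] mult_ac)
    qed (simp add: k_def)
  qed
  finally show ?thesis .
qed

lemma nn_integral_exp_over_A_le:
  assumes \<beta>: "\<beta> > 0"
  shows "(\<integral>\<^sup>+y. ennreal (exp (- \<beta> * S y) / A y) \<partial>M) \<le> ennreal (weight_bound * \<beta> powr (- \<epsilon>))"
  unfolding nn_integral_exp_over_A[OF \<beta>] by (rule nn_weight_le[OF \<beta>])

lemma integral_exp_over_A:
  assumes \<beta>: "\<beta> > 0"
  shows "(LINT y|M. exp (- \<beta> * S y) / A y) = (LINT v:{0<..<1}|lborel. schwinger_weight \<epsilon> q \<beta> v)"
proof -
  have "AE y in M. 0 \<le> exp (- \<beta> * S y) / A y"
    using A_pos by eventually_elim simp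
  then have "(LINT y|M. exp (- \<beta> * S y) / A y) = enn2real (\<integral>\<^sup>+y. ennreal (exp (- \<beta> * S y) / A y) \<partial>M)"
    by (intro integral_eq_nn_integral) auto
  also have "\<dots> = enn2real (\<integral>\<^sup>+v. ennreal (indicator {0<..<1} v *\<^sub>R schwinger_weight \<epsilon> q \<beta> v) \<partial>lborel)"
    unfolding nn_integral_exp_over_A[OF \<beta>]
    by (intro arg_cong[where f = enn2real] nn_integral_cong) (auto simp: indicator_def)
  also have "\<dots> = (LINT v:{0<..<1}|lborel. schwinger_weight \<epsilon> q \<beta> v)"
    unfolding set_lebesgue_integral_def
    by (intro integral_eq_nn_integral[symmetric]) (auto simp: weight_nonneg)
  finally show ?thesis .
qed

text \<open>
  The majorant that justifies the interchange of \<open>y\<close> and \<open>\<beta>\<close>. Near \<open>\<beta> = 0\<close> the integrand is of order \<open>\<beta>\<^bsup>1-\<epsilon>\<^esup>\<close>, which is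
  integrable because \<open>\<epsilon> < 2\<close>; the factor \<open>exp (-\<delta>\<beta>)\<close> takes care of large \<open>\<beta>\<close>.
\<close>

lemma nn_double_integral_finite:
  assumes \<delta>: "\<delta> > 0"
  shows "(\<integral>\<^sup>+y. \<integral>\<^sup>+\<beta>. ennreal (exp (- \<beta> * S y) / A y) * (ennreal (\<beta> * exp (- \<delta> * \<beta>)) * indicator {0<..} \<beta>) \<partial>lborel \<partial>M) < \<infinity>"
proof -
  have "(\<integral>\<^sup>+y. \<integral>\<^sup>+\<beta>. ennreal (exp (- \<beta> * S y) / A y) * (ennreal (\<beta> * exp (- \<delta> * \<beta>)) * indicator {0<..} \<beta>) \<partial>lborel \<partial>M)
     = (\<integral>\<^sup>+\<beta>. \<integral>\<^sup>+y. ennreal (exp (- \<beta> * S y) / A y) * (ennreal (\<beta> * exp (- \<delta> * \<beta>)) * indicator {0<..} \<beta>) \<partial>M \<partial>lborel)"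
    by (rule pair.Fubini'[symmetric]) measurable
  also have "\<dots> \<le> (\<integral>\<^sup>+\<beta>. ennreal weight_bound * (ennreal (\<beta> powr (2 - \<epsilon> - 1) * exp (- \<delta> * \<beta>)) * indicator {0<..} \<beta>) \<partial>lborel)"
  proof (intro nn_integral_mono)
    fix \<beta> :: real
    show "(\<integral>\<^sup>+y. ennreal (exp (- \<beta> * S y) / A y) * (ennreal (\<beta> * exp (- \<delta> * \<beta>)) * indicator {0<..} \<beta>) \<partial>M)
       \<le> ennreal weight_bound * (ennreal (\<beta> powr (2 - \<epsilon> - 1) * exp (- \<delta> * \<beta>)) * indicator {0<..} \<beta>)"
    proof (cases "\<beta> > 0")
      case True
      have "(\<integral>\<^sup>+y. ennreal (exp (- \<beta> * S y) / A y) * (ennreal (\<beta> * exp (- \<delta> * \<beta>)) * indicator {0<..} \<beta>) \<partial>M)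
          = (\<integral>\<^sup>+y. ennreal (exp (- \<beta> * S y) / A y) \<partial>M) * ennreal (\<beta> * exp (- \<delta> * \<beta>))"
        using True by (subst nn_integral_multc) auto
      also have "\<dots> \<le> ennreal (weight_bound * \<beta> powr (- \<epsilon>)) * ennreal (\<beta> * exp (- \<delta> * \<beta>))"
        by (intro mult_right_mono nn_integral_exp_over_A_le True) auto
      also have "\<dots> = ennreal weight_bound * ennreal (\<beta> powr (2 - \<epsilon> - 1) * exp (- \<delta> * \<beta>))"
        using True \<epsilon>_pos by (simp add: ennreal_mult[symmetric] weight_bound_def powr_diff powr_minus field_simps)
      finally show ?thesis using True by simp
    qed simp
  qed
  also have "\<dots> = ennreal weight_bound * ennreal (Gamma (2 - \<epsilon>) / \<delta> powr (2 - \<epsilon>))"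
    using nn_integral_Gamma_scaled[of "2 - \<epsilon>" \<delta>] \<delta> \<epsilon>_less by (subst nn_integral_cmult) auto
  also have "\<dots> < \<infinity>" by (simp add: ennreal_mult_less_top)
  finally show ?thesis .
qed

text \<open>
  Since \<open>(S + p)\<^sup>2 \<le> 2 (p\<^sup>2 + S\<^sup>2)\<close>, the function is dominated by twice \<open>1 / (A (S + p)\<^sup>2)\<close>, which is an integral of
  positive exponentials: \<open>1 / (S + p)\<^sup>2 = \<integral>\<^sub>0\<^sup>\<infinity> \<beta> exp (-\<beta> (S + p)) d\<beta>\<close>.
\<close>

lemma integrable_propagator:
  assumes p: "p > 0"
  shows "integrable M (\<lambda>y. 1 / (A y * (p\<^sup>2 + (S y)\<^sup>2)))"
proof (rule integrableI_bounded)
  have "(\<integral>\<^sup>+y. ennreal (norm (1 / (A y * (p\<^sup>2 + (S y)\<^sup>2)))) \<partial>M) \<le>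
      (\<integral>\<^sup>+y. ennreal 2 * (\<integral>\<^sup>+\<beta>. ennreal (exp (- \<beta> * S y) / A y) * (ennreal (\<beta> * exp (- p * \<beta>)) * indicator {0<..} \<beta>) \<partial>lborel) \<partial>M)"
  proof (rule nn_integral_mono_AE, use A_pos in eventually_elim)
    fix y assume A: "A y > 0"
    have Sp: "S y + p > 0" using S_nonneg[of y] p by simp
    have "(\<integral>\<^sup>+\<beta>. ennreal (exp (- \<beta> * S y) / A y) * (ennreal (\<beta> * exp (- p * \<beta>)) * indicator {0<..} \<beta>) \<partial>lborel)
        = (\<integral>\<^sup>+\<beta>. ennreal (1 / A y) * (ennreal (\<beta> powr (2 - 1) * exp (- (S y + p) * \<beta>)) * indicator {0<..} \<beta>) \<partial>lborel)"
      using A by (intro nn_integral_cong)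
        (auto simp: indicator_def ennreal_mult[symmetric] exp_add[symmetric] algebra_simps)
    also have "\<dots> = ennreal (1 / A y) * ennreal (Gamma 2 / (S y + p) powr 2)"
      using nn_integral_Gamma_scaled[of 2 "S y + p"] Sp by (subst nn_integral_cmult) auto
    also have "\<dots> = ennreal (1 / (A y * (S y + p)\<^sup>2))"
      using A Sp Gamma_numeral[of "Num.Bit0 Num.One"] by (simp add: ennreal_mult[symmetric])
    finally have eq: "(\<integral>\<^sup>+\<beta>. ennreal (exp (- \<beta> * S y) / A y) * (ennreal (\<beta> * exp (- p * \<beta>)) * indicator {0<..} \<beta>) \<partial>lborel)
        = ennreal (1 / (A y * (S y + p)\<^sup>2))" .
    have "(S y + p)\<^sup>2 \<le> 2 * (p\<^sup>2 + (S y)\<^sup>2)"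
      using zero_le_power2[of "S y - p"] by (simp add: power2_eq_square algebra_simps)
    then have "A y * (S y + p)\<^sup>2 \<le> 2 * (A y * (p\<^sup>2 + (S y)\<^sup>2))"
      using A by (simp add: mult.left_commute)
    moreover have "0 < A y * (S y + p)\<^sup>2" "0 < A y * (p\<^sup>2 + (S y)\<^sup>2)"
      using A p Sp by (auto intro!: mult_pos_pos add_pos_nonneg)
    moreover have "1 / Y \<le> 2 * (1 / X)" if "X \<le> 2 * Y" "0 < X" "0 < Y" for X Y :: real
      using that by (simp add: field_simps)
    ultimately have "1 / (A y * (p\<^sup>2 + (S y)\<^sup>2)) \<le> 2 * (1 / (A y * (S y + p)\<^sup>2))"
      by blast
    then show "ennreal (norm (1 / (A y * (p\<^sup>2 + (S y)\<^sup>2)))) \<le>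
        ennreal 2 * (\<integral>\<^sup>+\<beta>. ennreal (exp (- \<beta> * S y) / A y) * (ennreal (\<beta> * exp (- p * \<beta>)) * indicator {0<..} \<beta>) \<partial>lborel)"
      unfolding eq using \<open>0 < A y * (p\<^sup>2 + (S y)\<^sup>2)\<close>
      by (subst ennreal_mult'[symmetric]) (auto intro!: ennreal_leI)
  qed
  also have "\<dots> = ennreal 2 * (\<integral>\<^sup>+y. (\<integral>\<^sup>+\<beta>. ennreal (exp (- \<beta> * S y) / A y) * (ennreal (\<beta> * exp (- p * \<beta>)) * indicator {0<..} \<beta>) \<partial>lborel) \<partial>M)"
    by (rule nn_integral_cmult) measurable
  also have "\<dots> < \<infinity>"
    using nn_double_integral_finite[OF p] by (simp add: ennreal_mult_less_top)
  finally show "(\<integral>\<^sup>+y. ennreal (norm (1 / (A y * (p\<^sup>2 + (S y)\<^sup>2)))) \<partial>M) < \<infinity>" .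
qed measurable

text \<open>
  The damping factor \<open>exp (-\<delta>\<beta>)\<close> makes both applications of Fubini's theorem legitimate: first \<open>y\<close> against
  \<open>\<beta>\<close>, then, after the Gaussian integration, \<open>\<beta>\<close> against \<open>v\<close>.
\<close>

lemma regularized_integral:
  assumes p: "p > 0" and \<delta>: "\<delta> > 0"
  shows "(LINT y|M. 1 / (A y * (p\<^sup>2 + (S y + \<delta>)\<^sup>2))) =
         pi powr (1 + \<epsilon>) * 2 powr (- \<epsilon>) / p *
           (LINT v:{0<..<1}|lborel. v powr (\<epsilon> - 1) * sine_transform p \<epsilon> (\<delta> + q\<^sup>2 * (1 - v / 2)))"
proof -
  define h where "h \<beta> = indicator {0<..} \<beta> * (sin (p * \<beta>) / p * exp (- \<delta> * \<beta>))" for \<beta>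
  have h_le: "\<bar>h \<beta>\<bar> \<le> indicator {0<..} \<beta> * (\<beta> * exp (- \<delta> * \<beta>))" for \<beta>
    using abs_sin_kernel_le[OF p] by (auto simp: h_def indicator_def)
  have [measurable]: "h \<in> borel_measurable borel" unfolding h_def by measurable

  have "integrable (M \<Otimes>\<^sub>M lborel) (\<lambda>(y, \<beta>). exp (- \<beta> * S y) / A y * h \<beta>)"
  proof (rule pair.integrable_Tonelli)
    have "(\<integral>\<^sup>+y. \<integral>\<^sup>+\<beta>. ennreal \<bar>exp (- \<beta> * S y) / A y * h \<beta>\<bar> \<partial>lborel \<partial>M) \<le>
      (\<integral>\<^sup>+y. \<integral>\<^sup>+\<beta>. ennreal (exp (- \<beta> * S y) / A y) * (ennreal (\<beta> * exp (- \<delta> * \<beta>)) * indicator {0<..} \<beta>) \<partial>lborel \<partial>M)"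
    proof (rule nn_integral_mono_AE, use A_pos in eventually_elim)
      fix y assume A: "A y > 0"
      show "(\<integral>\<^sup>+\<beta>. ennreal \<bar>exp (- \<beta> * S y) / A y * h \<beta>\<bar> \<partial>lborel) \<le>
        (\<integral>\<^sup>+\<beta>. ennreal (exp (- \<beta> * S y) / A y) * (ennreal (\<beta> * exp (- \<delta> * \<beta>)) * indicator {0<..} \<beta>) \<partial>lborel)"
      proof (rule nn_integral_mono)
        fix \<beta>
        have "\<bar>exp (- \<beta> * S y) / A y * h \<beta>\<bar> \<le> exp (- \<beta> * S y) / A y * (indicator {0<..} \<beta> * (\<beta> * exp (- \<delta> * \<beta>)))"
          using A unfolding abs_mult by (intro mult_mono h_le) auto
        then show "ennreal \<bar>exp (- \<beta> * S y) / A y * h \<beta>\<bar> \<le> ennreal (exp (- \<beta> * S y) / A y) * (ennreal (\<beta> * exp (- \<delta> * \<beta>)) * indicator {0<..} \<beta>)"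
          using A by (cases "\<beta> > 0") (simp_all add: ennreal_mult[symmetric] ennreal_leI h_def[of \<beta>])
      qed
    qed
    also have "\<dots> < \<infinity>" by (rule nn_double_integral_finite[OF \<delta>])
    finally show "(\<integral>\<^sup>+y. \<integral>\<^sup>+\<beta>. ennreal \<bar>exp (- \<beta> * S y) / A y * h \<beta>\<bar> \<partial>lborel \<partial>M) < \<infinity>" .
  qed measurable
  \<comment> \<open>exchange of \<open>y\<close> and \<open>\<beta>\<close>\<close>
  note Fubini1 = pair.Fubini_integral[OF this]

  have "integrable (lborel \<Otimes>\<^sub>M lborel) (\<lambda>(\<beta>, v). h \<beta> * (indicator {0<..<1} v * schwinger_weight \<epsilon> q \<beta> v))"
  proof (rule lborel_pair.integrable_Tonelli)
    have "(\<integral>\<^sup>+\<beta>. \<integral>\<^sup>+v. ennreal \<bar>h \<beta> * (indicator {0<..<1} v * schwinger_weight \<epsilon> q \<beta> v)\<bar> \<partial>lborel \<partial>lborel)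
      \<le> (\<integral>\<^sup>+\<beta>. ennreal weight_bound * (ennreal (\<beta> powr (2 - \<epsilon> - 1) * exp (- \<delta> * \<beta>)) * indicator {0<..} \<beta>) \<partial>lborel)"
    proof (rule nn_integral_mono)
      fix \<beta> :: real
      show "(\<integral>\<^sup>+v. ennreal \<bar>h \<beta> * (indicator {0<..<1} v * schwinger_weight \<epsilon> q \<beta> v)\<bar> \<partial>lborel)
         \<le> ennreal weight_bound * (ennreal (\<beta> powr (2 - \<epsilon> - 1) * exp (- \<delta> * \<beta>)) * indicator {0<..} \<beta>)"
      proof (cases "\<beta> > 0")
        case True
        have "(\<integral>\<^sup>+v. ennreal \<bar>h \<beta> * (indicator {0<..<1} v * schwinger_weight \<epsilon> q \<beta> v)\<bar> \<partial>lborel)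
           = (\<integral>\<^sup>+v. ennreal \<bar>h \<beta>\<bar> * (ennreal (schwinger_weight \<epsilon> q \<beta> v) * indicator {0<..<1} v) \<partial>lborel)"
          using weight_nonneg by (intro nn_integral_cong) (auto simp: indicator_def abs_mult ennreal_mult)
        also have "\<dots> = ennreal \<bar>h \<beta>\<bar> * (\<integral>\<^sup>+v. ennreal (schwinger_weight \<epsilon> q \<beta> v) * indicator {0<..<1} v \<partial>lborel)"
          by (rule nn_integral_cmult) measurable
        also have "\<dots> \<le> ennreal (\<beta> * exp (- \<delta> * \<beta>)) * ennreal (weight_bound * \<beta> powr (- \<epsilon>))"
          using h_le[of \<beta>] True by (intro mult_mono nn_weight_le ennreal_leI) auto
        also have "\<dots> = ennreal weight_bound * ennreal (\<beta> powr (2 - \<epsilon> - 1) * exp (- \<delta> * \<beta>))"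
          using True \<epsilon>_pos by (simp add: ennreal_mult[symmetric] weight_bound_def powr_diff powr_minus field_simps)
        finally show ?thesis using True by simp
      qed (simp add: h_def)
    qed
    also have "\<dots> = ennreal weight_bound * ennreal (Gamma (2 - \<epsilon>) / \<delta> powr (2 - \<epsilon>))"
      using nn_integral_Gamma_scaled[of "2 - \<epsilon>" \<delta>] \<delta> \<epsilon>_less by (subst nn_integral_cmult) auto
    also have "\<dots> < \<infinity>" by (simp add: ennreal_mult_less_top)
    finally show "(\<integral>\<^sup>+\<beta>. \<integral>\<^sup>+v. ennreal \<bar>h \<beta> * (indicator {0<..<1} v * schwinger_weight \<epsilon> q \<beta> v)\<bar> \<partial>lborel \<partial>lborel) < \<infinity>" .
  qed measurable
  \<comment> \<open>exchange of \<open>\<beta>\<close> and \<open>v\<close>\<close>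
  note Fubini2 = lborel_pair.Fubini_integral[OF this]

  have "(LINT y|M. 1 / (A y * (p\<^sup>2 + (S y + \<delta>)\<^sup>2))) = (LINT y|M. LINT \<beta>|lborel. exp (- \<beta> * S y) / A y * h \<beta>)"
  proof (rule Bochner_Integration.integral_cong[OF refl])
    fix y
    have a: "S y + \<delta> > 0" using S_nonneg[of y] \<delta> by simp
    have "(LINT \<beta>|lborel. exp (- \<beta> * S y) / A y * h \<beta>) =
        (LINT \<beta>|lborel. 1 / (A y * p) * (indicator {0<..} \<beta> *\<^sub>R (exp (- (S y + \<delta>) * \<beta>) * sin (p * \<beta>))))"
      by (intro Bochner_Integration.integral_cong refl)
         (auto simp: h_def indicator_def exp_add[symmetric] algebra_simps)
    also have "\<dots> = 1 / (A y * p) * (p / (p\<^sup>2 + (S y + \<delta>)\<^sup>2))"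
      using integral_exp_sin[OF a, of p] unfolding set_lebesgue_integral_def integral_mult_right_zero by simp
    also have "\<dots> = 1 / (A y * (p\<^sup>2 + (S y + \<delta>)\<^sup>2))"
      using p by simp
    finally show "1 / (A y * (p\<^sup>2 + (S y + \<delta>)\<^sup>2)) = (LINT \<beta>|lborel. exp (- \<beta> * S y) / A y * h \<beta>)" by simp
  qed
  also have "\<dots> = (LINT \<beta>|lborel. LINT y|M. exp (- \<beta> * S y) / A y * h \<beta>)"
    by (rule Fubini1[symmetric])
  also have "\<dots> = (LINT \<beta>|lborel. LINT v|lborel. h \<beta> * (indicator {0<..<1} v * schwinger_weight \<epsilon> q \<beta> v))"
  proof (rule Bochner_Integration.integral_cong[OF refl])
    fix \<beta> :: real
    show "(LINT y|M. exp (- \<beta> * S y) / A y * h \<beta>) = (LINT v|lborel. h \<beta> * (indicator {0<..<1} v * schwinger_weight \<epsilon> q \<beta> v))"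
    proof (cases "\<beta> > 0")
      case True
      then show ?thesis
        using integral_exp_over_A[OF True]
        by (simp only: set_lebesgue_integral_def integral_mult_left_zero integral_mult_right_zero real_scaleR_def mult.commute)
    qed (simp add: h_def)
  qed
  also have "\<dots> = (LINT v|lborel. LINT \<beta>|lborel. h \<beta> * (indicator {0<..<1} v * schwinger_weight \<epsilon> q \<beta> v))"
    by (rule Fubini2[symmetric])
  also have "\<dots> = (LINT v|lborel. pi powr (1 + \<epsilon>) * 2 powr (- \<epsilon>) / p * (indicator {0<..<1} v *\<^sub>R
       (v powr (\<epsilon> - 1) * sine_transform p \<epsilon> (\<delta> + q\<^sup>2 * (1 - v / 2)))))"
  proof (rule Bochner_Integration.integral_cong[OF refl])
    fix v :: real
    show "(LINT \<beta>|lborel. h \<beta> * (indicator {0<..<1} v * schwinger_weight \<epsilon> q \<beta> v)) =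
      pi powr (1 + \<epsilon>) * 2 powr (- \<epsilon>) / p * (indicator {0<..<1} v *\<^sub>R
       (v powr (\<epsilon> - 1) * sine_transform p \<epsilon> (\<delta> + q\<^sup>2 * (1 - v / 2))))"
    proof (cases "v \<in> {0<..<1}")
      case True
      define a where "a = \<delta> + q\<^sup>2 * (1 - v / 2)"
      have a: "a > 0" using True \<delta> by (auto simp: a_def intro!: add_pos_nonneg mult_nonneg_nonneg)
      have "(LINT \<beta>|lborel. h \<beta> * (indicator {0<..<1} v * schwinger_weight \<epsilon> q \<beta> v)) =
        (LINT \<beta>|lborel. pi powr (1 + \<epsilon>) * 2 powr (- \<epsilon>) / p * v powr (\<epsilon> - 1) *
            (indicator {0<..} \<beta> *\<^sub>R (\<beta> powr (- \<epsilon>) * exp (- a * \<beta>) * sin (p * \<beta>))))"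
        using True
        by (intro Bochner_Integration.integral_cong refl)
           (auto simp: h_def indicator_def schwinger_weight_def a_def powr_mult exp_add[symmetric] algebra_simps)
      also have "\<dots> = pi powr (1 + \<epsilon>) * 2 powr (- \<epsilon>) / p * v powr (\<epsilon> - 1) * sine_transform p \<epsilon> a"
        using sine_transform_integral[OF a \<epsilon>_less, of p] unfolding set_lebesgue_integral_def integral_mult_right_zero by simp
      finally show ?thesis using True by (simp add: a_def)
    qed simp
  qed
  also have "\<dots> = pi powr (1 + \<epsilon>) * 2 powr (- \<epsilon>) / p *
      (LINT v:{0<..<1}|lborel. v powr (\<epsilon> - 1) * sine_transform p \<epsilon> (\<delta> + q\<^sup>2 * (1 - v / 2)))"
    unfolding set_lebesgue_integral_def by (rule integral_mult_right_zero)
  finally show ?thesis .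
qed

text \<open>
  The limit \<open>\<delta> \<rightarrow> 0\<close> of the regularized identity. On the left the integrand increases to its limit; on
  the right the sine transform is continuous on the compact range of its argument, because
  \<open>a - ip\<close> stays off the cut of the logarithm even at \<open>a = 0\<close>.
\<close>

theorem propagator_integral:
  assumes p: "p > 0"
  shows "(LINT y|M. 1 / (A y * (p\<^sup>2 + (S y)\<^sup>2))) =
         pi powr (1 + \<epsilon>) * 2 powr (- \<epsilon>) / p *
           (LINT v:{0<..<1}|lborel. v powr (\<epsilon> - 1) * sine_transform p \<epsilon> (q\<^sup>2 * (1 - v / 2)))"
proof -
  define \<delta> where "\<delta> = (\<lambda>n. inverse (real (Suc n)))"
  have \<delta>: "\<delta> n > 0" "\<delta> n \<le> 1" for n by (auto simp: \<delta>_def field_simps)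
  have \<delta>_lim: "\<delta> \<longlonglongrightarrow> 0" unfolding \<delta>_def by (rule LIMSEQ_inverse_real_of_nat)
  have pos: "p\<^sup>2 + x\<^sup>2 > 0" for x :: real using p by (intro add_pos_nonneg) auto

  have L: "(\<lambda>n. LINT y|M. 1 / (A y * (p\<^sup>2 + (S y + \<delta> n)\<^sup>2))) \<longlonglongrightarrow> (LINT y|M. 1 / (A y * (p\<^sup>2 + (S y)\<^sup>2)))"
  proof (rule integral_dominated_convergence[OF _ _ integrable_propagator[OF p]])
    show "AE y in M. (\<lambda>n. 1 / (A y * (p\<^sup>2 + (S y + \<delta> n)\<^sup>2))) \<longlonglongrightarrow> 1 / (A y * (p\<^sup>2 + (S y)\<^sup>2))"
      using A_pos
    proof eventually_elim
      fix y assume "A y > 0"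
      then have "(\<lambda>n. 1 / (A y * (p\<^sup>2 + (S y + \<delta> n)\<^sup>2))) \<longlonglongrightarrow> 1 / (A y * (p\<^sup>2 + (S y + 0)\<^sup>2))"
        using pos[of "S y"] by (intro tendsto_intros \<delta>_lim) auto
      then show "(\<lambda>n. 1 / (A y * (p\<^sup>2 + (S y + \<delta> n)\<^sup>2))) \<longlonglongrightarrow> 1 / (A y * (p\<^sup>2 + (S y)\<^sup>2))" by simp
    qed
    show "AE y in M. norm (1 / (A y * (p\<^sup>2 + (S y + \<delta> n)\<^sup>2))) \<le> 1 / (A y * (p\<^sup>2 + (S y)\<^sup>2))" for n
      using A_pos
    proof eventually_elim
      fix y assume A: "A y > 0"
      have "(S y)\<^sup>2 \<le> (S y + \<delta> n)\<^sup>2"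
        using S_nonneg[of y] \<delta>(1)[of n] by (intro power_mono) auto
      then have "A y * (p\<^sup>2 + (S y)\<^sup>2) \<le> A y * (p\<^sup>2 + (S y + \<delta> n)\<^sup>2)"
        using A by simp
      moreover have "0 < A y * (p\<^sup>2 + (S y)\<^sup>2)" using A pos[of "S y"] by simp
      ultimately show "norm (1 / (A y * (p\<^sup>2 + (S y + \<delta> n)\<^sup>2))) \<le> 1 / (A y * (p\<^sup>2 + (S y)\<^sup>2))"
        by (auto intro!: divide_left_mono)
    qed
  qed auto

  have "compact (sine_transform p \<epsilon> ` {0..1 + q\<^sup>2})"
    by (intro compact_continuous_image continuous_on_subset[OF sine_transform_continuous[OF p]]) auto
  then obtain B where "\<forall>a\<in>{0..1 + q\<^sup>2}. \<bar>sine_transform p \<epsilon> a\<bar> \<le> B"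
    by (auto dest!: compact_imp_bounded simp: bounded_iff)
  then have B: "\<bar>sine_transform p \<epsilon> a\<bar> \<le> B" if "a \<in> {0..1 + q\<^sup>2}" for a
    using that by blast
  have arg: "\<delta> n + q\<^sup>2 * (1 - v / 2) \<in> {0..1 + q\<^sup>2}" if "v \<in> {0<..<1}" for n v
  proof -
    have "q\<^sup>2 * (1 - v / 2) \<le> q\<^sup>2 * 1" using that by (intro mult_left_mono) auto
    then show ?thesis
      using \<delta>[of n] that by (auto intro!: add_nonneg_nonneg mult_nonneg_nonneg)
  qed
  have meas: "(\<lambda>v. indicator {0<..<1} v *\<^sub>R (v powr (\<epsilon> - 1) * sine_transform p \<epsilon> (x + q\<^sup>2 * (1 - v / 2)))) \<in> borel_measurable borel"
    if "x \<ge> 0" for x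
  proof -
    have "continuous_on {0<..<1} (\<lambda>v. v powr (\<epsilon> - 1) * sine_transform p \<epsilon> (x + q\<^sup>2 * (1 - v / 2)))"
      using that
      by (intro continuous_intros continuous_on_compose2[OF sine_transform_continuous[OF p]])
         (auto intro!: add_nonneg_nonneg mult_nonneg_nonneg)
    then show ?thesis by (intro borel_measurable_continuous_on_indicator) auto
  qed
  have R: "(\<lambda>n. LINT v:{0<..<1}|lborel. v powr (\<epsilon> - 1) * sine_transform p \<epsilon> (\<delta> n + q\<^sup>2 * (1 - v / 2))) \<longlonglongrightarrow>
     (LINT v:{0<..<1}|lborel. v powr (\<epsilon> - 1) * sine_transform p \<epsilon> (0 + q\<^sup>2 * (1 - v / 2)))"
    unfolding set_lebesgue_integral_def
  proof (rule integral_dominated_convergence[where w = "\<lambda>v. B * (indicator {0<..<1} v *\<^sub>R v powr (\<epsilon> - 1))"])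
    show "integrable lborel (\<lambda>v. B * (indicator {0<..<1} v *\<^sub>R v powr (\<epsilon> - 1)))"
      using powr_integrable unfolding set_integrable_def by simp
    show "AE v in lborel. (\<lambda>n. indicator {0<..<1} v *\<^sub>R (v powr (\<epsilon> - 1) * sine_transform p \<epsilon> (\<delta> n + q\<^sup>2 * (1 - v / 2)))) \<longlonglongrightarrow>
        indicator {0<..<1} v *\<^sub>R (v powr (\<epsilon> - 1) * sine_transform p \<epsilon> (0 + q\<^sup>2 * (1 - v / 2)))"
    proof (rule AE_I2)
      fix v :: real
      show "(\<lambda>n. indicator {0<..<1} v *\<^sub>R (v powr (\<epsilon> - 1) * sine_transform p \<epsilon> (\<delta> n + q\<^sup>2 * (1 - v / 2)))) \<longlonglongrightarrow>
        indicator {0<..<1} v *\<^sub>R (v powr (\<epsilon> - 1) * sine_transform p \<epsilon> (0 + q\<^sup>2 * (1 - v / 2)))"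
      proof (cases "v \<in> {0<..<1}")
        case True
        have "(\<lambda>n. sine_transform p \<epsilon> (\<delta> n + q\<^sup>2 * (1 - v / 2))) \<longlonglongrightarrow> sine_transform p \<epsilon> (0 + q\<^sup>2 * (1 - v / 2))"
          using arg[OF True] True
          by (intro continuous_on_tendsto_compose[OF sine_transform_continuous[OF p]] tendsto_intros \<delta>_lim)
             (auto intro!: mult_nonneg_nonneg)
        then show ?thesis by (intro tendsto_intros)
      qed simp
    qed
    show "AE v in lborel. norm (indicator {0<..<1} v *\<^sub>R (v powr (\<epsilon> - 1) * sine_transform p \<epsilon> (\<delta> n + q\<^sup>2 * (1 - v / 2)))) \<le>
        B * (indicator {0<..<1} v *\<^sub>R v powr (\<epsilon> - 1))" for n
      using B[OF arg] by (intro AE_I2) (auto simp: indicator_def abs_mult mult.commute intro!: mult_right_mono)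
    show "(\<lambda>v. indicator {0<..<1} v *\<^sub>R (v powr (\<epsilon> - 1) * sine_transform p \<epsilon> (0 + q\<^sup>2 * (1 - v / 2)))) \<in> borel_measurable lborel"
      unfolding measurable_lborel2 by (rule meas) simp
    show "(\<lambda>v. indicator {0<..<1} v *\<^sub>R (v powr (\<epsilon> - 1) * sine_transform p \<epsilon> (\<delta> n + q\<^sup>2 * (1 - v / 2)))) \<in> borel_measurable lborel" for n
      unfolding measurable_lborel2 by (rule meas) (use \<delta>(1)[of n] in simp)
  qed
  have "(\<lambda>n. LINT y|M. 1 / (A y * (p\<^sup>2 + (S y + \<delta> n)\<^sup>2))) \<longlonglongrightarrow> pi powr (1 + \<epsilon>) * 2 powr (- \<epsilon>) / p *
       (LINT v:{0<..<1}|lborel. v powr (\<epsilon> - 1) * sine_transform p \<epsilon> (0 + q\<^sup>2 * (1 - v / 2)))"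
    unfolding regularized_integral[OF p \<delta>(1)] by (intro tendsto_intros R)
  from LIMSEQ_unique[OF L this] show ?thesis by simp
qed

end

section \<open>The integral over \<open>v\<close> and the hypergeometric series\<close>

text \<open>
  Expand \<open>(1 - z (1 - v))\<^bsup>\<epsilon>-1\<^esup>\<close> in its binomial series and integrate term by term with the Beta integral.
  For \<open>|z| < 1\<close> the series of the integrals of the norms converges, since each Beta integral is at most \<open>1/\<epsilon>\<close>.
\<close>

lemma Euler_integral_2F1:
  fixes z :: complex and \<epsilon> :: real
  assumes \<epsilon>: "\<epsilon> > 0" and z: "norm z < 1"
  defines "f \<equiv> (\<lambda>v::real. of_real (v powr (\<epsilon> - 1)) * (1 - z * of_real (1 - v)) powr of_real (\<epsilon> - 1))"
  shows "set_integrable lborel {0<..<1} f"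
    and "(LINT v:{0<..<1}|lborel. f v) = gauss_2F1 1 (1 - of_real \<epsilon>) (1 + of_real \<epsilon>) z / of_real \<epsilon>"
proof -
  define c where "c = (\<lambda>n. pochhammer (1 - complex_of_real \<epsilon>) n / fact n)"
  define g where "g = (\<lambda>n v. c n * z ^ n * of_real (indicator {0<..<1} v *\<^sub>R (v powr (\<epsilon> - 1) * (1 - v) ^ n)))"
  have bin: "(\<lambda>n. c n * x ^ n) sums (1 - x) powr of_real (\<epsilon> - 1)" if "norm x < 1" for x :: complex
  proof -
    have "((complex_of_real (\<epsilon> - 1) gchoose n) * (- x) ^ n) = c n * x ^ n" for n
      by (simp add: gbinomial_pochhammer c_def power_minus[of x])
    then show ?thesis
      using gen_binomial_complex[of "- x" "of_real (\<epsilon> - 1)"] that by simp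
  qed
  have sm: "summable (\<lambda>n. norm (c n * x ^ n))" if nx: "norm x < 1" for x :: complex
  proof -
    obtain r where r: "norm x < r" "r < 1" using dense[OF nx] by blast
    moreover have "r > 0" using r(1) norm_ge_zero[of x] by linarith
    ultimately have "norm (complex_of_real r) < 1" "norm x < norm (complex_of_real r)"
      by simp_all
    with powser_insidea[OF sums_summable[OF bin]] show ?thesis by blast
  qed
  have g_int: "integrable lborel (g n)" for n
    using Beta_weight(1)[OF \<epsilon>, of n] unfolding set_integrable_def g_def
    by (intro integrable_mult_right integrable_of_real) auto
  have fact_le: "fact n \<le> pochhammer (1 + \<epsilon>) n" for n
    unfolding pochhammer_fact pochhammer_prod using \<epsilon> by (intro prod_mono) auto
  have g_sums: "(\<lambda>n. g n v) sums (indicator {0<..<1} v *\<^sub>R f v)" for v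
  proof (cases "v \<in> {0<..<1}")
    case True
    have "norm (z * of_real (1 - v)) < 1"
    proof -
      have "norm z * \<bar>1 - v\<bar> \<le> norm z * 1" using True by (intro mult_left_mono) auto
      then show ?thesis using z by (simp add: norm_mult del: of_real_diff)
    qed
    from sums_mult[OF bin[OF this], of "of_real (v powr (\<epsilon> - 1))"] show ?thesis
      using True by (simp add: g_def f_def power_mult_distrib mult_ac)
  qed (simp add: g_def)
  have g_summable: "summable (\<lambda>n. norm (g n v))" for v
  proof (rule summable_comparison_test')
    show "summable (\<lambda>n. norm (c n * z ^ n) * (indicator {0<..<1} v * v powr (\<epsilon> - 1)))"
      by (intro summable_mult2 sm z)
    show "norm (norm (g n v)) \<le> norm (c n * z ^ n) * (indicator {0<..<1} v * v powr (\<epsilon> - 1))" for n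
    proof (cases "v \<in> {0<..<1}")
      case True
      then have "v powr (\<epsilon> - 1) * (1 - v) ^ n \<le> v powr (\<epsilon> - 1)"
        by (intro mult_left_le power_le_one) auto
      then have "norm (c n * z ^ n) * (v powr (\<epsilon> - 1) * (1 - v) ^ n) \<le> norm (c n * z ^ n) * v powr (\<epsilon> - 1)"
        by (intro mult_left_mono) auto
      then show ?thesis
        using True by (simp add: g_def norm_mult norm_power del: of_real_power of_real_diff of_real_mult)
    qed (simp add: g_def)
  qed
  have g_norm: "(LINT v|lborel. norm (g n v)) = norm (c n * z ^ n) * (fact n / (\<epsilon> * pochhammer (1 + \<epsilon>) n))" for n
  proof -
    have "(LINT v|lborel. norm (g n v)) = (LINT v|lborel. norm (c n * z ^ n) * (indicator {0<..<1} v *\<^sub>R (v powr (\<epsilon> - 1) * (1 - v) ^ n)))"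
      by (intro Bochner_Integration.integral_cong refl)
        (auto simp: g_def norm_mult indicator_def simp del: of_real_power of_real_diff of_real_mult)
    also have "\<dots> = norm (c n * z ^ n) * (fact n / (\<epsilon> * pochhammer (1 + \<epsilon>) n))"
      using Beta_weight(2)[OF \<epsilon>, of n] unfolding set_lebesgue_integral_def by simp
    finally show ?thesis .
  qed
  have norm_summable: "summable (\<lambda>n. LINT v|lborel. norm (g n v))"
  proof (rule summable_comparison_test')
    show "summable (\<lambda>n. norm (c n * z ^ n) * (1 / \<epsilon>))"
      by (intro summable_mult2 sm z)
    have "fact n / (\<epsilon> * pochhammer (1 + \<epsilon>) n) \<le> 1 / \<epsilon>" for n
      using fact_le[of n] \<epsilon> pochhammer_pos[of "1 + \<epsilon>" n] by (simp add: field_simps)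
    then show "norm (LINT v|lborel. norm (g n v)) \<le> norm (c n * z ^ n) * (1 / \<epsilon>)" for n
      unfolding g_norm using \<epsilon> pochhammer_pos[of "1 + \<epsilon>" n]
      by (simp only: real_norm_def abs_mult) (intro mult_mono, auto)
  qed
  have g_suminf: "(\<Sum>n. g n v) = indicator {0<..<1} v *\<^sub>R f v" for v
    using sums_unique[OF g_sums] by simp
  show "set_integrable lborel {0<..<1} f"
    unfolding set_integrable_def g_suminf[symmetric]
    by (rule integrable_suminf[OF g_int AE_I2[OF g_summable] norm_summable])
  have "(\<lambda>n. integral\<^sup>L lborel (g n)) sums (LINT v:{0<..<1}|lborel. f v)"
    unfolding set_lebesgue_integral_def g_suminf[symmetric]
    by (rule sums_integral[OF g_int AE_I2[OF g_summable] norm_summable])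
  then have "(LINT v:{0<..<1}|lborel. f v) = (\<Sum>n. integral\<^sup>L lborel (g n))"
    by (simp add: sums_iff)
  also have "\<dots> = (\<Sum>n. fps_nth (fps_hypergeo [1, 1 - of_real \<epsilon>] [1 + of_real \<epsilon>] 1) n * z ^ n / of_real \<epsilon>)"
  proof (rule suminf_cong)
    fix n
    have "integral\<^sup>L lborel (g n) = c n * z ^ n * of_real (LINT v:{0<..<1}|lborel. v powr (\<epsilon> - 1) * (1 - v) ^ n)"
      unfolding g_def set_lebesgue_integral_def integral_mult_right_zero integral_complex_of_real ..
    also have "\<dots> = fps_nth (fps_hypergeo [1, 1 - of_real \<epsilon>] [1 + of_real \<epsilon>] 1) n * z ^ n / of_real \<epsilon>"
      unfolding Beta_weight(2)[OF \<epsilon>]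
      using pochhammer_of_real[of "1 + \<epsilon>" n, where 'a = complex]
      by (simp add: c_def pochhammer_fact[symmetric])
    finally show "integral\<^sup>L lborel (g n) = fps_nth (fps_hypergeo [1, 1 - of_real \<epsilon>] [1 + of_real \<epsilon>] 1) n * z ^ n / of_real \<epsilon>" .
  qed
  also have "\<dots> = gauss_2F1 1 (1 - of_real \<epsilon>) (1 + of_real \<epsilon>) z / of_real \<epsilon>"
  proof -
    have "summable (\<lambda>n. fps_nth (fps_hypergeo [1, 1 - complex_of_real \<epsilon>] [1 + of_real \<epsilon>] 1) n * z ^ n)"
    proof (rule summable_comparison_test'[OF sm[OF z]])
      fix n
      have "norm (fact n / complex_of_real (pochhammer (1 + \<epsilon>) n)) \<le> 1"
        using fact_le[of n] pochhammer_pos[of "1 + \<epsilon>" n] \<epsilon> by (simp add: norm_divide)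
      then have "norm (c n * z ^ n) * norm (fact n / complex_of_real (pochhammer (1 + \<epsilon>) n)) \<le> norm (c n * z ^ n) * 1"
        by (intro mult_left_mono) auto
      moreover have "fps_nth (fps_hypergeo [1, 1 - complex_of_real \<epsilon>] [1 + of_real \<epsilon>] 1) n * z ^ n =
          (c n * z ^ n) * (fact n / complex_of_real (pochhammer (1 + \<epsilon>) n))"
        using pochhammer_of_real[of "1 + \<epsilon>" n, where 'a = complex]
        by (simp add: c_def pochhammer_fact[symmetric])
      ultimately show "norm (fps_nth (fps_hypergeo [1, 1 - complex_of_real \<epsilon>] [1 + of_real \<epsilon>] 1) n * z ^ n)
          \<le> norm (c n * z ^ n)"
        by (simp only: norm_mult mult_1_right)
    qed
    from suminf_divide[OF this, of "of_real \<epsilon>"] show ?thesis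
      by (simp add: gauss_2F1_def eval_fps_def)
  qed
  finally show "(LINT v:{0<..<1}|lborel. f v) = gauss_2F1 1 (1 - of_real \<epsilon>) (1 + of_real \<epsilon>) z / of_real \<epsilon>" .
qed

text \<open>
  The common value of the two integrals of the theorem; unlike the closed form it is defined at
  \<open>\<epsilon> = 1\<close> as well.
\<close>

definition reduced_integral :: "real \<Rightarrow> real \<Rightarrow> real \<Rightarrow> real" where
  "reduced_integral p q \<epsilon> =
     pi powr (1 + \<epsilon>) * 2 powr (- \<epsilon>) / p / (2 * pi) powr (2 + 2 * \<epsilon>) *
       (LINT v:{0<..<1}|lborel. v powr (\<epsilon> - 1) * sine_transform p \<epsilon> (q\<^sup>2 * (1 - v / 2)))"

lemma powr_mult_Re_nonneg:
  fixes x y s :: complex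
  assumes "x \<noteq> 0" "Re x \<ge> 0" "Re y > 0"
  shows "(x * y) powr s = x powr s * y powr s"
proof -
  have y: "y \<noteq> 0" using assms by auto
  have "\<bar>Im (Ln x)\<bar> \<le> pi / 2" "\<bar>Im (Ln y)\<bar> < pi / 2"
    using assms y Re_Ln_pos_le[of x] Re_Ln_pos_lt[of y] by auto
  then have "Ln (x * y) = Ln x + Ln y"
    using assms(1) y by (intro Ln_times_simple) auto
  then show ?thesis
    using assms(1) y by (simp add: powr_def exp_add algebra_simps)
qed

text \<open>
  The base \<open>q\<^sup>2 (1 - v/2) - ip\<close> factors as \<open>(w/2) (1 - z (1 - v))\<close>. The first factor lies in the closed and the
  second in the open right half plane, so the principal powers multiply and \<open>w\<^bsup>\<epsilon>-1\<^esup>\<close> comes out of the integral.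
\<close>

lemma reduced_integral_eq_closed_form:
  assumes p: "p > 0" and \<epsilon>: "0 < \<epsilon>" "\<epsilon> < 2" "\<epsilon> \<noteq> 1"
  shows "reduced_integral p q \<epsilon> = closed_form p q \<epsilon>"
proof -
  define w where "w = complex_of_real (q\<^sup>2) - 2 * \<i> * complex_of_real p"
  define z where "z = - complex_of_real (q\<^sup>2) / w"
  have w_nz: "w \<noteq> 0" and Re_w: "Re w \<ge> 0" using p by (auto simp: w_def complex_eq_iff)
  have "(q\<^sup>2)\<^sup>2 < (cmod w)\<^sup>2"
    using p by (simp add: w_def cmod_power2)
  then have "q\<^sup>2 < cmod w" by (rule power2_less_imp_less) simp
  then have z: "norm z < 1"
    using w_nz by (simp add: z_def norm_divide norm_power)
  have Im_scale: "Im (of_real r * x) = r * Im x" for r x by simp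
  define f where "f = (\<lambda>v::real. complex_of_real (v powr (\<epsilon> - 1)) * (1 - z * of_real (1 - v)) powr of_real (\<epsilon> - 1))"
  note Euler = Euler_integral_2F1[OF \<epsilon>(1) z, folded f_def]
  define F where "F = gauss_2F1 1 (1 - of_real \<epsilon>) (1 + of_real \<epsilon>) z"
  \<comment> \<open>the factor \<open>2\<close> accounts for the power \<open>2\<^bsup>1-\<epsilon>\<^esup>\<close> in the constant of the closed form\<close>
  have w2: "w powr of_real (\<epsilon> - 1) = of_real (2 powr (\<epsilon> - 1)) * (w / 2) powr of_real (\<epsilon> - 1)"
  proof -
    have "w powr of_real (\<epsilon> - 1) = (w / 2) powr of_real (\<epsilon> - 1) * 2 powr of_real (\<epsilon> - 1)"
      using powr_mult_Re_nonneg[of "w / 2" 2 "of_real (\<epsilon> - 1)"] w_nz Re_w by simp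
    also have "(2::complex) powr of_real (\<epsilon> - 1) = of_real (2 powr (\<epsilon> - 1))"
      using powr_of_real[of 2 "\<epsilon> - 1"] by simp
    finally show ?thesis by simp
  qed
  have split: "Complex (q\<^sup>2 * (1 - v / 2)) (- p) powr of_real (\<epsilon> - 1) =
      (w / 2) powr of_real (\<epsilon> - 1) * (1 - z * of_real (1 - v)) powr of_real (\<epsilon> - 1)" if v: "v \<in> {0<..<1}" for v
  proof -
    have "norm (z * of_real (1 - v)) < 1"
    proof -
      have "norm z * \<bar>1 - v\<bar> \<le> norm z * 1" using v by (intro mult_left_mono) auto
      then show ?thesis using z by (simp add: norm_mult del: of_real_diff)
    qed
    then have "Re (1 - z * of_real (1 - v)) > 0"
      using complex_Re_le_cmod[of "z * of_real (1 - v)"] by simp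
    moreover have "Complex (q\<^sup>2 * (1 - v / 2)) (- p) = (w / 2) * (1 - z * of_real (1 - v))"
    proof -
      have "(w / 2) * (1 - z * of_real (1 - v)) = w / 2 + of_real (q\<^sup>2) * of_real (1 - v) / 2"
        using w_nz by (simp add: z_def field_simps)
      also have "\<dots> = Complex (q\<^sup>2 * (1 - v / 2)) (- p)"
        by (simp add: w_def complex_eq_iff field_simps)
      finally show ?thesis ..
    qed
    ultimately show ?thesis
      using w_nz Re_w by (simp only:) (intro powr_mult_Re_nonneg, auto)
  qed
  have "(LINT v:{0<..<1}|lborel. v powr (\<epsilon> - 1) * sine_transform p \<epsilon> (q\<^sup>2 * (1 - v / 2))) =
     (LINT v|lborel. Im (of_real (Gamma (1 - \<epsilon>)) * (w / 2) powr of_real (\<epsilon> - 1) * (indicator {0<..<1} v *\<^sub>R f v)))"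
    unfolding set_lebesgue_integral_def
  proof (rule Bochner_Integration.integral_cong[OF refl])
    fix v :: real
    show "indicator {0<..<1} v *\<^sub>R (v powr (\<epsilon> - 1) * sine_transform p \<epsilon> (q\<^sup>2 * (1 - v / 2))) =
       Im (of_real (Gamma (1 - \<epsilon>)) * (w / 2) powr of_real (\<epsilon> - 1) * (indicator {0<..<1} v *\<^sub>R f v))"
    proof (cases "v \<in> {0<..<1}")
      case True
      have "of_real (Gamma (1 - \<epsilon>)) * (w / 2) powr of_real (\<epsilon> - 1) * f v =
         of_real (v powr (\<epsilon> - 1) * Gamma (1 - \<epsilon>)) * Complex (q\<^sup>2 * (1 - v / 2)) (- p) powr of_real (\<epsilon> - 1)"
        unfolding split[OF True] f_def by (simp only: of_real_mult mult_ac)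
      then have "Im (of_real (Gamma (1 - \<epsilon>)) * (w / 2) powr of_real (\<epsilon> - 1) * f v) =
         v powr (\<epsilon> - 1) * sine_transform p \<epsilon> (q\<^sup>2 * (1 - v / 2))"
        using \<epsilon>(3) by (simp only: sine_transform_def Im_scale if_False mult.assoc)
      then show ?thesis
        using True by simp
    qed simp
  qed
  also have "\<dots> = Im (LINT v|lborel. of_real (Gamma (1 - \<epsilon>)) * (w / 2) powr of_real (\<epsilon> - 1) * (indicator {0<..<1} v *\<^sub>R f v))"
    using Euler(1) unfolding set_integrable_def by (intro integral_Im integrable_mult_right) auto
  also have "(LINT v|lborel. of_real (Gamma (1 - \<epsilon>)) * (w / 2) powr of_real (\<epsilon> - 1) * (indicator {0<..<1} v *\<^sub>R f v)) =
      of_real (Gamma (1 - \<epsilon>)) * (w / 2) powr of_real (\<epsilon> - 1) * (F / of_real \<epsilon>)"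
    using Euler(2) unfolding set_lebesgue_integral_def integral_mult_right_zero F_def by simp
  also have "\<dots> = of_real (- Gamma (- \<epsilon>) * 2 powr (1 - \<epsilon>)) * (w powr of_real (\<epsilon> - 1) * F)"
  proof -
    have "- \<epsilon> \<notin> \<int>\<^sub>\<le>\<^sub>0"
    proof
      assume "- \<epsilon> \<in> \<int>\<^sub>\<le>\<^sub>0"
      then obtain n where n: "\<epsilon> = real n" by (auto elim!: nonpos_Ints_cases')
      then have "n = 1" using \<epsilon> by auto
      with n \<epsilon>(3) show False by simp
    qed
    then have "Gamma (1 - \<epsilon>) = - \<epsilon> * Gamma (- \<epsilon>)"
      using Gamma_plus1[of "- \<epsilon>"] by simp
    moreover have "2 powr (1 - \<epsilon>) * 2 powr (\<epsilon> - 1) = (1::real)"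
      by (simp add: powr_add[symmetric])
    then have "complex_of_real (2 powr (1 - \<epsilon>)) * of_real (2 powr (\<epsilon> - 1)) = 1"
      by (metis of_real_1 of_real_mult)
    ultimately show ?thesis
      unfolding w2 using \<epsilon>(1) by (simp add: mult.assoc[symmetric])
  qed
  finally have I: "(LINT v:{0<..<1}|lborel. v powr (\<epsilon> - 1) * sine_transform p \<epsilon> (q\<^sup>2 * (1 - v / 2))) =
     - Gamma (- \<epsilon>) * 2 powr (1 - \<epsilon>) * Im (w powr of_real (\<epsilon> - 1) * F)"
    by (simp only: Im_scale)
  have "pi powr (1 + \<epsilon>) * 2 powr (- \<epsilon>) / p / (2 * pi) powr (2 + 2 * \<epsilon>) * 2 powr (1 - \<epsilon>) =
      1 / p / (2 powr (1 + 4 * \<epsilon>) * pi powr (1 + \<epsilon>))"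
  proof -
    have "pi powr (2 + 2 * \<epsilon>) = pi powr (1 + \<epsilon>) * pi powr (1 + \<epsilon>)"
      "2 powr (2 + 2 * \<epsilon>) = 2 powr (1 + 4 * \<epsilon>) * (2 powr (- \<epsilon>) * 2 powr (1 - \<epsilon>))"
      by (simp_all add: powr_add[symmetric])
    then show ?thesis by (simp add: powr_mult)
  qed
  moreover have "C * (- G * T * X) = - (1 / p) * (G / D) * X" if "C * T = 1 / p / D" for C D G T X :: real
  proof -
    have "C * (- G * T * X) = - ((C * T) * G * X)" by simp
    then show ?thesis unfolding that by simp
  qed
  moreover have "- 1 + \<epsilon> = \<epsilon> - 1" by simp
  ultimately show ?thesis
    unfolding reduced_integral_def I closed_form_def Let_def w_def[symmetric] z_def[symmetric] F_def[symmetric]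
    by (simp only:)
qed

text \<open>
  In polar form the pole of \<open>\<Gamma>(1 - \<epsilon>)\<close> at \<open>\<epsilon> = 1\<close> is absorbed by the zero of \<open>sin ((\<epsilon> - 1) \<phi>)\<close>, where
  \<open>\<phi> = Arg (a - ip)\<close>. The limit and a uniform bound near \<open>\<epsilon> = 1\<close> are read off from this.
\<close>

lemma sine_transform_polar:
  assumes p: "p > 0" and \<epsilon>: "\<epsilon> < 2" "\<epsilon> \<noteq> 1"
  shows "sine_transform p \<epsilon> a = - (Gamma (2 - \<epsilon>) * norm (Complex a (- p)) powr (\<epsilon> - 1) *
      (sin ((\<epsilon> - 1) * Im (Ln (Complex a (- p)))) / (\<epsilon> - 1)))"
proof -
  define c where "c = Complex a (- p)"
  have c: "c \<noteq> 0" using p by (simp add: c_def complex_eq_iff)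
  have "Im (c powr of_real (\<epsilon> - 1)) = norm c powr (\<epsilon> - 1) * sin ((\<epsilon> - 1) * Im (Ln c))"
    using c by (simp add: powr_def Im_exp del: of_real_diff)
  moreover note Gamma_two_minus[OF \<epsilon>]
  moreover have "- ((1 - \<epsilon>) * G * N * (s / (\<epsilon> - 1))) = G * (N * s)" for G N s :: real
  proof -
    have "(1 - \<epsilon>) * (s / (\<epsilon> - 1)) = - s" using \<epsilon> by (simp add: field_simps)
    then have "- (G * N * ((1 - \<epsilon>) * (s / (\<epsilon> - 1)))) = G * (N * s)" by simp
    then show ?thesis by (simp only: mult_ac)
  qed
  ultimately show ?thesis
    using \<epsilon> by (simp only: sine_transform_def c_def[symmetric] if_False)
qed

lemma sine_transform_tendsto:
  assumes p: "p > 0"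
  shows "((\<lambda>\<epsilon>. sine_transform p \<epsilon> a) \<longlongrightarrow> sine_transform p 1 a) (at 1)"
proof -
  define c where "c = Complex a (- p)"
  have c: "c \<noteq> 0" using p by (simp add: c_def complex_eq_iff)
  have "((\<lambda>\<epsilon>. sin ((\<epsilon> - 1) * Im (Ln c))) has_real_derivative cos ((1 - 1) * Im (Ln c)) * Im (Ln c)) (at 1)"
    by (auto intro!: derivative_eq_intros)
  then have lim: "((\<lambda>\<epsilon>. sin ((\<epsilon> - 1) * Im (Ln c)) / (\<epsilon> - 1)) \<longlongrightarrow> Im (Ln c)) (at 1)"
    by (simp add: has_field_derivative_iff)
  have "((\<lambda>\<epsilon>. - (Gamma (2 - \<epsilon>) * norm c powr (\<epsilon> - 1) * (sin ((\<epsilon> - 1) * Im (Ln c)) / (\<epsilon> - 1)))) \<longlongrightarrow>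
      - (Gamma (2 - 1) * norm c powr (1 - 1) * Im (Ln c))) (at (1::real))"
    using c by (intro tendsto_intros lim) auto
  then have "((\<lambda>\<epsilon>. - (Gamma (2 - \<epsilon>) * norm c powr (\<epsilon> - 1) * (sin ((\<epsilon> - 1) * Im (Ln c)) / (\<epsilon> - 1)))) \<longlongrightarrow>
      sine_transform p 1 a) (at 1)"
    using c by (simp add: sine_transform_def c_def)
  moreover have "\<forall>\<^sub>F \<epsilon> in at 1. - (Gamma (2 - \<epsilon>) * norm c powr (\<epsilon> - 1) * (sin ((\<epsilon> - 1) * Im (Ln c)) / (\<epsilon> - 1)))
      = sine_transform p \<epsilon> a"
    using eventually_at_in_open'[of "{..<2}" "1::real"]
    by (auto simp: eventually_at_filter sine_transform_polar[OF p] c_def elim!: eventually_mono)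
  ultimately show ?thesis by (rule Lim_transform_eventually)
qed

lemma sine_transform_bounded:
  assumes p: "p > 0"
  shows "\<exists>B. \<forall>\<epsilon>\<in>{1/2<..<3/2} - {1}. \<forall>a\<in>{0..R}. \<bar>sine_transform p \<epsilon> a\<bar> \<le> B"
proof -
  have "compact ((\<lambda>\<epsilon>. Gamma (2 - \<epsilon>)) ` {1/2..3/2::real})"
  proof (rule compact_continuous_image)
    show "continuous_on {1/2..3/2::real} (\<lambda>\<epsilon>. Gamma (2 - \<epsilon>))"
      unfolding continuous_on_def by (intro ballI tendsto_intros) (auto elim!: nonpos_Ints_cases')
  qed simp
  then obtain G where G: "\<forall>\<epsilon>\<in>{1/2..3/2::real}. \<bar>Gamma (2 - \<epsilon>)\<bar> \<le> G"
    by (auto dest!: compact_imp_bounded simp: bounded_iff)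
  \<comment> \<open>\<open>N\<close> bounds \<open>|a - ip|\<^bsup>\<epsilon>-1\<^esup>\<close> since \<open>p \<le> |a - ip| \<le> R + p\<close> and \<open>|\<epsilon> - 1| \<le> 1\<close>\<close>
  define N where "N = 1 + R + p + 1 / p"
  have "\<bar>sine_transform p \<epsilon> a\<bar> \<le> G * N * pi" if \<epsilon>: "\<epsilon> \<in> {1/2<..<3/2}" "\<epsilon> \<noteq> 1" and a: "a \<in> {0..R}" for \<epsilon> a
  proof -
    define c where "c = Complex a (- p)"
    have c: "c \<noteq> 0" using p by (simp add: c_def complex_eq_iff)
    have c_le: "norm c \<le> R + p" using a p by (simp add: c_def cmod_le[THEN order_trans])
    have c_ge: "p \<le> norm c" using abs_Im_le_cmod[of c] p by (simp add: c_def)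
    have "norm c powr (\<epsilon> - 1) \<le> N"
    proof (cases "norm c \<ge> 1")
      case True
      have "norm c powr (\<epsilon> - 1) \<le> norm c powr 1" using True \<epsilon> by (intro powr_mono) auto
      also have "\<dots> \<le> N" using c_le p c by (simp add: N_def add_increasing2)
      finally show ?thesis .
    next
      case False
      have "norm c powr (\<epsilon> - 1) \<le> norm c powr (- 1)" using False \<epsilon> c by (intro powr_mono') auto
      also have "\<dots> = 1 / norm c" using c by (simp add: powr_minus divide_inverse)
      also have "\<dots> \<le> 1 / p" using c_ge p c by (intro divide_left_mono mult_pos_pos) auto
      also have "\<dots> \<le> N" using a p by (simp add: N_def)
      finally show ?thesis .
    qed
    moreover have "\<bar>sin ((\<epsilon> - 1) * Im (Ln c)) / (\<epsilon> - 1)\<bar> \<le> pi"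
    proof -
      have "\<bar>sin ((\<epsilon> - 1) * Im (Ln c))\<bar> \<le> \<bar>(\<epsilon> - 1) * Im (Ln c)\<bar>" by (rule abs_sin_x_le_abs_x)
      also have "\<dots> \<le> \<bar>\<epsilon> - 1\<bar> * pi"
        using mpi_less_Im_Ln[OF c] Im_Ln_le_pi[OF c] unfolding abs_mult by (intro mult_left_mono) auto
      finally show ?thesis using \<epsilon> by (simp add: field_simps)
    qed
    moreover have "\<bar>Gamma (2 - \<epsilon>)\<bar> \<le> G" using G \<epsilon> by auto
    moreover from calculation have "0 \<le> G" "0 \<le> N"
      using powr_ge_zero[of "norm c" "\<epsilon> - 1"] by linarith+
    ultimately have "\<bar>Gamma (2 - \<epsilon>)\<bar> * norm c powr (\<epsilon> - 1) * \<bar>sin ((\<epsilon> - 1) * Im (Ln c)) / (\<epsilon> - 1)\<bar> \<le> G * N * pi"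
      by (intro mult_mono) auto
    then show ?thesis
      using \<epsilon> by (subst sine_transform_polar[OF p]) (auto simp: abs_mult c_def)
  qed
  then show ?thesis by blast
qed

lemma weighted_sine_transform_measurable:
  assumes "p > 0"
  shows "(\<lambda>v. indicator {0<..<1} v *\<^sub>R (v powr (\<epsilon> - 1) * sine_transform p \<epsilon> (q\<^sup>2 * (1 - v / 2)))) \<in> borel_measurable lborel"
proof -
  have "continuous_on {0<..<1} (\<lambda>v. v powr (\<epsilon> - 1) * sine_transform p \<epsilon> (q\<^sup>2 * (1 - v / 2)))"
    by (intro continuous_intros continuous_on_compose2[OF sine_transform_continuous[OF assms]])
       (auto intro!: mult_nonneg_nonneg)
  then show ?thesis
    unfolding measurable_lborel2 by (intro borel_measurable_continuous_on_indicator) auto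
qed

lemma weighted_sine_transform_tendsto:
  fixes X :: "nat \<Rightarrow> real"
  assumes p: "p > 0" and X: "\<And>i. X i \<noteq> 1" "X \<longlonglongrightarrow> 1"
  shows "(\<lambda>i. indicator {0<..<1} v *\<^sub>R (v powr (X i - 1) * sine_transform p (X i) (q\<^sup>2 * (1 - v / 2)))) \<longlonglongrightarrow>
     indicator {0<..<1} v *\<^sub>R (v powr (1 - 1) * sine_transform p 1 (q\<^sup>2 * (1 - v / 2)))"
proof (cases "v \<in> {0<..<1}")
  case True
  have "filterlim X (at 1) sequentially"
    using X by (simp add: filterlim_at)
  with sine_transform_tendsto[OF p]
  have lim: "(\<lambda>i. sine_transform p (X i) (q\<^sup>2 * (1 - v / 2))) \<longlonglongrightarrow> sine_transform p 1 (q\<^sup>2 * (1 - v / 2))"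
    by (rule filterlim_compose)
  have "(\<lambda>i. v powr (X i - 1)) \<longlonglongrightarrow> v powr (1 - 1)"
    using True by (intro tendsto_powr tendsto_const tendsto_diff X(2)) simp
  from tendsto_mult[OF this lim] show ?thesis
    using True by simp
qed simp

lemma weighted_sine_transform_le:
  assumes B: "v \<in> {0<..<1} \<Longrightarrow> \<bar>sine_transform p \<epsilon> (q\<^sup>2 * (1 - v / 2))\<bar> \<le> B"
    and \<epsilon>: "1/2 < \<epsilon>"
  shows "norm (indicator {0<..<1} v *\<^sub>R (v powr (\<epsilon> - 1) * sine_transform p \<epsilon> (q\<^sup>2 * (1 - v / 2)))) \<le>
     B * (indicator {0<..<1} v *\<^sub>R (v powr (1/2 - 1)))"
proof (cases "v \<in> {0<..<1}")
  case True
  have "v powr (\<epsilon> - 1) \<le> v powr (1/2 - 1)"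
    using True \<epsilon> by (intro powr_mono') auto
  then have "v powr (\<epsilon> - 1) * \<bar>sine_transform p \<epsilon> (q\<^sup>2 * (1 - v / 2))\<bar> \<le> v powr (1/2 - 1) * B"
    by (intro mult_mono B True) auto
  then show ?thesis using True by (simp add: abs_mult mult.commute)
qed simp

text \<open>
  Dominated convergence along a sequence: for \<open>\<epsilon> > 1/2\<close> the integrand is at most a constant times \<open>v\<^bsup>-1/2\<^esup>\<close>.
\<close>

lemma reduced_integral_sequentially:
  fixes X :: "nat \<Rightarrow> real"
  assumes p: "p > 0" and X: "\<And>i. X i \<in> {1/2<..<3/2}" "\<And>i. X i \<noteq> 1" "X \<longlonglongrightarrow> 1"
  shows "(\<lambda>i. reduced_integral p q (X i)) \<longlonglongrightarrow> reduced_integral p q 1"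
proof -
  obtain B where B: "\<forall>\<epsilon>\<in>{1/2<..<3/2} - {1}. \<forall>a\<in>{0..q\<^sup>2}. \<bar>sine_transform p \<epsilon> a\<bar> \<le> B"
    using sine_transform_bounded[OF p, of "q\<^sup>2"] by blast
  have arg: "q\<^sup>2 * (1 - v / 2) \<in> {0..q\<^sup>2}" if "v \<in> {0<..<1}" for v
    using that mult_left_mono[of "1 - v / 2" 1 "q\<^sup>2"] by simp
  have "integrable lborel (\<lambda>v. B * (indicator {0<..<1} v *\<^sub>R (v powr (1/2 - 1))))"
    using Beta_weight(1)[of "1/2" 0] by (simp add: set_integrable_def)
  then have "(\<lambda>i. LINT v:{0<..<1}|lborel. v powr (X i - 1) * sine_transform p (X i) (q\<^sup>2 * (1 - v / 2))) \<longlonglongrightarrow>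
      (LINT v:{0<..<1}|lborel. v powr (1 - 1) * sine_transform p 1 (q\<^sup>2 * (1 - v / 2)))"
    unfolding set_lebesgue_integral_def
  proof (rule integral_dominated_convergence[rotated 2])
    show "AE v in lborel. (\<lambda>i. indicator {0<..<1} v *\<^sub>R (v powr (X i - 1) * sine_transform p (X i) (q\<^sup>2 * (1 - v / 2)))) \<longlonglongrightarrow>
        indicator {0<..<1} v *\<^sub>R (v powr (1 - 1) * sine_transform p 1 (q\<^sup>2 * (1 - v / 2)))"
      by (intro AE_I2 weighted_sine_transform_tendsto p X)
    show "AE v in lborel. norm (indicator {0<..<1} v *\<^sub>R (v powr (X i - 1) * sine_transform p (X i) (q\<^sup>2 * (1 - v / 2)))) \<le>
        B * (indicator {0<..<1} v *\<^sub>R (v powr (1/2 - 1)))" for i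
      using X(1,2)[of i] by (intro AE_I2 weighted_sine_transform_le B[rule_format] arg) simp_all
  qed (rule weighted_sine_transform_measurable[OF p])+
  then show ?thesis
    unfolding reduced_integral_def
    using p by (intro tendsto_mult tendsto_divide tendsto_powr tendsto_add tendsto_minus tendsto_const X(3)) simp_all
qed

lemma reduced_integral_tendsto:
  assumes p: "p > 0"
  shows "(reduced_integral p q \<longlongrightarrow> reduced_integral p q 1) (at 1)"
proof -
  have "(reduced_integral p q \<longlongrightarrow> reduced_integral p q 1) (at 1 within {1/2<..<3/2})"
    unfolding tendsto_at_iff_sequentially o_def
    by (intro allI impI reduced_integral_sequentially p) simp_all
  moreover have "at 1 within {1/2<..<3/2} = at (1::real)"
    by (rule at_within_open) simp_all
  ultimately show ?thesis by simp
qed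

lemma equals_closed_form_reduced_integral:
  assumes p: "p > 0" and \<epsilon>: "0 < \<epsilon>" "\<epsilon> < 2"
  shows "equals_closed_form (reduced_integral p q \<epsilon>) p q \<epsilon>"
proof (cases "\<epsilon> = 1")
  case True
  have "\<forall>\<^sub>F \<epsilon> in at 1. reduced_integral p q \<epsilon> = closed_form p q \<epsilon>"
    using eventually_at_in_open[of "{0<..<2}" "1::real"]
    by (auto simp: reduced_integral_eq_closed_form[OF p] elim!: eventually_mono)
  with reduced_integral_tendsto[OF p] have "(closed_form p q \<longlongrightarrow> reduced_integral p q 1) (at 1)"
    by (rule Lim_transform_eventually)
  then show ?thesis using True by (simp add: equals_closed_form_def)
qed (use assms in \<open>simp add: equals_closed_form_def reduced_integral_eq_closed_form\<close>)

section \<open>The Gaussian property in Euclidean space and in continuous dimension\<close>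

lemma nn_integral_gaussian_euclidean:
  fixes c :: "'b::euclidean_space"
  assumes \<gamma>: "\<gamma> > 0"
  shows "(\<integral>\<^sup>+y. ennreal (exp (- \<gamma> * (norm (y - c))\<^sup>2)) \<partial>lborel) = ennreal ((pi / \<gamma>) powr (real DIM('b) / 2))"
proof -
  interpret product_sigma_finite "\<lambda>b::'b. lborel :: real measure" ..
  have norm_eq: "exp (- \<gamma> * (norm ((\<Sum>b\<in>Basis. f b *\<^sub>R b) - c))\<^sup>2) = (\<Prod>b\<in>Basis. exp (- \<gamma> * (f b - c \<bullet> b)\<^sup>2))" for f :: "'b \<Rightarrow> real"
  proof -
    have "(norm ((\<Sum>b\<in>Basis. f b *\<^sub>R b) - c))\<^sup>2 = (\<Sum>b\<in>Basis. (f b - c \<bullet> b)\<^sup>2)"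
      unfolding power2_norm_eq_inner by (subst euclidean_inner) (simp add: inner_diff_left inner_sum_left inner_Basis power2_eq_square if_distrib sum.delta cong: if_cong)
    then show ?thesis by (simp add: exp_sum[symmetric] sum_distrib_left)
  qed
  have "(\<integral>\<^sup>+y. ennreal (exp (- \<gamma> * (norm (y - c))\<^sup>2)) \<partial>lborel) =
      (\<integral>\<^sup>+f. ennreal (exp (- \<gamma> * (norm ((\<Sum>b\<in>Basis. f b *\<^sub>R b) - c))\<^sup>2)) \<partial>(\<Pi>\<^sub>M b\<in>(Basis::'b set). lborel))"
    by (subst lborel_eq, subst nn_integral_distr) auto
  also have "\<dots> = (\<integral>\<^sup>+f. (\<Prod>b\<in>Basis. ennreal (exp (- \<gamma> * (f b - c \<bullet> b)\<^sup>2))) \<partial>(\<Pi>\<^sub>M b\<in>(Basis::'b set). lborel))"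
    unfolding norm_eq by (simp add: prod_ennreal)
  also have "\<dots> = (\<Prod>b\<in>(Basis::'b set). \<integral>\<^sup>+x. ennreal (exp (- \<gamma> * (x - c \<bullet> b)\<^sup>2)) \<partial>lborel)"
    by (rule product_nn_integral_prod) auto
  also have "\<dots> = ennreal (sqrt (pi / \<gamma>) ^ DIM('b))"
    unfolding nn_integral_gaussian[OF \<gamma>] using \<gamma> by (simp add: ennreal_power)
  also have "sqrt (pi / \<gamma>) ^ DIM('b) = (pi / \<gamma>) powr (real DIM('b) / 2)"
    using \<gamma> by (simp add: powr_half_sqrt[symmetric] powr_powr flip: powr_realpow)
  finally show ?thesis .
qed

text \<open>
  Completing the square: with \<open>\<gamma> = \<alpha> + 2\<beta>\<close> the exponent is \<open>-\<gamma> |y - (\<alpha>/(2\<gamma>)) Q|\<^sup>2\<close> up to a constant.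
\<close>

lemma gaussian_pair_euclidean:
  fixes Q :: "'b::euclidean_space"
  assumes m: "2 < real DIM('b)" "real DIM('b) < 6" and q: "q = norm Q"
  shows "gaussian_pair lborel (\<lambda>y. (norm (y - Q /\<^sub>R 2))\<^sup>2) (\<lambda>y. (norm (y - Q /\<^sub>R 2))\<^sup>2 + (norm (y + Q /\<^sub>R 2))\<^sup>2)
     (real DIM('b) / 2 - 1) q"
proof
  show "AE y in lborel. 0 < (norm (y - Q /\<^sub>R 2))\<^sup>2"
    using AE_lborel_singleton[of "Q /\<^sub>R 2"] by eventually_elim simp
  fix \<alpha> \<beta> :: real assume \<alpha>: "\<alpha> > 0" and \<beta>: "\<beta> > 0"
  define \<gamma> where "\<gamma> = \<alpha> + 2 * \<beta>"
  have \<gamma>: "\<gamma> > 0" using \<alpha> \<beta> by (simp add: \<gamma>_def)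
  define E where "E = - (\<alpha> * \<beta> * q\<^sup>2 / (2 * \<gamma>)) - \<beta> * q\<^sup>2 / 2"
  have square: "- \<alpha> * (norm (y - Q /\<^sub>R 2))\<^sup>2 - \<beta> * ((norm (y - Q /\<^sub>R 2))\<^sup>2 + (norm (y + Q /\<^sub>R 2))\<^sup>2)
      = - \<gamma> * (norm (y - (\<alpha> / (2 * \<gamma>)) *\<^sub>R Q))\<^sup>2 + E" for y
  proof -
    define Y X where "Y = y \<bullet> y" and "X = y \<bullet> Q"
    have qq: "Q \<bullet> Q = q\<^sup>2" unfolding q by (simp add: power2_norm_eq_inner)
    have 1: "(norm (y - Q /\<^sub>R 2))\<^sup>2 = Y - X + q\<^sup>2 / 4" "(norm (y + Q /\<^sub>R 2))\<^sup>2 = Y + X + q\<^sup>2 / 4"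
      unfolding power2_norm_eq_inner Y_def X_def
      by (simp_all add: inner_diff_left inner_diff_right inner_add_left inner_add_right inner_commute[of Q y] qq field_simps)
    have 2: "(norm (y - (\<alpha> / (2 * \<gamma>)) *\<^sub>R Q))\<^sup>2 = Y - \<alpha> / \<gamma> * X + (\<alpha> / (2 * \<gamma>))\<^sup>2 * q\<^sup>2"
      unfolding power2_norm_eq_inner Y_def X_def using \<gamma>
      by (simp add: inner_diff_left inner_diff_right inner_commute[of Q y] qq power2_eq_square field_simps)
    have "- \<alpha> * (Y - X + q\<^sup>2 / 4) - \<beta> * ((Y - X + q\<^sup>2 / 4) + (Y + X + q\<^sup>2 / 4)) =
       - \<gamma> * Y + \<alpha> * X - \<alpha> * q\<^sup>2 / 4 - \<beta> * q\<^sup>2 / 2"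
      by (simp add: \<gamma>_def algebra_simps)
    moreover have "- \<gamma> * (Y - \<alpha> / \<gamma> * X + (\<alpha> / (2 * \<gamma>))\<^sup>2 * q\<^sup>2) + E =
       - \<gamma> * Y + \<alpha> * X - \<alpha> * (\<alpha> + 2 * \<beta>) * q\<^sup>2 / (4 * \<gamma>) - \<beta> * q\<^sup>2 / 2"
      using \<gamma> by (simp add: E_def field_simps power2_eq_square)
    moreover have "\<alpha> * (\<alpha> + 2 * \<beta>) * q\<^sup>2 / (4 * \<gamma>) = \<alpha> * q\<^sup>2 / 4"
      using \<gamma> by (simp add: \<gamma>_def[symmetric])
    ultimately show ?thesis unfolding 1 2 by simp
  qed
  have "(\<integral>\<^sup>+y. ennreal (exp (- \<alpha> * (norm (y - Q /\<^sub>R 2))\<^sup>2 - \<beta> * ((norm (y - Q /\<^sub>R 2))\<^sup>2 + (norm (y + Q /\<^sub>R 2))\<^sup>2))) \<partial>lborel)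
      = (\<integral>\<^sup>+y. ennreal (exp E) * ennreal (exp (- \<gamma> * (norm (y - (\<alpha> / (2 * \<gamma>)) *\<^sub>R Q))\<^sup>2)) \<partial>lborel)"
    unfolding square exp_add by (simp add: ennreal_mult mult.commute)
  also have "\<dots> = ennreal ((pi / \<gamma>) powr (1 + (real DIM('b) / 2 - 1)) * exp E)"
    by (subst nn_integral_cmult) (simp_all add: nn_integral_gaussian_euclidean[OF \<gamma>, simplified] ennreal_mult[symmetric] mult.commute)
  finally show "(\<integral>\<^sup>+y. ennreal (exp (- \<alpha> * (norm (y - Q /\<^sub>R 2))\<^sup>2 - \<beta> * ((norm (y - Q /\<^sub>R 2))\<^sup>2 + (norm (y + Q /\<^sub>R 2))\<^sup>2))) \<partial>lborel)
     = ennreal ((pi / (\<alpha> + 2 * \<beta>)) powr (1 + (real DIM('b) / 2 - 1)) * exp (- (\<alpha> * \<beta> * q\<^sup>2 / (2 * (\<alpha> + 2 * \<beta>))) - \<beta> * q\<^sup>2 / 2))"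
    by (simp add: \<gamma>_def E_def)
qed (use m in \<open>auto\<close>)

text \<open>
  Integration in continuous dimension \<open>m\<close> as a measure on pairs of a radius and an angle; the iterated integral
  in the definition of \<open>cont_dim_integral\<close> becomes a Bochner integral by Fubini's theorem.
\<close>

definition polar_measure :: "real \<Rightarrow> (real \<times> real) measure" where
  "polar_measure m = density (lborel \<Otimes>\<^sub>M lborel)
     (\<lambda>(r, \<theta>). ennreal (2 * pi powr ((m - 1) / 2) / Gamma ((m - 1) / 2) *
        (indicator {0<..} r * r powr (m - 1) * (indicator {0..pi} \<theta> * sin \<theta> powr (m - 2)))))"

text \<open>
  The passage from polar to Cartesian coordinates \<open>x = - r cos \<theta>\<close> and \<open>\<rho>\<^sup>2 = s = r\<^sup>2 - x\<^sup>2\<close> is made by two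
  substitutions in one variable: \<open>r \<mapsto> s\<close> at fixed \<open>x\<close>, and \<open>\<theta> \<mapsto> x\<close> at fixed \<open>r\<close>. The unbounded range of \<open>r\<close> is
  exhausted by compact intervals.
\<close>

lemma nn_integral_square_substitution:
  fixes h :: "real \<Rightarrow> real" and x :: real
  assumes [measurable]: "h \<in> borel_measurable borel" and h: "\<And>s. h s \<ge> 0"
  shows "(\<integral>\<^sup>+r. ennreal (h (r\<^sup>2 - x\<^sup>2) * (2 * r)) * indicator {\<bar>x\<bar>..} r \<partial>lborel) = (\<integral>\<^sup>+s. ennreal (h s) * indicator {0..} s \<partial>lborel)"
proof -
  define b where "b = (\<lambda>n::nat. \<bar>x\<bar> + real n)"
  define F where "F = (\<lambda>r. ennreal (h (r\<^sup>2 - x\<^sup>2) * (2 * r)))"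
  define H where "H = (\<lambda>s. ennreal (h s))"
  have [measurable]: "F \<in> borel_measurable borel" "H \<in> borel_measurable borel"
    unfolding F_def H_def by measurable
  have eq: "(\<integral>\<^sup>+s. H s * indicator {0..(b n)\<^sup>2 - x\<^sup>2} s \<partial>lborel) = (\<integral>\<^sup>+r. F r * indicator {\<bar>x\<bar>..b n} r \<partial>lborel)" for n
  proof -
    have "(\<integral>\<^sup>+s. h s * indicator {(\<lambda>r. r\<^sup>2 - x\<^sup>2) \<bar>x\<bar>..(\<lambda>r. r\<^sup>2 - x\<^sup>2) (b n)} s \<partial>lborel) =
        (\<integral>\<^sup>+r. h ((\<lambda>r. r\<^sup>2 - x\<^sup>2) r) * (2 * r) * indicator {\<bar>x\<bar>..b n} r \<partial>lborel)"
    proof (rule nn_integral_substitution)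
      show "set_borel_measurable borel {\<bar>x\<bar>\<^sup>2 - x\<^sup>2..(b n)\<^sup>2 - x\<^sup>2} h"
        unfolding set_borel_measurable_def by measurable
    qed (auto intro!: derivative_eq_intros continuous_intros simp: b_def)
    moreover have "ennreal (h s * indicator A s) = H s * indicator A s" for s A
      by (simp add: H_def indicator_def)
    moreover have "ennreal (h (r\<^sup>2 - x\<^sup>2) * (2 * r) * indicator A r) = F r * indicator A r" for r A
      by (simp add: F_def indicator_def)
    ultimately show ?thesis by simp
  qed
  have emF: "(\<integral>\<^sup>+r. F r * indicator A r \<partial>lborel) = emeasure (density lborel F) A"
    and emH: "(\<integral>\<^sup>+r. H r * indicator A r \<partial>lborel) = emeasure (density lborel H) A"
    if "A \<in> sets borel" for A
    using that by (simp_all add: emeasure_density)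
  have "(\<integral>\<^sup>+r. F r * indicator {\<bar>x\<bar>..} r \<partial>lborel) = emeasure (density lborel F) (\<Union>n. {\<bar>x\<bar>..b n})"
  proof -
    have "\<exists>n. r \<le> b n" for r
      using real_arch_simple[of "r - \<bar>x\<bar>"] by (auto simp: b_def algebra_simps)
    then have "(\<Union>n. {\<bar>x\<bar>..b n}) = {\<bar>x\<bar>..}" by auto
    then show ?thesis by (simp add: emF)
  qed
  also have "\<dots> = (SUP n. emeasure (density lborel F) {\<bar>x\<bar>..b n})"
    by (rule SUP_emeasure_incseq[symmetric]) (auto simp: incseq_def b_def)
  also have "\<dots> = (SUP n. emeasure (density lborel H) {0..(b n)\<^sup>2 - x\<^sup>2})"
    using eq by (simp add: emF emH)
  also have "\<dots> = emeasure (density lborel H) (\<Union>n. {0..(b n)\<^sup>2 - x\<^sup>2})"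
  proof (rule SUP_emeasure_incseq)
    show "incseq (\<lambda>n. {0..(b n)\<^sup>2 - x\<^sup>2})"
      unfolding incseq_def b_def
      by (auto intro!: order_trans[OF _ power_mono] simp: atLeastatMost_subset_iff le_diff_eq)
  qed auto
  also have "(\<Union>n. {0..(b n)\<^sup>2 - x\<^sup>2}) = {0..}"
  proof -
    have "\<exists>n. s \<le> (b n)\<^sup>2 - x\<^sup>2" if "s \<ge> 0" for s
    proof -
      obtain n :: nat where n: "s + 1 \<le> real n" using real_arch_simple by blast
      have "s \<le> real n * 1" using n by simp
      also have "\<dots> \<le> real n * real n" using n that by (intro mult_left_mono) auto
      also have "\<dots> \<le> (b n)\<^sup>2 - x\<^sup>2" by (simp add: b_def power2_eq_square algebra_simps)
      finally show ?thesis by blast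
    qed
    then show ?thesis by auto
  qed
  also have "emeasure (density lborel H) {0..} = (\<integral>\<^sup>+s. H s * indicator {0..} s \<partial>lborel)"
    by (simp add: emH)
  finally show ?thesis unfolding F_def H_def .
qed

lemma nn_integral_polar_slice:
  fixes r k m :: real
  assumes r: "r > 0"
  shows "ennreal (r powr (m - 1)) * (\<integral>\<^sup>+\<theta>. ennreal (sin \<theta> powr (m - 2) * exp (k * r * cos \<theta>)) * indicator {0..pi} \<theta> \<partial>lborel)
     = (\<integral>\<^sup>+x. ennreal (r * ((r\<^sup>2 - x\<^sup>2) powr ((m - 3) / 2) * exp (- k * x))) * indicator {- r..r} x \<partial>lborel)"
proof -
  define f where "f = (\<lambda>x. (r\<^sup>2 - x\<^sup>2) powr ((m - 3) / 2) * exp (- k * x))"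
  have [measurable]: "f \<in> borel_measurable borel" unfolding f_def by measurable
  have "(\<integral>\<^sup>+x. f x * indicator {(\<lambda>\<theta>. - r * cos \<theta>) 0..(\<lambda>\<theta>. - r * cos \<theta>) pi} x \<partial>lborel) =
      (\<integral>\<^sup>+\<theta>. f ((\<lambda>\<theta>. - r * cos \<theta>) \<theta>) * (r * sin \<theta>) * indicator {0..pi} \<theta> \<partial>lborel)"
  proof (rule nn_integral_substitution)
    show "set_borel_measurable borel {- r * cos 0..- r * cos pi} f"
      unfolding set_borel_measurable_def by measurable
  qed (use r in \<open>auto intro!: derivative_eq_intros continuous_intros mult_nonneg_nonneg sin_ge_zero\<close>)
  also have "\<dots> = (\<integral>\<^sup>+\<theta>. ennreal (r powr (m - 2)) * (ennreal (sin \<theta> powr (m - 2) * exp (k * r * cos \<theta>)) * indicator {0..pi} \<theta>) \<partial>lborel)"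
  proof (rule nn_integral_cong)
    fix \<theta> :: real
    show "ennreal (f (- r * cos \<theta>) * (r * sin \<theta>) * indicator {0..pi} \<theta>) =
        ennreal (r powr (m - 2)) * (ennreal (sin \<theta> powr (m - 2) * exp (k * r * cos \<theta>)) * indicator {0..pi} \<theta>)"
    proof (cases "\<theta> \<in> {0..pi} \<and> sin \<theta> \<noteq> 0")
      case True
      then have s: "sin \<theta> > 0" using sin_ge_zero[of \<theta>] by auto
      have "r\<^sup>2 - (- r * cos \<theta>)\<^sup>2 = r\<^sup>2 * (sin \<theta>)\<^sup>2"
        by (simp add: sin_squared_eq power_mult_distrib algebra_simps)
      also have "\<dots> = (r * sin \<theta>) powr 2"
        using r s by (simp add: power_mult_distrib)
      finally have "r\<^sup>2 - (- r * cos \<theta>)\<^sup>2 = (r * sin \<theta>) powr 2" .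
      moreover have "2 * ((m - 3) / 2) = m - 3" by simp
      ultimately have "(r\<^sup>2 - (- r * cos \<theta>)\<^sup>2) powr ((m - 3) / 2) = (r * sin \<theta>) powr (m - 3)"
        by (simp only: powr_powr)
      moreover have "(r * sin \<theta>) powr (m - 3) * (r * sin \<theta>) = (r * sin \<theta>) powr (m - 3 + 1)"
        using r s by (subst powr_add) simp
      ultimately have "f (- r * cos \<theta>) * (r * sin \<theta>) = r powr (m - 2) * (sin \<theta> powr (m - 2) * exp (k * r * cos \<theta>))"
        using r s by (simp add: f_def powr_mult mult_ac)
      then show ?thesis using True by (simp add: ennreal_mult[symmetric])
    qed (auto simp: indicator_def)
  qed
  also have "\<dots> = ennreal (r powr (m - 2)) * (\<integral>\<^sup>+\<theta>. ennreal (sin \<theta> powr (m - 2) * exp (k * r * cos \<theta>)) * indicator {0..pi} \<theta> \<partial>lborel)"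
    by (rule nn_integral_cmult) measurable
  finally have eq: "(\<integral>\<^sup>+x. ennreal (f x * indicator {- r..r} x) \<partial>lborel) =
      ennreal (r powr (m - 2)) * (\<integral>\<^sup>+\<theta>. ennreal (sin \<theta> powr (m - 2) * exp (k * r * cos \<theta>)) * indicator {0..pi} \<theta> \<partial>lborel)"
    by simp
  have "r powr (m - 1) = r * r powr (m - 2)"
    using r powr_add[of r 1 "m - 2"] by simp
  then have "ennreal (r powr (m - 1)) * (\<integral>\<^sup>+\<theta>. ennreal (sin \<theta> powr (m - 2) * exp (k * r * cos \<theta>)) * indicator {0..pi} \<theta> \<partial>lborel)
     = ennreal r * (\<integral>\<^sup>+x. ennreal (f x * indicator {- r..r} x) \<partial>lborel)"
    using r unfolding eq by (simp add: ennreal_mult mult.assoc)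
  also have "\<dots> = (\<integral>\<^sup>+x. ennreal r * ennreal (f x * indicator {- r..r} x) \<partial>lborel)"
    by (rule nn_integral_cmult[symmetric]) measurable
  also have "\<dots> = (\<integral>\<^sup>+x. ennreal (r * f x) * indicator {- r..r} x \<partial>lborel)"
    using r by (intro nn_integral_cong) (auto simp: indicator_def ennreal_mult' )
  finally show ?thesis unfolding f_def .
qed

text \<open>
  In the Cartesian coordinates the weight is \<open>\<rho>\<^bsup>m-2\<^esup> d\<rho> dx\<close>, that is \<open>s\<^bsup>(m-3)/2\<^esup> ds dx\<close> up to a factor \<open>1/2\<close>, and the
  integrand \<open>exp (-\<gamma> x\<^sup>2 - k x) exp (-\<gamma> s)\<close> factorizes into a Gaussian and a Gamma integral.
\<close>

lemma nn_integral_polar_gaussian: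
  fixes m \<gamma> k :: real
  assumes m: "m > 1" and \<gamma>: "\<gamma> > 0"
  shows "(\<integral>\<^sup>+r. ennreal (exp (- \<gamma> * r\<^sup>2)) * indicator {0<..} r *
            (ennreal (r powr (m - 1)) * (\<integral>\<^sup>+\<theta>. ennreal (sin \<theta> powr (m - 2) * exp (k * r * cos \<theta>)) * indicator {0..pi} \<theta> \<partial>lborel)) \<partial>lborel)
     = ennreal (Gamma ((m - 1) / 2) / (2 * pi powr ((m - 1) / 2)) * ((pi / \<gamma>) powr (m / 2) * exp (k\<^sup>2 / (4 * \<gamma>))))"
proof -
  define s where "s = (m - 1) / 2"
  have s: "s > 0" using m by (simp add: s_def)
  define h where "h = (\<lambda>t. t powr (s - 1) * exp (- \<gamma> * t))"
  have [measurable]: "h \<in> borel_measurable borel" unfolding h_def by measurable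
  have h0: "h t \<ge> 0" for t by (simp add: h_def)
  have "(\<integral>\<^sup>+t. ennreal (h t) * indicator {0..} t \<partial>lborel) = (\<integral>\<^sup>+t. ennreal (h t) * indicator {0<..} t \<partial>lborel)"
    by (intro nn_integral_cong) (auto simp: h_def indicator_def)
  also have "\<dots> = ennreal (Gamma s / \<gamma> powr s)"
    unfolding h_def by (rule nn_integral_Gamma_scaled[OF s \<gamma>])
  finally have int_h: "(\<integral>\<^sup>+t. ennreal (h t) * indicator {0..} t \<partial>lborel) = ennreal (Gamma s / \<gamma> powr s)" .
  define w where "w = (\<lambda>x r. ennreal (1/2 * exp (- k * x - \<gamma> * x\<^sup>2)) * (ennreal (h (r\<^sup>2 - x\<^sup>2) * (2 * r)) * indicator {\<bar>x\<bar>..} r))"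
  have [measurable]: "(\<lambda>(x, r). w x r) \<in> borel_measurable (lborel \<Otimes>\<^sub>M lborel)"
  proof -
    have "w x r = ennreal (1/2 * exp (- k * x - \<gamma> * x\<^sup>2)) * (ennreal (h (r\<^sup>2 - x\<^sup>2) * (2 * r)) * indicator {z. \<bar>fst z\<bar> \<le> snd z} (x, r))" for x r
      by (simp add: w_def indicator_def)
    then show ?thesis by simp
  qed
  have "(\<integral>\<^sup>+r. ennreal (exp (- \<gamma> * r\<^sup>2)) * indicator {0<..} r *
            (ennreal (r powr (m - 1)) * (\<integral>\<^sup>+\<theta>. ennreal (sin \<theta> powr (m - 2) * exp (k * r * cos \<theta>)) * indicator {0..pi} \<theta> \<partial>lborel)) \<partial>lborel)
     = (\<integral>\<^sup>+r. \<integral>\<^sup>+x. w x r \<partial>lborel \<partial>lborel)"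
  proof (rule nn_integral_cong)
    fix r :: real
    show "ennreal (exp (- \<gamma> * r\<^sup>2)) * indicator {0<..} r *
            (ennreal (r powr (m - 1)) * (\<integral>\<^sup>+\<theta>. ennreal (sin \<theta> powr (m - 2) * exp (k * r * cos \<theta>)) * indicator {0..pi} \<theta> \<partial>lborel))
        = (\<integral>\<^sup>+x. w x r \<partial>lborel)"
    proof (cases "r > 0")
      case True
      have "ennreal (exp (- \<gamma> * r\<^sup>2)) * (\<integral>\<^sup>+x. ennreal (r * ((r\<^sup>2 - x\<^sup>2) powr ((m - 3) / 2) * exp (- k * x))) * indicator {- r..r} x \<partial>lborel)
          = (\<integral>\<^sup>+x. ennreal (exp (- \<gamma> * r\<^sup>2)) * (ennreal (r * ((r\<^sup>2 - x\<^sup>2) powr ((m - 3) / 2) * exp (- k * x))) * indicator {- r..r} x) \<partial>lborel)"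
        by (rule nn_integral_cmult[symmetric]) measurable
      also have "\<dots> = (\<integral>\<^sup>+x. w x r \<partial>lborel)"
      proof (rule nn_integral_cong)
        fix x :: real
        have "s - 1 = (m - 3) / 2" by (simp add: s_def field_simps)
        then have pw: "(r\<^sup>2 - x\<^sup>2) powr ((m - 3) / 2) = (r\<^sup>2 - x\<^sup>2) powr (s - 1)" by (simp only:)
        have "exp (- \<gamma> * r\<^sup>2) * (r * ((r\<^sup>2 - x\<^sup>2) powr ((m - 3) / 2) * exp (- k * x))) =
            1/2 * exp (- k * x - \<gamma> * x\<^sup>2) * (h (r\<^sup>2 - x\<^sup>2) * (2 * r))"
          unfolding pw by (simp add: h_def exp_diff exp_minus right_diff_distrib field_simps)
        then have "ennreal (exp (- \<gamma> * r\<^sup>2)) * ennreal (r * ((r\<^sup>2 - x\<^sup>2) powr ((m - 3) / 2) * exp (- k * x))) =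
            ennreal (1/2 * exp (- k * x - \<gamma> * x\<^sup>2)) * ennreal (h (r\<^sup>2 - x\<^sup>2) * (2 * r))"
          using True h0 by (subst (1 2) ennreal_mult[symmetric]) auto
        then show "ennreal (exp (- \<gamma> * r\<^sup>2)) * (ennreal (r * ((r\<^sup>2 - x\<^sup>2) powr ((m - 3) / 2) * exp (- k * x))) * indicator {- r..r} x) = w x r"
          unfolding w_def by (auto simp: indicator_def)
      qed
      finally show ?thesis using True unfolding nn_integral_polar_slice[OF True] by simp
    next
      case False
      have "w x r = 0" for x
        using False h0[of "r\<^sup>2 - x\<^sup>2"] by (auto simp: w_def indicator_def mult_nonneg_nonpos ennreal_neg)
      then show ?thesis using False by simp
    qed
  qed
  also have "\<dots> = (\<integral>\<^sup>+x. \<integral>\<^sup>+r. w x r \<partial>lborel \<partial>lborel)"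
    by (rule lborel_pair.Fubini') measurable
  also have "\<dots> = (\<integral>\<^sup>+x. ennreal (1/2 * (Gamma s / \<gamma> powr s) * exp (k\<^sup>2 / (4 * \<gamma>))) * ennreal (exp (- \<gamma> * (x - (- k / (2 * \<gamma>)))\<^sup>2)) \<partial>lborel)"
  proof (rule nn_integral_cong)
    fix x :: real
    have "(\<integral>\<^sup>+r. w x r \<partial>lborel) = ennreal (1/2 * exp (- k * x - \<gamma> * x\<^sup>2)) * ennreal (Gamma s / \<gamma> powr s)"
    proof -
      have "(\<integral>\<^sup>+r. ennreal (h (r\<^sup>2 - x\<^sup>2) * (2 * r)) * indicator {\<bar>x\<bar>..} r \<partial>lborel) = ennreal (Gamma s / \<gamma> powr s)"
        using nn_integral_square_substitution[of h x] h0 int_h by simp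
      then show ?thesis
        unfolding w_def by (subst nn_integral_cmult) auto
    qed
    also have "- k * x - \<gamma> * x\<^sup>2 = k\<^sup>2 / (4 * \<gamma>) + - \<gamma> * (x - (- k / (2 * \<gamma>)))\<^sup>2"
      using \<gamma> by (simp add: field_simps power2_eq_square)
    finally have "(\<integral>\<^sup>+r. w x r \<partial>lborel) = ennreal (1/2 * (exp (k\<^sup>2 / (4 * \<gamma>)) * exp (- \<gamma> * (x - (- k / (2 * \<gamma>)))\<^sup>2))) * ennreal (Gamma s / \<gamma> powr s)"
      by (simp only: exp_add)
    also have "\<dots> = ennreal (1/2 * (exp (k\<^sup>2 / (4 * \<gamma>)) * exp (- \<gamma> * (x - (- k / (2 * \<gamma>)))\<^sup>2)) * (Gamma s / \<gamma> powr s))"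
      using s by (intro ennreal_mult[symmetric]) auto
    also have "1/2 * (exp (k\<^sup>2 / (4 * \<gamma>)) * exp (- \<gamma> * (x - (- k / (2 * \<gamma>)))\<^sup>2)) * (Gamma s / \<gamma> powr s) =
        (1/2 * (Gamma s / \<gamma> powr s) * exp (k\<^sup>2 / (4 * \<gamma>))) * exp (- \<gamma> * (x - (- k / (2 * \<gamma>)))\<^sup>2)"
      by (simp only: mult_ac)
    also have "ennreal \<dots> = ennreal (1/2 * (Gamma s / \<gamma> powr s) * exp (k\<^sup>2 / (4 * \<gamma>))) * ennreal (exp (- \<gamma> * (x - (- k / (2 * \<gamma>)))\<^sup>2))"
      using s by (intro ennreal_mult) auto
    finally show "(\<integral>\<^sup>+r. w x r \<partial>lborel) = ennreal (1/2 * (Gamma s / \<gamma> powr s) * exp (k\<^sup>2 / (4 * \<gamma>))) * ennreal (exp (- \<gamma> * (x - (- k / (2 * \<gamma>)))\<^sup>2))" .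
  qed
  also have "\<dots> = ennreal (1/2 * (Gamma s / \<gamma> powr s) * exp (k\<^sup>2 / (4 * \<gamma>))) * ennreal (sqrt (pi / \<gamma>))"
    by (subst nn_integral_cmult) (simp_all only: nn_integral_gaussian[OF \<gamma>], measurable)
  also have "\<dots> = ennreal (Gamma s / (2 * pi powr s) * ((pi / \<gamma>) powr (m / 2) * exp (k\<^sup>2 / (4 * \<gamma>))))"
  proof -
    have m2: "m / 2 = s + 1 / 2" by (simp add: s_def field_simps)
    have "(pi / \<gamma>) powr (m / 2) = pi powr s / \<gamma> powr s * sqrt (pi / \<gamma>)"
      unfolding m2 using \<gamma> by (simp add: powr_add powr_divide powr_half_sqrt[symmetric])
    then show ?thesis using s \<gamma> by (simp add: ennreal_mult[symmetric] field_simps)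
  qed
  finally show ?thesis unfolding s_def .
qed

lemma measurable_polar_measure [measurable_cong]:
  "sets (polar_measure m) = sets (borel \<Otimes>\<^sub>M borel)"
  unfolding polar_measure_def by simp

lemma gaussian_pair_polar:
  fixes m q :: real
  assumes m: "2 < m" "m < 6"
  shows "gaussian_pair (polar_measure m) (\<lambda>(r, \<theta>). r\<^sup>2 - r * q * cos \<theta> + q\<^sup>2 / 4) (\<lambda>(r, \<theta>). 2 * r\<^sup>2 + q\<^sup>2 / 2) (m / 2 - 1) q"
proof -
  define C where "C = 2 * pi powr ((m - 1) / 2) / Gamma ((m - 1) / 2)"
  have C: "C > 0" using m by (auto simp: C_def intro!: divide_pos_pos Gamma_real_pos)
  define \<omega> where "\<omega> = (\<lambda>(r, \<theta>). C * (indicator {0<..} r * r powr (m - 1) * (indicator {0..pi} \<theta> * sin \<theta> powr (m - 2))))"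
  have \<omega>: "polar_measure m = density (lborel \<Otimes>\<^sub>M lborel) (\<lambda>z. ennreal (\<omega> z))"
    unfolding polar_measure_def \<omega>_def C_def by (simp add: case_prod_unfold)
  have [measurable]: "\<omega> \<in> borel_measurable (borel \<Otimes>\<^sub>M borel)"
    unfolding \<omega>_def by measurable
  interpret sigma_finite_measure "polar_measure m"
    unfolding \<omega>
    by (subst sigma_finite_measure.sigma_finite_iff_density_finite[OF lborel_pair.sigma_finite_measure_axioms]) auto
  show ?thesis
  proof
    \<comment> \<open>for \<open>r > 0\<close>, \<open>A\<close> can vanish only where \<open>sin \<theta> = 0\<close>, and there the weight vanishes\<close>
    show "AE z in polar_measure m. 0 < (case z of (r, \<theta>) \<Rightarrow> r\<^sup>2 - r * q * cos \<theta> + q\<^sup>2 / 4)"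
      unfolding \<omega>
    proof (subst AE_density, measurable, rule AE_I2, clarify)
      fix r \<theta> :: real assume pos: "0 < ennreal (\<omega> (r, \<theta>))"
      have r: "r > 0"
        by (rule ccontr) (use pos in \<open>simp add: \<omega>_def\<close>)
      have s: "sin \<theta> \<noteq> 0"
        by (rule notI) (use pos in \<open>simp add: \<omega>_def\<close>)
      have eq: "r\<^sup>2 - r * q * cos \<theta> + q\<^sup>2 / 4 = (r - q / 2 * cos \<theta>)\<^sup>2 + (q / 2 * sin \<theta>)\<^sup>2"
        by (simp add: power2_diff power_mult_distrib power_divide sin_squared_eq field_simps)
      have "\<not> (r - q / 2 * cos \<theta> = 0 \<and> q / 2 * sin \<theta> = 0)"
        using r s by auto
      then show "0 < r\<^sup>2 - r * q * cos \<theta> + q\<^sup>2 / 4"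
        unfolding eq using sum_power2_gt_zero_iff by blast
    qed
    fix \<alpha> \<beta> :: real assume \<alpha>: "\<alpha> > 0" and \<beta>: "\<beta> > 0"
    define \<gamma> where "\<gamma> = \<alpha> + 2 * \<beta>"
    have \<gamma>: "\<gamma> > 0" using \<alpha> \<beta> by (simp add: \<gamma>_def)
    define k where "k = \<alpha> * q"
    define E where "E = - \<alpha> * q\<^sup>2 / 4 - \<beta> * q\<^sup>2 / 2"
    define f where "f = (\<lambda>(r, \<theta>). exp (- \<alpha> * (r\<^sup>2 - r * q * cos \<theta> + q\<^sup>2 / 4) - \<beta> * (2 * r\<^sup>2 + q\<^sup>2 / 2)))"
    have [measurable]: "f \<in> borel_measurable (borel \<Otimes>\<^sub>M borel)"
      unfolding f_def by measurable
    have f_eq: "f (r, \<theta>) = exp E * exp (- \<gamma> * r\<^sup>2) * exp (k * r * cos \<theta>)" for r \<theta>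
      unfolding f_def k_def E_def \<gamma>_def by (simp add: exp_add[symmetric] algebra_simps)
    have "(\<integral>\<^sup>+z. ennreal (f z) \<partial>polar_measure m) = (\<integral>\<^sup>+z. ennreal (\<omega> z) * ennreal (f z) \<partial>(lborel \<Otimes>\<^sub>M lborel))"
      unfolding \<omega> by (rule nn_integral_density) measurable
    also have "\<dots> = (\<integral>\<^sup>+r. \<integral>\<^sup>+\<theta>. ennreal (\<omega> (r, \<theta>)) * ennreal (f (r, \<theta>)) \<partial>lborel \<partial>lborel)"
      by (rule lborel.nn_integral_fst[symmetric]) measurable
    also have "\<dots> = (\<integral>\<^sup>+r. ennreal (C * exp E) * (ennreal (exp (- \<gamma> * r\<^sup>2)) * indicator {0<..} r *
            (ennreal (r powr (m - 1)) * (\<integral>\<^sup>+\<theta>. ennreal (sin \<theta> powr (m - 2) * exp (k * r * cos \<theta>)) * indicator {0..pi} \<theta> \<partial>lborel))) \<partial>lborel)"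
    proof (rule nn_integral_cong)
      fix r :: real
      have "(\<integral>\<^sup>+\<theta>. ennreal (\<omega> (r, \<theta>)) * ennreal (f (r, \<theta>)) \<partial>lborel) =
          (\<integral>\<^sup>+\<theta>. (ennreal (C * exp E) * (ennreal (exp (- \<gamma> * r\<^sup>2)) * indicator {0<..} r * ennreal (r powr (m - 1)))) *
             (ennreal (sin \<theta> powr (m - 2) * exp (k * r * cos \<theta>)) * indicator {0..pi} \<theta>) \<partial>lborel)"
        using C
        by (intro nn_integral_cong) (auto simp: f_eq \<omega>_def indicator_def ennreal_mult[symmetric] mult_ac)
      also have "\<dots> = (ennreal (C * exp E) * (ennreal (exp (- \<gamma> * r\<^sup>2)) * indicator {0<..} r * ennreal (r powr (m - 1)))) *
          (\<integral>\<^sup>+\<theta>. (ennreal (sin \<theta> powr (m - 2) * exp (k * r * cos \<theta>)) * indicator {0..pi} \<theta>) \<partial>lborel)"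
        by (rule nn_integral_cmult) measurable
      finally show "(\<integral>\<^sup>+\<theta>. ennreal (\<omega> (r, \<theta>)) * ennreal (f (r, \<theta>)) \<partial>lborel) =
        ennreal (C * exp E) * (ennreal (exp (- \<gamma> * r\<^sup>2)) * indicator {0<..} r *
            (ennreal (r powr (m - 1)) * (\<integral>\<^sup>+\<theta>. ennreal (sin \<theta> powr (m - 2) * exp (k * r * cos \<theta>)) * indicator {0..pi} \<theta> \<partial>lborel)))"
        by (simp only: mult.assoc)
    qed
    also have "\<dots> = ennreal (C * exp E) * ennreal (Gamma ((m - 1) / 2) / (2 * pi powr ((m - 1) / 2)) * ((pi / \<gamma>) powr (m / 2) * exp (k\<^sup>2 / (4 * \<gamma>))))"
      using m by (subst nn_integral_cmult) (simp_all only: nn_integral_polar_gaussian[OF _ \<gamma>], measurable)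
    also have "\<dots> = ennreal ((pi / \<gamma>) powr (m / 2) * exp (E + k\<^sup>2 / (4 * \<gamma>)))"
    proof -
      have "C * (Gamma ((m - 1) / 2) / (2 * pi powr ((m - 1) / 2))) = 1"
        using C unfolding C_def by (auto simp: field_simps)
      then have "C * exp E * (Gamma ((m - 1) / 2) / (2 * pi powr ((m - 1) / 2)) * ((pi / \<gamma>) powr (m / 2) * exp (k\<^sup>2 / (4 * \<gamma>)))) =
          (pi / \<gamma>) powr (m / 2) * exp (E + k\<^sup>2 / (4 * \<gamma>))"
      proof -
        assume 1: "C * (Gamma ((m - 1) / 2) / (2 * pi powr ((m - 1) / 2))) = 1"
        have "C * e * (G * (w * f)) = w * (e * f)" if "C * G = 1" for e G w f
        proof -
          have "C * e * (G * (w * f)) = (C * G) * (w * (e * f))" by (simp only: mult_ac)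
          then show ?thesis using that by simp
        qed
        from this[OF 1] show ?thesis unfolding exp_add .
      qed
      then show ?thesis using C by (simp add: ennreal_mult'[symmetric])
    qed
    also have "E + k\<^sup>2 / (4 * \<gamma>) = - (\<alpha> * \<beta> * q\<^sup>2 / (2 * \<gamma>)) - \<beta> * q\<^sup>2 / 2"
    proof -
      have "\<alpha> * q\<^sup>2 / 4 = \<alpha> * (\<alpha> + 2 * \<beta>) * q\<^sup>2 / (4 * \<gamma>)" using \<gamma> by (simp add: \<gamma>_def[symmetric])
      also have "\<dots> = k\<^sup>2 / (4 * \<gamma>) + \<alpha> * \<beta> * q\<^sup>2 / (2 * \<gamma>)"
        using \<gamma> by (simp add: k_def field_simps power2_eq_square)
      finally show ?thesis unfolding E_def by linarith
    qed
    finally show "(\<integral>\<^sup>+z. ennreal (exp (- \<alpha> * (case z of (r, \<theta>) \<Rightarrow> r\<^sup>2 - r * q * cos \<theta> + q\<^sup>2 / 4) - \<beta> * (case z of (r, \<theta>) \<Rightarrow> 2 * r\<^sup>2 + q\<^sup>2 / 2))) \<partial>polar_measure m)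
     = ennreal ((pi / (\<alpha> + 2 * \<beta>)) powr (1 + (m / 2 - 1)) * exp (- (\<alpha> * \<beta> * q\<^sup>2 / (2 * (\<alpha> + 2 * \<beta>))) - \<beta> * q\<^sup>2 / 2))"
      by (simp add: f_def case_prod_unfold \<gamma>_def)
  qed (use m in \<open>auto\<close>)
qed

section \<open>The integral over \<open>x\<close>\<close>

text \<open>
  The primitive \<open>F\<close> comes from partial fractions. Their common denominator
  \<open>N = (P\<^sup>2 + (a + b)\<^sup>2) (P\<^sup>2 + (a - b)\<^sup>2)\<close> does not vanish because \<open>P \<noteq> 0\<close>. The logarithm tends to \<open>0\<close> at both
  ends, so only the two arctangents contribute.
\<close>

lemma integral_Lorentz_product:
  fixes P a b :: real
  assumes P: "P \<noteq> 0" and a: "a > 0" and b: "b > 0"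
  shows "(LINT x|lborel. 1 / ((x - P / 2)\<^sup>2 + a\<^sup>2) * (1 / ((x + P / 2)\<^sup>2 + b\<^sup>2))) =
           pi * (a + b) / (a * b * (P\<^sup>2 + (a + b)\<^sup>2))"
proof -
  define N where "N = (P\<^sup>2 + (a + b)\<^sup>2) * (P\<^sup>2 + (a - b)\<^sup>2)"
  have N: "N \<noteq> 0" using P by (auto simp: N_def add_nonneg_eq_0_iff)
  define F where "F = (\<lambda>x. - P / N * ln (((x - P / 2)\<^sup>2 + a\<^sup>2) / ((x + P / 2)\<^sup>2 + b\<^sup>2))
      + (P\<^sup>2 + b\<^sup>2 - a\<^sup>2) / (N * a) * arctan ((x - P / 2) / a)
      + (P\<^sup>2 + a\<^sup>2 - b\<^sup>2) / (N * b) * arctan ((x + P / 2) / b))"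
  define f where "f = (\<lambda>x. 1 / ((x - P / 2)\<^sup>2 + a\<^sup>2) * (1 / ((x + P / 2)\<^sup>2 + b\<^sup>2)))"
  define L where "L = ((P\<^sup>2 + b\<^sup>2 - a\<^sup>2) / (N * a) + (P\<^sup>2 + a\<^sup>2 - b\<^sup>2) / (N * b)) * (pi / 2)"
  have pos: "(x - P / 2)\<^sup>2 + a\<^sup>2 > 0" "(x + P / 2)\<^sup>2 + b\<^sup>2 > 0" for x
    using a b by (auto intro!: add_nonneg_pos)
  have deriv: "DERIV F x :> f x" for x
  proof -
    define X Y where "X = (x - P / 2)\<^sup>2 + a\<^sup>2" and "Y = (x + P / 2)\<^sup>2 + b\<^sup>2"
    have XY: "X > 0" "Y > 0" unfolding X_def Y_def by (rule pos)+
    have 1: "((\<lambda>x. ln (((x - P / 2)\<^sup>2 + a\<^sup>2) / ((x + P / 2)\<^sup>2 + b\<^sup>2))) has_real_derivative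
        2 * (x - P / 2) / X - 2 * (x + P / 2) / Y) (at x)"
    proof -
      have "(\<lambda>x. ln (((x - P / 2)\<^sup>2 + a\<^sup>2) / ((x + P / 2)\<^sup>2 + b\<^sup>2))) =
          (\<lambda>x. ln ((x - P / 2)\<^sup>2 + a\<^sup>2) - ln ((x + P / 2)\<^sup>2 + b\<^sup>2))"
      proof
        fix x
        show "ln (((x - P / 2)\<^sup>2 + a\<^sup>2) / ((x + P / 2)\<^sup>2 + b\<^sup>2)) =
          ln ((x - P / 2)\<^sup>2 + a\<^sup>2) - ln ((x + P / 2)\<^sup>2 + b\<^sup>2)"
          using pos[of x] by (subst ln_div) auto
      qed
      moreover have "((\<lambda>x. ln ((x - P / 2)\<^sup>2 + a\<^sup>2)) has_real_derivative 2 * (x - P / 2) / X) (at x)"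
        using pos(1)[of x] unfolding X_def by (auto intro!: derivative_eq_intros)
      moreover have "((\<lambda>x. ln ((x + P / 2)\<^sup>2 + b\<^sup>2)) has_real_derivative 2 * (x + P / 2) / Y) (at x)"
        using pos(2)[of x] unfolding Y_def by (auto intro!: derivative_eq_intros)
      ultimately show ?thesis
        by (simp only:) (intro DERIV_diff)
    qed
    have arctan_deriv: "((\<lambda>x. arctan ((x + d) / c)) has_real_derivative c / ((x + d)\<^sup>2 + c\<^sup>2)) (at x)"
      if "c > 0" for c d :: real
    proof -
      have c: "c \<noteq> 0" using that by simp
      have "((\<lambda>x. (x + d) / c) has_real_derivative 1 / c) (at x)"
        using c by (auto intro!: derivative_eq_intros)
      from DERIV_chain2[OF DERIV_arctan this]
      have "((\<lambda>x. arctan ((x + d) / c)) has_real_derivative inverse (1 + ((x + d) / c)\<^sup>2) * (1 / c)) (at x)" .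
      moreover have "1 + ((x + d) / c)\<^sup>2 = ((x + d)\<^sup>2 + c\<^sup>2) / c\<^sup>2"
        unfolding power_divide using c by (simp add: add_divide_distrib)
      then have "inverse (1 + ((x + d) / c)\<^sup>2) * (1 / c) = c / ((x + d)\<^sup>2 + c\<^sup>2)"
        using c by (simp add: power2_eq_square)
      ultimately show ?thesis by (simp only:)
    qed
    have 2: "((\<lambda>x. arctan ((x - P / 2) / a)) has_real_derivative a / X) (at x)"
      using arctan_deriv[OF a, of "- (P / 2)"] unfolding X_def by simp
    have 3: "((\<lambda>x. arctan ((x + P / 2) / b)) has_real_derivative b / Y) (at x)"
      using arctan_deriv[OF b, of "P / 2"] unfolding Y_def .
    have "- P / N * (2 * A / X - 2 * B / Y) + K / (N * a) * (a / X) + K' / (N * b) * (b / Y)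
        = ((- 2 * P * A + K) * Y + (2 * P * B + K') * X) / (N * X * Y)" for A B K K'
      using N XY a b by (simp add: field_simps)
    then have "- P / N * (2 * (x - P / 2) / X - 2 * (x + P / 2) / Y) + (P\<^sup>2 + b\<^sup>2 - a\<^sup>2) / (N * a) * (a / X) + (P\<^sup>2 + a\<^sup>2 - b\<^sup>2) / (N * b) * (b / Y)
        = ((- 2 * P * (x - P / 2) + (P\<^sup>2 + b\<^sup>2 - a\<^sup>2)) * Y + (2 * P * (x + P / 2) + (P\<^sup>2 + a\<^sup>2 - b\<^sup>2)) * X) / (N * X * Y)" .
    also have "(- 2 * P * (x - P / 2) + (P\<^sup>2 + b\<^sup>2 - a\<^sup>2)) * Y + (2 * P * (x + P / 2) + (P\<^sup>2 + a\<^sup>2 - b\<^sup>2)) * X = N"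
      unfolding N_def X_def Y_def by (simp add: power2_eq_square algebra_simps) 
    also have "N / (N * X * Y) = f x"
      using N XY by (simp add: f_def X_def Y_def)
    finally have eq: "- P / N * (2 * (x - P / 2) / X - 2 * (x + P / 2) / Y) + (P\<^sup>2 + b\<^sup>2 - a\<^sup>2) / (N * a) * (a / X) + (P\<^sup>2 + a\<^sup>2 - b\<^sup>2) / (N * b) * (b / Y) = f x" .
    show ?thesis
      unfolding F_def eq[symmetric]
      by (intro DERIV_add DERIV_cmult 1 2 3)
  qed
  have cont: "isCont f x" for x
    unfolding f_def using pos[of x] by (intro continuous_intros) auto
  have ln_lim: "((\<lambda>x. ln (((x - P / 2)\<^sup>2 + a\<^sup>2) / ((x + P / 2)\<^sup>2 + b\<^sup>2))) \<longlongrightarrow> 0) \<F>"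
    if \<F>: "\<F> \<le> at_infinity" for \<F>
  proof -
    \<comment> \<open>the quotient as a function of \<open>1/x\<close>, which is continuous at \<open>0\<close>\<close>
    define R where "R = (\<lambda>i. ((1 - P / 2 * i)\<^sup>2 + (a * i)\<^sup>2) / ((1 + P / 2 * i)\<^sup>2 + (b * i)\<^sup>2))"
    have "(inverse \<longlongrightarrow> (0::real)) \<F>"
      using \<F> tendsto_inverse_0 by (rule tendsto_mono)
    then have "((\<lambda>x. ln (R (inverse x))) \<longlongrightarrow> ln (R 0)) \<F>"
      unfolding R_def by (intro tendsto_intros) auto
    moreover have "\<forall>\<^sub>F x in \<F>. x \<noteq> (0::real)"
      using \<F> eventually_not_equal_at_infinity by (rule filter_leD)
    then have "\<forall>\<^sub>F x in \<F>. ln (R (inverse x)) = ln (((x - P / 2)\<^sup>2 + a\<^sup>2) / ((x + P / 2)\<^sup>2 + b\<^sup>2))"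
    proof eventually_elim
      fix x :: real assume x: "x \<noteq> 0"
      have "(x - P / 2)\<^sup>2 + a\<^sup>2 = x\<^sup>2 * ((1 - P / 2 * inverse x)\<^sup>2 + (a * inverse x)\<^sup>2)"
        "(x + P / 2)\<^sup>2 + b\<^sup>2 = x\<^sup>2 * ((1 + P / 2 * inverse x)\<^sup>2 + (b * inverse x)\<^sup>2)"
        using x by (simp_all add: distrib_left power_mult_distrib[symmetric] right_diff_distrib mult.left_commute[of x])
      then show "ln (R (inverse x)) = ln (((x - P / 2)\<^sup>2 + a\<^sup>2) / ((x + P / 2)\<^sup>2 + b\<^sup>2))"
        using x by (simp add: R_def)
    qed
    ultimately have "((\<lambda>x. ln (((x - P / 2)\<^sup>2 + a\<^sup>2) / ((x + P / 2)\<^sup>2 + b\<^sup>2))) \<longlongrightarrow> ln (R 0)) \<F>"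
      by (rule Lim_transform_eventually)
    then show ?thesis by (simp add: R_def)
  qed
  have arctan_lim_top: "((\<lambda>x. arctan ((x + d) / c)) \<longlongrightarrow> pi / 2) at_top" if c: "c > 0" for c d :: real
  proof (rule filterlim_compose[OF tendsto_arctan_at_top])
    have "filterlim (\<lambda>x. d / c + 1 / c * x) at_top at_top"
      using c by (intro filterlim_tendsto_add_at_top[OF tendsto_const] filterlim_tendsto_pos_mult_at_top[OF tendsto_const] filterlim_ident) auto
    then show "filterlim (\<lambda>x. (x + d) / c) at_top at_top"
      by (simp add: add_divide_distrib add.commute)
  qed
  have arctan_lim_bot: "((\<lambda>x. arctan ((x + d) / c)) \<longlongrightarrow> - (pi / 2)) at_bot" if c: "c > 0" for c d :: real
  proof -
    have "((\<lambda>x. - arctan ((x + - d) / c)) \<longlongrightarrow> - (pi / 2)) at_top"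
      by (intro tendsto_minus arctan_lim_top c)
    moreover have "- arctan ((x + - d) / c) = arctan ((- x + d) / c)" for x
      unfolding arctan_minus[symmetric] by (simp add: minus_divide_left)
    ultimately show ?thesis
      by (simp add: at_bot_mirror filterlim_filtermap)
  qed
  have top: "(F \<longlongrightarrow> L) at_top"
  proof -
    from ln_lim[OF at_top_le_at_infinity] arctan_lim_top[OF a, of "- (P / 2)"] arctan_lim_top[OF b, of "P / 2"]
    have "(F \<longlongrightarrow> - P / N * 0 + (P\<^sup>2 + b\<^sup>2 - a\<^sup>2) / (N * a) * (pi / 2) + (P\<^sup>2 + a\<^sup>2 - b\<^sup>2) / (N * b) * (pi / 2)) at_top"
      unfolding F_def by (intro tendsto_add tendsto_mult tendsto_const) simp_all
    then show ?thesis unfolding L_def by (simp only: distrib_right mult_zero_right add_0_left)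
  qed
  have bot: "(F \<longlongrightarrow> - L) at_bot"
  proof -
    from ln_lim[OF at_bot_le_at_infinity] arctan_lim_bot[OF a, of "- (P / 2)"] arctan_lim_bot[OF b, of "P / 2"]
    have "(F \<longlongrightarrow> - P / N * 0 + (P\<^sup>2 + b\<^sup>2 - a\<^sup>2) / (N * a) * - (pi / 2) + (P\<^sup>2 + a\<^sup>2 - b\<^sup>2) / (N * b) * - (pi / 2)) at_bot"
      unfolding F_def by (intro tendsto_add tendsto_mult tendsto_const) simp_all
    then show ?thesis unfolding L_def
      by (simp only: distrib_right mult_zero_right add_0_left mult_minus_right minus_add_distrib)
  qed
  have "(LBINT x=-\<infinity>..\<infinity>. f x) = L - (- L)"
  proof (rule interval_integral_FTC_nonneg(2))
    show "AE x in lborel. - \<infinity> < ereal x \<longrightarrow> ereal x < \<infinity> \<longrightarrow> 0 \<le> f x"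
      using pos by (auto simp: f_def less_imp_le)
  qed (use deriv cont top bot in \<open>auto simp: ereal_tendsto_simps\<close>)
  moreover have "einterval (-\<infinity>) \<infinity> = UNIV" by (auto simp: einterval_iff)
  ultimately have "(LINT x|lborel. f x) = 2 * L"
    by (simp add: interval_lebesgue_integral_def set_lebesgue_integral_def)
  also have "2 * L = pi * (a + b) / (a * b * (P\<^sup>2 + (a + b)\<^sup>2))"
  proof -
    have N2: "P\<^sup>2 + (a - b)\<^sup>2 \<noteq> 0" using P by (auto simp: add_nonneg_eq_0_iff)
    have "(P\<^sup>2 + b\<^sup>2 - a\<^sup>2) / (N * a) + (P\<^sup>2 + a\<^sup>2 - b\<^sup>2) / (N * b) = (b * (P\<^sup>2 + b\<^sup>2 - a\<^sup>2) + a * (P\<^sup>2 + a\<^sup>2 - b\<^sup>2)) / (N * (a * b))"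
      using N a b by (simp add: field_simps)
    also have "b * (P\<^sup>2 + b\<^sup>2 - a\<^sup>2) + a * (P\<^sup>2 + a\<^sup>2 - b\<^sup>2) = (a + b) * (P\<^sup>2 + (a - b)\<^sup>2)"
      by (simp add: power2_eq_square algebra_simps)
    also have "\<dots> / (N * (a * b)) = (a + b) / (a * b * (P\<^sup>2 + (a + b)\<^sup>2))"
      using N2 unfolding N_def by (simp add: mult_ac)
    finally show ?thesis unfolding L_def by simp
  qed
  finally show ?thesis by (simp add: f_def)
qed

lemma x_integral_real:
  fixes P u v :: real
  assumes P: "P \<noteq> 0" and u: "u\<^sup>2 > 0" and v: "v\<^sup>2 > 0"
  shows "x_integral P u v = 1/2 * (1 / (u\<^sup>2 * (\<bar>P\<bar>\<^sup>2 + (u\<^sup>2 + v\<^sup>2)\<^sup>2))) + 1/2 * (1 / (v\<^sup>2 * (\<bar>P\<bar>\<^sup>2 + (u\<^sup>2 + v\<^sup>2)\<^sup>2)))"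
proof -
  have "x_integral P u v = pi * (u\<^sup>2 + v\<^sup>2) / (u\<^sup>2 * v\<^sup>2 * (P\<^sup>2 + (u\<^sup>2 + v\<^sup>2)\<^sup>2)) / (2 * pi)"
  proof -
    have "P /\<^sub>R 2 = P / 2" by simp
    moreover have "t ^ 4 = (t\<^sup>2)\<^sup>2" for t :: real by (simp flip: power_mult)
    ultimately show ?thesis
      unfolding x_integral_def integral_Lorentz_product[OF P u v, symmetric]
      by (simp only: real_norm_def power2_abs DIM_real power_one_right)
  qed
  also have "\<dots> = (u\<^sup>2 + v\<^sup>2) / (u\<^sup>2 * v\<^sup>2) / (2 * (P\<^sup>2 + (u\<^sup>2 + v\<^sup>2)\<^sup>2))"
  proof -
    have "pi * s / (t * d) / (2 * pi) = s / t / (2 * d)" for s t d :: real by simp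
    then show ?thesis .
  qed
  also have "(u\<^sup>2 + v\<^sup>2) / (u\<^sup>2 * v\<^sup>2) = 1 / u\<^sup>2 + 1 / v\<^sup>2"
    using u v by (simp add: field_simps)
  also have "(1 / u\<^sup>2 + 1 / v\<^sup>2) / (2 * (P\<^sup>2 + (u\<^sup>2 + v\<^sup>2)\<^sup>2)) =
      1/2 * (1 / (u\<^sup>2 * (P\<^sup>2 + (u\<^sup>2 + v\<^sup>2)\<^sup>2))) + 1/2 * (1 / (v\<^sup>2 * (P\<^sup>2 + (u\<^sup>2 + v\<^sup>2)\<^sup>2)))"
  proof -
    have "(1 / s + 1 / t) / (2 * d) = 1/2 * (1 / (s * d)) + 1/2 * (1 / (t * d))" for s t d :: real
      by (simp add: add_divide_distrib)
    then show ?thesis .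
  qed
  finally show ?thesis by (simp only: power2_abs)
qed

lemma x_integral_measurable [measurable]:
  fixes P :: real
  shows "(\<lambda>(u, v). x_integral P u v) \<in> borel_measurable (borel \<Otimes>\<^sub>M borel)"
  unfolding x_integral_def by measurable

section \<open>The two momentum integrals\<close>

text \<open>
  The terms with \<open>1/A\<close> and \<open>1/B\<close> contribute equally, because the result for one centre depends on \<open>q\<close> only
  through its square.
\<close>

lemma integral_x_integral:
  fixes P :: real
  assumes GA: "gaussian_pair M A S \<epsilon> q" and GB: "gaussian_pair M B S \<epsilon> q'" and q': "q'\<^sup>2 = q\<^sup>2"
    and S: "\<And>y. S y = A y + B y"
    and [measurable]: "u \<in> borel_measurable M" "v \<in> borel_measurable M"
    and u: "\<And>y. (u y)\<^sup>2 = A y" and v: "\<And>y. (v y)\<^sup>2 = B y"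
    and P: "P \<noteq> 0"
  shows "integrable M (\<lambda>y. x_integral P (u y) (v y))"
    and "(LINT y|M. x_integral P (u y) (v y)) / (2 * pi) powr (2 + 2 * \<epsilon>) = reduced_integral \<bar>P\<bar> q \<epsilon>"
proof -
  have p: "\<bar>P\<bar> > 0" using P by simp
  define fA where "fA = (\<lambda>y. 1 / (A y * (\<bar>P\<bar>\<^sup>2 + (S y)\<^sup>2)))"
  define fB where "fB = (\<lambda>y. 1 / (B y * (\<bar>P\<bar>\<^sup>2 + (S y)\<^sup>2)))"
  have AE: "AE y in M. x_integral P (u y) (v y) = 1/2 * fA y + 1/2 * fB y"
    using gaussian_pair.A_pos[OF GA] gaussian_pair.A_pos[OF GB]
  proof eventually_elim
    fix y assume "A y > 0" "B y > 0"
    then show "x_integral P (u y) (v y) = 1/2 * fA y + 1/2 * fB y"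
      using x_integral_real[OF P, of "u y" "v y"] unfolding u v fA_def fB_def S by simp
  qed
  have int: "integrable M fA" "integrable M fB"
    unfolding fA_def fB_def by (rule gaussian_pair.integrable_propagator[OF GA p] gaussian_pair.integrable_propagator[OF GB p])+
  have meas: "(\<lambda>y. x_integral P (u y) (v y)) \<in> borel_measurable M" by measurable
  show "integrable M (\<lambda>y. x_integral P (u y) (v y))"
    using int by (subst integrable_cong_AE[OF meas _ AE]) auto
  have "(LINT y|M. x_integral P (u y) (v y)) = (LINT y|M. 1/2 * fA y + 1/2 * fB y)"
    using int by (intro integral_cong_AE[OF meas _ AE]) auto
  also have "\<dots> = 1/2 * integral\<^sup>L M fA + 1/2 * integral\<^sup>L M fB"
    using int by simp
  also have "\<dots> = integral\<^sup>L M fA"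
    unfolding fA_def fB_def gaussian_pair.propagator_integral[OF GA p] gaussian_pair.propagator_integral[OF GB p] q' by simp
  finally show "(LINT y|M. x_integral P (u y) (v y)) / (2 * pi) powr (2 + 2 * \<epsilon>) = reduced_integral \<bar>P\<bar> q \<epsilon>"
    unfolding fA_def gaussian_pair.propagator_integral[OF GA p] reduced_integral_def by simp
qed

lemma I_int_eq_reduced_integral:
  fixes P :: real and Q :: "'b::euclidean_space"
  assumes m: "2 < real DIM('b)" "real DIM('b) < 6" and P: "P \<noteq> 0"
  shows "I_int P Q = reduced_integral \<bar>P\<bar> (norm Q) (real DIM('b) / 2 - 1)"
proof -
  have G1: "gaussian_pair lborel (\<lambda>y. (norm (y - Q /\<^sub>R 2))\<^sup>2) (\<lambda>y. (norm (y - Q /\<^sub>R 2))\<^sup>2 + (norm (y + Q /\<^sub>R 2))\<^sup>2)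
     (real DIM('b) / 2 - 1) (norm Q)"
    by (rule gaussian_pair_euclidean[OF m refl])
  have G2: "gaussian_pair lborel (\<lambda>y. (norm (y + Q /\<^sub>R 2))\<^sup>2) (\<lambda>y. (norm (y - Q /\<^sub>R 2))\<^sup>2 + (norm (y + Q /\<^sub>R 2))\<^sup>2)
     (real DIM('b) / 2 - 1) (norm Q)"
    using gaussian_pair_euclidean[OF m refl, of "- Q"] by (simp add: add.commute)
  have "(LINT y|lborel. x_integral P (norm (y - Q /\<^sub>R 2)) (norm (y + Q /\<^sub>R 2))) / (2 * pi) powr (2 + 2 * (real DIM('b) / 2 - 1))
      = reduced_integral \<bar>P\<bar> (norm Q) (real DIM('b) / 2 - 1)"
    by (rule integral_x_integral(2)[OF G1 G2]) (use P in auto)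
  moreover have "(2 * pi) powr (2 + 2 * (real DIM('b) / 2 - 1)) = (2 * pi) ^ DIM('b)"
    by (simp add: powr_realpow)
  ultimately show ?thesis unfolding I_int_def by simp
qed

lemma I_cont_eq_reduced_integral:
  fixes P m q :: real
  assumes m: "2 < m" "m < 6" and P: "P \<noteq> 0"
  shows "I_cont m P q = reduced_integral \<bar>P\<bar> q (m / 2 - 1)"
proof -
  define C where "C = 2 * pi powr ((m - 1) / 2) / Gamma ((m - 1) / 2)"
  have "C > 0" using m by (auto simp: C_def intro!: divide_pos_pos Gamma_real_pos)
  then have C: "C \<noteq> 0" "C \<ge> 0" by auto
  define A where "A = (\<lambda>(q::real) (r::real, \<theta>). r\<^sup>2 - r * q * cos \<theta> + q\<^sup>2 / 4)"
  define S where "S = (\<lambda>(r::real, \<theta>::real). 2 * r\<^sup>2 + q\<^sup>2 / 2)"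
  have G1: "gaussian_pair (polar_measure m) (A q) S (m / 2 - 1) q"
    unfolding A_def S_def by (rule gaussian_pair_polar[OF m])
  have G2: "gaussian_pair (polar_measure m) (A (- q)) S (m / 2 - 1) (- q)"
    using gaussian_pair_polar[OF m, of "- q"] unfolding A_def S_def by simp
  have A_nonneg: "A s z \<ge> 0" for s z
  proof (cases z)
    case (Pair r \<theta>)
    have "A s z = (r - s / 2 * cos \<theta>)\<^sup>2 + (s / 2 * sin \<theta>)\<^sup>2"
      unfolding Pair A_def by (simp add: power2_diff power_mult_distrib power_divide sin_squared_eq field_simps)
    then show ?thesis by simp
  qed
  have [measurable]: "A s \<in> borel_measurable (polar_measure m)" for s unfolding A_def by measurable
  define X where "X = (\<lambda>z. x_integral P (sqrt (A q z)) (sqrt (A (- q) z)))"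
  have S_eq: "S z = A q z + A (- q) z" for z
    by (cases z) (simp add: A_def S_def)
  have sq: "(sqrt (A s z))\<^sup>2 = A s z" for s z
    using A_nonneg by simp
  have sq_meas: "(\<lambda>z. sqrt (A s z)) \<in> borel_measurable (polar_measure m)" for s
    by measurable
  note X = integral_x_integral[OF G1 G2 power2_minus S_eq sq_meas sq_meas sq sq P, folded X_def]
  define \<omega> where "\<omega> = (\<lambda>(r, \<theta>). indicator {0<..} r * r powr (m - 1) * (indicator {0..pi} \<theta> * sin \<theta> powr (m - 2)))"
  have \<omega>: "polar_measure m = density (lborel \<Otimes>\<^sub>M lborel) (\<lambda>z. ennreal (C * \<omega> z))"
    unfolding polar_measure_def \<omega>_def C_def by (simp add: case_prod_unfold)
  have [measurable]: "\<omega> \<in> borel_measurable (borel \<Otimes>\<^sub>M borel)" unfolding \<omega>_def by measurable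
  have \<omega>_nonneg: "\<omega> z \<ge> 0" for z by (simp add: \<omega>_def case_prod_unfold)
  have Xm [measurable]: "X \<in> borel_measurable (borel \<Otimes>\<^sub>M borel)"
    using borel_measurable_integrable[OF X(1)] by (simp cong: measurable_cong_sets add: measurable_polar_measure)
  have "integrable (lborel \<Otimes>\<^sub>M lborel) (\<lambda>z. (C * \<omega> z) *\<^sub>R X z)"
    using X(1) unfolding \<omega> using C \<omega>_nonneg by (subst (asm) integrable_density) auto
  then have int: "integrable (lborel \<Otimes>\<^sub>M lborel) (\<lambda>z. \<omega> z * X z)"
    using C(1) by (simp add: mult.assoc)
  have "(LINT z|polar_measure m. X z) = (LINT z|(lborel \<Otimes>\<^sub>M lborel). (C * \<omega> z) *\<^sub>R X z)"
    unfolding \<omega> using C \<omega>_nonneg by (intro integral_density) auto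
  also have "\<dots> = C * (LINT z|(lborel \<Otimes>\<^sub>M lborel). \<omega> z * X z)"
    by (simp add: mult.assoc)
  also have "(LINT z|(lborel \<Otimes>\<^sub>M lborel). \<omega> z * X z) = (LINT r|lborel. LINT \<theta>|lborel. \<omega> (r, \<theta>) * X (r, \<theta>))"
    by (rule lborel_pair.integral_fst'[OF int, symmetric])
  also have "\<dots> = (LINT r:{0<..}|lborel. r powr (m - 1) * (LINT \<theta>:{0..pi}|lborel. sin \<theta> powr (m - 2) * X (r, \<theta>)))"
    unfolding set_lebesgue_integral_def
    by (simp add: \<omega>_def mult.assoc)
  finally have "cont_dim_integral m (\<lambda>r \<theta>. X (r, \<theta>)) = (LINT z|polar_measure m. X z)"
    unfolding cont_dim_integral_def C_def by simp
  then show ?thesis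
    unfolding I_cont_def using X(2) by (simp add: X_def A_def)
qed

theorem proposition1:
  fixes P m \<epsilon> p q :: real
  assumes "2 < m" and "m < 6" and "\<epsilon> = m / 2 - 1"
    and "p = norm P" and "p > 0" and "q \<ge> 0"
  shows "equals_closed_form (I_cont m P q) p q \<epsilon> \<and>
    (\<forall>Q :: 'b::euclidean_space.
       m = real DIM('b) \<and> q = norm Q \<longrightarrow> equals_closed_form (I_int P Q) p q \<epsilon>)"
proof -
  have "equals_closed_form (reduced_integral p q \<epsilon>) p q \<epsilon>"
    using assms by (intro equals_closed_form_reduced_integral) auto
  moreover have "P \<noteq> 0" "p = \<bar>P\<bar>" using assms by auto
  ultimately show ?thesis
    using assms(1-3) I_cont_eq_reduced_integral[of m P q] I_int_eq_reduced_integral[where P = P and 'b = 'b] by auto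
qed

end
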